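(* Let $p$ be a prime and let $G$ be a finite $p$-group such that $G_3\le \Phi(G')\cong C_p$ and $G/\Phi(G')\cong M_p(n,m,1)$, where $n\ge m$, and $n>1$ if $p=2$. Then $G$ is isomorphic to one of the following groups, and the listed groups (different types, or the same type with different parameter values) are pairwise non-isomorphic: (A1) $\langle a,b,c\mid a^4=b^2=c^4=1,[a,b]=c,[c,a]=[c,b]=c^2\rangle$; (A2) $\langle a,b,c\mid a^4=b^4=1,c^2=a^2,[a,b]=c,[c,a]=[c,b]=c^2\rangle$; (A3) $\langle a,b,c\mid a^8=b^2=1,c^2=a^4,[a,b]=c,[c,a]=[c,b]=c^2\rangle$; (B1) $\langle a,b,c\mid a^{2^{n+1}}=b^2=1,c^2=a^{2^n},[a,b]=c,[c,a]=1,[c,b]=c^2\rangle$, where $n\ge3$; (B2) $\langle a,b,c\mid a^{2^n}=b^2=c^4=1,[a,b]=c,[c,a]=1,[c,b]=c^2\rangle$, where $n\ge3$; (B3) $\langle a,b,c\mid a^{2^n}=b^4=1,c^2=b^2,[a,b]=c,[c,a]=1,[c,b]=c^2\rangle$, where $n\ge3$; (C1) $\langle a,b,c\mid a^8=1,c^2=a^4=b^4,[a,b]=c,[c,a]=1,[c,b]=1\rangle$; (C2) $\langle a,b,c\mid a^8=b^4=1,c^2=a^4,[a,b]=c,[c,a]=[c,b]=1\rangle$; (C3) $\langle a,b,c\mid a^8=1,c^2=a^4=b^4,[a,b]=c,[c,a]=1,[c,b]=c^2\rangle$; (C4) $\langle a,b,c\mid a^8=b^4=1,c^2=a^4,[a,b]=c,[c,a]=1,[c,b]=c^2\rangle$;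 (C5) $\langle a,b,c\mid a^8=b^4=1,c^2=a^4,[a,b]=c,[c,a]=c^2,[c,b]=1\rangle$; In (D1)--(D5): $n\ge2$, and $n\ge3$ if $p=2$. (D1) $\langle a,b,c\mid a^{p^{n+1}}=b^{p^n}=1,c^p=a^{p^n},[a,b]=c,[c,a]=1,[c,b]=c^{tp}\rangle$, where $t\in F_p^*$; (D2) $\langle a,b,c\mid a^{p^{n+1}}=b^{p^n}=1,c^p=a^{p^n},[a,b]=c,[c,a]=c^p,[c,b]=1\rangle$; (D3) $\langle a,b,c\mid a^{p^{n+1}}=b^{p^n}=1,c^p=a^{p^n},[a,b]=c,[c,a]=1,[c,b]=1\rangle$; (D4) $\langle a,b,c\mid a^{p^n}=b^{p^n}=c^{p^2}=1,[a,b]=c,[c,a]=c^p,[c,b]=1\rangle$; (D5) $\langle a,b,c\mid a^{p^n}=b^{p^n}=c^{p^2}=1,[a,b]=c,[c,a]=1,[c,b]=1\rangle$; In (E1)--(E9): $n>m\ge2$. (E1) $\langle a,b,c\mid a^{p^{n+1}}=b^{p^m}=1,c^p=a^{p^n},[a,b]=c,[c,a]=1,[c,b]=c^{tp}\rangle$, where $t\in F_p^*$; (E2) $\langle a,b,c\mid a^{p^{n+1}}=b^{p^m}=1,c^p=a^{p^n},[a,b]=c,[c,a]=c^p,[c,b]=1\rangle$; (E3) $\langle a,b,c\mid a^{p^{n+1}}=b^{p^m}=1,c^p=a^{p^n},[a,b]=c,[c,a]=1,[c,b]=1\rangle$; (E4) $\langle a,b,c\mid a^{p^n}=b^{p^{m+1}}=1,c^p=b^{p^m},[a,b]=c,[c,a]=1,[c,b]=c^p\rangle$;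 (E5) $\langle a,b,c\mid a^{p^n}=b^{p^{m+1}}=1,c^p=b^{p^m},[a,b]=c,[c,a]=c^{tp},[c,b]=1\rangle$, where $t\in F_p^*$; (E6) $\langle a,b,c\mid a^{p^n}=b^{p^{m+1}}=1,c^p=b^{p^m},[a,b]=c,[c,a]=1,[c,b]=1\rangle$; (E7) $\langle a,b,c\mid a^{p^n}=b^{p^m}=c^{p^2}=1,[a,b]=c,[c,a]=1,[c,b]=c^p\rangle$; (E8) $\langle a,b,c\mid a^{p^n}=b^{p^m}=c^{p^2}=1,[a,b]=c,[c,a]=c^p,[c,b]=1\rangle$; (E9) $\langle a,b,c\mid a^{p^n}=b^{p^m}=c^{p^2}=1,[a,b]=c,[c,a]=1,[c,b]=1\rangle$.
   Context: All groups are finite $p$-groups; $G_3=[G',G]$, $\Phi(H)$ is the Frattini subgroup of $H$, $[x,y]=x^{-1}y^{-1}xy$. For $n\ge m\ge 1$ (with $n>1$ if $p=2$), $M_p(n,m,1)=\langle a,b,c\mid a^{p^n}=b^{p^m}=c^p=1,\ [a,b]=c,\ [c,a]=[c,b]=1\rangle$. $F_p$ is the field with $p$ elements and $F_p^*$ its multiplicative group; parameters in $F_p$ occurring in exponents are represented by integers in $\{0,\dots,p-1\}$. The groups of types (A), (B), (C) are 2-groups. *)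

theory Defs
  imports "HOL-Algebra.Algebra" "HOL-Computational_Algebra.Primes"
begin

section \<open>Finite $p$-groups, Frattini subgroup, commutator subgroups\<close>

definition finite_p_group :: "nat \<Rightarrow> ('a, 'b) monoid_scheme \<Rightarrow> bool" where
  "finite_p_group p G \<longleftrightarrow> group G \<and> finite (carrier G) \<and> (\<exists>k. order G = p ^ k)"

definition commutator :: "('a, 'b) monoid_scheme \<Rightarrow> 'a \<Rightarrow> 'a \<Rightarrow> 'a" where
  "commutator G x y = inv\<^bsub>G\<^esub> x \<otimes>\<^bsub>G\<^esub> inv\<^bsub>G\<^esub> y \<otimes>\<^bsub>G\<^esub> x \<otimes>\<^bsub>G\<^esub> y"

definition commutator_subgroup :: "('a, 'b) monoid_scheme \<Rightarrow> 'a set \<Rightarrow> 'a set \<Rightarrow> 'a set" where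
  "commutator_subgroup G H K = generate G {commutator G x y | x y. x \<in> H \<and> y \<in> K}"

text \<open>The library's \<open>derived\<close> is built from the commutators
  $x y x^{-1} y^{-1}$; it generates the same subgroup \<open>G'\<close> as $x^{-1} y^{-1} x y$.\<close>

abbreviation derived_subgroup :: "('a, 'b) monoid_scheme \<Rightarrow> 'a set" where
  "derived_subgroup G \<equiv> derived G (carrier G)"

definition G3 :: "('a, 'b) monoid_scheme \<Rightarrow> 'a set" where
  "G3 G = commutator_subgroup G (derived_subgroup G) (carrier G)"

definition maximal_subgroup :: "'a set \<Rightarrow> ('a, 'b) monoid_scheme \<Rightarrow> bool" where
  "maximal_subgroup M G \<longleftrightarrow> subgroup M G \<and> M \<noteq> carrier G \<and>
     (\<forall>K. subgroup K G \<longrightarrow> M \<subseteq> K \<longrightarrow> K = M \<or> K = carrier G)"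

text \<open>The intersection with the carrier makes the Frattini subgroup of a group without
  maximal subgroups the whole group.\<close>

definition frattini :: "('a, 'b) monoid_scheme \<Rightarrow> 'a set" where
  "frattini G = carrier G \<inter> \<Inter>{M. maximal_subgroup M G}"

definition frattini_derived :: "('a, 'b) monoid_scheme \<Rightarrow> 'a set" where
  "frattini_derived G = frattini (G\<lparr>carrier := derived_subgroup G\<rparr>)"


section \<open>Groups given by generators and relations\<close>

text \<open>A word is a list of signed generators; \<open>(x, True)\<close> stands for $x$ and
  \<open>(x, False)\<close> for $x^{-1}$. A relation \<open>u = v\<close> is a pair of words.\<close>

type_synonym 'g word = "('g \<times> bool) list"

definition winv :: "'g word \<Rightarrow> 'g word" where
  "winv w = rev (map (\<lambda>(x, s). (x, \<not> s)) w)"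

definition wpow :: "'g word \<Rightarrow> nat \<Rightarrow> 'g word"  (infixr "\<up>" 80) where
  "w \<up> k = concat (replicate k w)"

definition wcomm :: "'g word \<Rightarrow> 'g word \<Rightarrow> 'g word" where
  "wcomm u v = winv u @ winv v @ u @ v"

inductive word_eq :: "('g word \<times> 'g word) set \<Rightarrow> 'g word \<Rightarrow> 'g word \<Rightarrow> bool"
  for R where
  rel:    "(u, v) \<in> R \<Longrightarrow> word_eq R u v"
| cancel: "word_eq R [(x, s), (x, \<not> s)] []"
| refl:   "word_eq R u u"
| sym:    "word_eq R u v \<Longrightarrow> word_eq R v u"
| trans:  "word_eq R u v \<Longrightarrow> word_eq R v w \<Longrightarrow> word_eq R u w"
| append: "word_eq R u v \<Longrightarrow> word_eq R u' v' \<Longrightarrow> word_eq R (u @ u') (v @ v')"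

definition word_class :: "('g word \<times> 'g word) set \<Rightarrow> 'g word \<Rightarrow> 'g word set" where
  "word_class R u = {v. word_eq R u v}"

definition presented_group :: "('g word \<times> 'g word) set \<Rightarrow> 'g word set monoid" where
  "presented_group R =
     \<lparr>carrier = range (word_class R),
      monoid.mult = (\<lambda>U V. {w. \<exists>u \<in> U. \<exists>v \<in> V. word_eq R (u @ v) w}),
      one = word_class R []\<rparr>"

lemma word_class_eq_iff: "word_class R u = word_class R v \<longleftrightarrow> word_eq R u v"
  unfolding word_class_def by (auto intro: word_eq.intros)

lemma mult_word_class:
  "word_class R u \<otimes>\<^bsub>presented_group R\<^esub> word_class R v = word_class R (u @ v)"
  unfolding presented_group_def word_class_def
  by (auto intro: word_eq.refl word_eq.trans word_eq.append)

lemma carrier_presented_group: "carrier (presented_group R) = range (word_class R)"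
  and one_presented_group: "\<one>\<^bsub>presented_group R\<^esub> = word_class R []"
  by (simp_all add: presented_group_def)

lemma winv_left: "word_eq R (winv w @ w) []"
proof (induction w)
  case Nil
  then show ?case by (simp add: winv_def word_eq.refl)
next
  case (Cons a w)
  obtain x s where a: "a = (x, s)" by fastforce
  have "word_eq R ([(x, \<not> s), (x, s)] @ w) ([] @ w)"
    using word_eq.cancel[of R x "\<not> s"] by (intro word_eq.append word_eq.refl) simp
  then have "word_eq R (winv w @ [(x, \<not> s), (x, s)] @ w) (winv w @ w)"
    by (intro word_eq.append word_eq.refl) simp
  then show ?case using Cons by (auto simp: a winv_def intro: word_eq.trans)
qed

lemma group_presented_group: "group (presented_group R)"
proof (rule groupI)
  fix U assume "U \<in> carrier (presented_group R)"
  then obtain u where "U = word_class R u" by (auto simp: carrier_presented_group)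
  then show "\<exists>V\<in>carrier (presented_group R). V \<otimes>\<^bsub>presented_group R\<^esub> U = \<one>\<^bsub>presented_group R\<^esub>"
    using winv_left[of R u]
    by (auto simp: carrier_presented_group mult_word_class one_presented_group word_class_eq_iff)
qed (auto simp: carrier_presented_group mult_word_class one_presented_group)

fun word_val :: "('a, 'b) monoid_scheme \<Rightarrow> ('g \<Rightarrow> 'a) \<Rightarrow> 'g word \<Rightarrow> 'a" where
  "word_val H f [] = \<one>\<^bsub>H\<^esub>"
| "word_val H f ((x, s) # w) = (if s then f x else inv\<^bsub>H\<^esub> (f x)) \<otimes>\<^bsub>H\<^esub> word_val H f w"

text \<open>The universal property (von Dyck).\<close>

lemma presented_group_universal:
  fixes H :: "('a, 'b) monoid_scheme" and f :: "'g \<Rightarrow> 'a"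
  assumes "group H" and f: "\<And>x. f x \<in> carrier H"
    and R: "\<And>u v. (u, v) \<in> R \<Longrightarrow> word_val H f u = word_val H f v"
  shows "\<exists>h \<in> hom (presented_group R) H. \<forall>w. h (word_class R w) = word_val H f w"
proof -
  interpret H: group H by fact
  have cl: "word_val H f w \<in> carrier H" for w
    by (induction w) (auto simp: f)
  have app: "word_val H f (u @ v) = word_val H f u \<otimes>\<^bsub>H\<^esub> word_val H f v" for u v
    by (induction u) (auto simp: f cl H.m_assoc)
  have eq: "word_val H f u = word_val H f v" if "word_eq R u v" for u v
    using that by (induction rule: word_eq.induct) (auto simp: R app f)
  define h where "h = (\<lambda>U. word_val H f (SOME w. w \<in> U))"
  have h: "h (word_class R w) = word_val H f w" for w
  proof -
    have "w \<in> word_class R w" by (simp add: word_class_def word_eq.refl)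
    then have "(SOME v. v \<in> word_class R w) \<in> word_class R w" by (rule someI)
    then show ?thesis unfolding h_def using eq by (auto simp: word_class_def)
  qed
  have "h \<in> hom (presented_group R) H"
    by (auto simp: hom_def carrier_presented_group h cl mult_word_class app)
  then show ?thesis using h by blast
qed


section \<open>The groups of the classification\<close>

datatype gen = Gen_a | Gen_b | Gen_c

abbreviation a :: "gen word" where "a \<equiv> [(Gen_a, True)]"
abbreviation b :: "gen word" where "b \<equiv> [(Gen_b, True)]"
abbreviation c :: "gen word" where "c \<equiv> [(Gen_c, True)]"
abbreviation e :: "gen word" where "e \<equiv> []"

definition M_group :: "nat \<Rightarrow> nat \<Rightarrow> nat \<Rightarrow> gen word set monoid" where
  "M_group p n m = presented_group
     {(a \<up> p ^ n, e), (b \<up> p ^ m, e), (c \<up> p, e), (wcomm a b, c), (wcomm c a, e), (wcomm c b, e)}"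

text \<open>The arguments are, in this order, those of the parameters \<open>n\<close>, \<open>m\<close>, \<open>t\<close> that occur in the
  presentation. The prime \<open>p\<close> is kept outside.\<close>

datatype family =
    A1 | A2 | A3
  | B1 nat | B2 nat | B3 nat
  | C1 | C2 | C3 | C4 | C5
  | D1 nat nat | D2 nat | D3 nat | D4 nat | D5 nat
  | E1 nat nat nat | E2 nat nat | E3 nat nat
  | E4 nat nat | E5 nat nat nat | E6 nat nat
  | E7 nat nat | E8 nat nat | E9 nat nat

fun admissible :: "nat \<Rightarrow> family \<Rightarrow> bool" where
  "admissible p A1 \<longleftrightarrow> p = 2"
| "admissible p A2 \<longleftrightarrow> p = 2"
| "admissible p A3 \<longleftrightarrow> p = 2"
| "admissible p (B1 n) \<longleftrightarrow> p = 2 \<and> n \<ge> 3"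
| "admissible p (B2 n) \<longleftrightarrow> p = 2 \<and> n \<ge> 3"
| "admissible p (B3 n) \<longleftrightarrow> p = 2 \<and> n \<ge> 3"
| "admissible p C1 \<longleftrightarrow> p = 2"
| "admissible p C2 \<longleftrightarrow> p = 2"
| "admissible p C3 \<longleftrightarrow> p = 2"
| "admissible p C4 \<longleftrightarrow> p = 2"
| "admissible p C5 \<longleftrightarrow> p = 2"
| "admissible p (D1 n t) \<longleftrightarrow> n \<ge> 2 \<and> (p = 2 \<longrightarrow> n \<ge> 3) \<and> t \<in> {1..<p}"
| "admissible p (D2 n) \<longleftrightarrow> n \<ge> 2 \<and> (p = 2 \<longrightarrow> n \<ge> 3)"
| "admissible p (D3 n) \<longleftrightarrow> n \<ge> 2 \<and> (p = 2 \<longrightarrow> n \<ge> 3)"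
| "admissible p (D4 n) \<longleftrightarrow> n \<ge> 2 \<and> (p = 2 \<longrightarrow> n \<ge> 3)"
| "admissible p (D5 n) \<longleftrightarrow> n \<ge> 2 \<and> (p = 2 \<longrightarrow> n \<ge> 3)"
| "admissible p (E1 n m t) \<longleftrightarrow> n > m \<and> m \<ge> 2 \<and> t \<in> {1..<p}"
| "admissible p (E2 n m) \<longleftrightarrow> n > m \<and> m \<ge> 2"
| "admissible p (E3 n m) \<longleftrightarrow> n > m \<and> m \<ge> 2"
| "admissible p (E4 n m) \<longleftrightarrow> n > m \<and> m \<ge> 2"
| "admissible p (E5 n m t) \<longleftrightarrow> n > m \<and> m \<ge> 2 \<and> t \<in> {1..<p}"
| "admissible p (E6 n m) \<longleftrightarrow> n > m \<and> m \<ge> 2"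
| "admissible p (E7 n m) \<longleftrightarrow> n > m \<and> m \<ge> 2"
| "admissible p (E8 n m) \<longleftrightarrow> n > m \<and> m \<ge> 2"
| "admissible p (E9 n m) \<longleftrightarrow> n > m \<and> m \<ge> 2"

text \<open>\<open>has_params n m L\<close>: wherever \<open>n\<close> or \<open>m\<close> occurs in the presentation \<open>L\<close>, it has the given
  value, so that it is the \<open>n\<close> or \<open>m\<close> of $G/\Phi(G') \cong M_p(n,m,1)$.\<close>

fun has_params :: "nat \<Rightarrow> nat \<Rightarrow> family \<Rightarrow> bool" where
  "has_params n m (B1 n') \<longleftrightarrow> n' = n"
| "has_params n m (B2 n') \<longleftrightarrow> n' = n"
| "has_params n m (B3 n') \<longleftrightarrow> n' = n"
| "has_params n m (D1 n' t) \<longleftrightarrow> n' = n"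
| "has_params n m (D2 n') \<longleftrightarrow> n' = n"
| "has_params n m (D3 n') \<longleftrightarrow> n' = n"
| "has_params n m (D4 n') \<longleftrightarrow> n' = n"
| "has_params n m (D5 n') \<longleftrightarrow> n' = n"
| "has_params n m (E1 n' m' t) \<longleftrightarrow> n' = n \<and> m' = m"
| "has_params n m (E2 n' m') \<longleftrightarrow> n' = n \<and> m' = m"
| "has_params n m (E3 n' m') \<longleftrightarrow> n' = n \<and> m' = m"
| "has_params n m (E4 n' m') \<longleftrightarrow> n' = n \<and> m' = m"
| "has_params n m (E5 n' m' t) \<longleftrightarrow> n' = n \<and> m' = m"
| "has_params n m (E6 n' m') \<longleftrightarrow> n' = n \<and> m' = m"
| "has_params n m (E7 n' m') \<longleftrightarrow> n' = n \<and> m' = m"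
| "has_params n m (E8 n' m') \<longleftrightarrow> n' = n \<and> m' = m"
| "has_params n m (E9 n' m') \<longleftrightarrow> n' = n \<and> m' = m"
| "has_params n m _ \<longleftrightarrow> True"

fun relations :: "nat \<Rightarrow> family \<Rightarrow> (gen word \<times> gen word) set" where
  "relations p A1 = {(a \<up> 4, e), (b \<up> 2, e), (c \<up> 4, e),
     (wcomm a b, c), (wcomm c a, c \<up> 2), (wcomm c b, c \<up> 2)}"
| "relations p A2 = {(a \<up> 4, e), (b \<up> 4, e), (c \<up> 2, a \<up> 2),
     (wcomm a b, c), (wcomm c a, c \<up> 2), (wcomm c b, c \<up> 2)}"
| "relations p A3 = {(a \<up> 8, e), (b \<up> 2, e), (c \<up> 2, a \<up> 4),
     (wcomm a b, c), (wcomm c a, c \<up> 2), (wcomm c b, c \<up> 2)}"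

| "relations p (B1 n) = {(a \<up> 2 ^ (n + 1), e), (b \<up> 2, e), (c \<up> 2, a \<up> 2 ^ n),
     (wcomm a b, c), (wcomm c a, e), (wcomm c b, c \<up> 2)}"
| "relations p (B2 n) = {(a \<up> 2 ^ n, e), (b \<up> 2, e), (c \<up> 4, e),
     (wcomm a b, c), (wcomm c a, e), (wcomm c b, c \<up> 2)}"
| "relations p (B3 n) = {(a \<up> 2 ^ n, e), (b \<up> 4, e), (c \<up> 2, b \<up> 2),
     (wcomm a b, c), (wcomm c a, e), (wcomm c b, c \<up> 2)}"

| "relations p C1 = {(a \<up> 8, e), (c \<up> 2, a \<up> 4), (a \<up> 4, b \<up> 4),
     (wcomm a b, c), (wcomm c a, e), (wcomm c b, e)}"
| "relations p C2 = {(a \<up> 8, e), (b \<up> 4, e), (c \<up> 2, a \<up> 4),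
     (wcomm a b, c), (wcomm c a, e), (wcomm c b, e)}"
| "relations p C3 = {(a \<up> 8, e), (c \<up> 2, a \<up> 4), (a \<up> 4, b \<up> 4),
     (wcomm a b, c), (wcomm c a, e), (wcomm c b, c \<up> 2)}"
| "relations p C4 = {(a \<up> 8, e), (b \<up> 4, e), (c \<up> 2, a \<up> 4),
     (wcomm a b, c), (wcomm c a, e), (wcomm c b, c \<up> 2)}"
| "relations p C5 = {(a \<up> 8, e), (b \<up> 4, e), (c \<up> 2, a \<up> 4),
     (wcomm a b, c), (wcomm c a, c \<up> 2), (wcomm c b, e)}"

| "relations p (D1 n t) = {(a \<up> p ^ (n + 1), e), (b \<up> p ^ n, e), (c \<up> p, a \<up> p ^ n),
     (wcomm a b, c), (wcomm c a, e), (wcomm c b, c \<up> (t * p))}"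
| "relations p (D2 n) = {(a \<up> p ^ (n + 1), e), (b \<up> p ^ n, e), (c \<up> p, a \<up> p ^ n),
     (wcomm a b, c), (wcomm c a, c \<up> p), (wcomm c b, e)}"
| "relations p (D3 n) = {(a \<up> p ^ (n + 1), e), (b \<up> p ^ n, e), (c \<up> p, a \<up> p ^ n),
     (wcomm a b, c), (wcomm c a, e), (wcomm c b, e)}"
| "relations p (D4 n) = {(a \<up> p ^ n, e), (b \<up> p ^ n, e), (c \<up> p ^ 2, e),
     (wcomm a b, c), (wcomm c a, c \<up> p), (wcomm c b, e)}"
| "relations p (D5 n) = {(a \<up> p ^ n, e), (b \<up> p ^ n, e), (c \<up> p ^ 2, e),
     (wcomm a b, c), (wcomm c a, e), (wcomm c b, e)}"

| "relations p (E1 n m t) = {(a \<up> p ^ (n + 1), e), (b \<up> p ^ m, e), (c \<up> p, a \<up> p ^ n),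
     (wcomm a b, c), (wcomm c a, e), (wcomm c b, c \<up> (t * p))}"
| "relations p (E2 n m) = {(a \<up> p ^ (n + 1), e), (b \<up> p ^ m, e), (c \<up> p, a \<up> p ^ n),
     (wcomm a b, c), (wcomm c a, c \<up> p), (wcomm c b, e)}"
| "relations p (E3 n m) = {(a \<up> p ^ (n + 1), e), (b \<up> p ^ m, e), (c \<up> p, a \<up> p ^ n),
     (wcomm a b, c), (wcomm c a, e), (wcomm c b, e)}"
| "relations p (E4 n m) = {(a \<up> p ^ n, e), (b \<up> p ^ (m + 1), e), (c \<up> p, b \<up> p ^ m),
     (wcomm a b, c), (wcomm c a, e), (wcomm c b, c \<up> p)}"
| "relations p (E5 n m t) = {(a \<up> p ^ n, e), (b \<up> p ^ (m + 1), e), (c \<up> p, b \<up> p ^ m),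
     (wcomm a b, c), (wcomm c a, c \<up> (t * p)), (wcomm c b, e)}"
| "relations p (E6 n m) = {(a \<up> p ^ n, e), (b \<up> p ^ (m + 1), e), (c \<up> p, b \<up> p ^ m),
     (wcomm a b, c), (wcomm c a, e), (wcomm c b, e)}"
| "relations p (E7 n m) = {(a \<up> p ^ n, e), (b \<up> p ^ m, e), (c \<up> p ^ 2, e),
     (wcomm a b, c), (wcomm c a, e), (wcomm c b, c \<up> p)}"
| "relations p (E8 n m) = {(a \<up> p ^ n, e), (b \<up> p ^ m, e), (c \<up> p ^ 2, e),
     (wcomm a b, c), (wcomm c a, c \<up> p), (wcomm c b, e)}"
| "relations p (E9 n m) = {(a \<up> p ^ n, e), (b \<up> p ^ m, e), (c \<up> p ^ 2, e),
     (wcomm a b, c), (wcomm c a, e), (wcomm c b, e)}"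

definition listed_group :: "nat \<Rightarrow> family \<Rightarrow> gen word set monoid" where
  "listed_group p L = presented_group (relations p L)"

hide_const (open) a b c e

end

theory Submission
  imports Defs
begin

text \<open>Lifting the generators of $M_p(n,m,1)$ to \<open>a, b\<close> and putting $c = [a,b]$, the subgroup $G'$
  is generated by \<open>c\<close> modulo its Frattini subgroup, hence by \<open>c\<close> alone. So \<open>c\<close> has order $p^2$, and
  $a^{p^n} = c^{pi}$, $b^{p^m} = c^{pj}$, $[c,a] = c^{pr}$, $[c,b] = c^{ps}$: up to isomorphism the group
  is given by $n, m$ and $(i,j,r,s)$ modulo \<open>p\<close>. Every element is $a^x b^y c^w$, and the product of two
  of these is polynomial in the exponents. The same product on integer triples, reduced by
  the relations, is a group of order $p^{n+m+2}$, which shows that no presentation of the list collapses.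

  Exponentiating $a^x b^y c^w$ tells how $(i,j,r,s)$ changes with the generators: $(r,s)$ is
  a linear form, and $(i,j)$ is one up to the determinant of the change, except for $p = 2$, $n = m = 2$
  (a quadratic form) and for $m = 1$. The groups of the list are representatives of the orbits.\<close>

subsection \<open>The product of normal forms\<close>

text \<open>The obstacle is consistency: not every tuple \<open>(i,j,r,s)\<close> belongs to a
  group. Since \<open>b^(p^m) = c^(pj)\<close> commutes with \<open>a\<close>, collecting
  \<open>[a, b^(p^m)] = 1\<close> gives \<open>p^m + p s binom(p^m, 2) = 0\<close> modulo
  \<open>p^2\<close>. For \<open>m \<ge> 2\<close> this is automatic; for \<open>m = 1\<close> it
  reads \<open>1 + s binom(p, 2) = 0\<close> modulo \<open>p\<close>, so \<open>p = 2\<close> and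
  \<open>s\<close> is odd. That is why the types with \<open>m = 1\<close> are 2-groups.

  Once normal forms are unique, comparing groups is arithmetic: a second pair of generators is
  written in the coordinates of the first, and its relations become congruences modulo
  \<open>p\<close>. The determinant appears at \<open>(i,j)\<close> because the new commutator is a
  power \<open>c^D\<close> that stands on one side of \<open>a^(p^n) = c^(pi)\<close> only; in
  \<open>[c,a] = c^(pr)\<close> it stands on both sides and cancels. The quadratic exception comes
  from \<open>binom(p^k, 2)\<close>, which for \<open>k \<ge> 2\<close> is a multiple of
  \<open>p^2\<close> unless \<open>p = k = 2\<close>.\<close>

definition tri :: "int \<Rightarrow> int" where
  "tri x = x * (x - 1) div 2"

lemma two_tri: "2 * tri x = x * (x - 1)"
  unfolding tri_def by (rule dvd_mult_div_cancel) auto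

lemma tri_add: "tri (x + y) = tri x + tri y + x * y"
proof -
  have "2 * tri (x + y) = 2 * (tri x + tri y + x * y)"
    unfolding distrib_left two_tri by (simp add: algebra_simps)
  then show ?thesis by simp
qed

lemma tri_simps [simp]: "tri 0 = 0" "tri 1 = 0"
  by (simp_all add: tri_def)

lemma tri_mult: "tri (k * x) = k * tri x + tri k * x * x"
proof -
  have "2 * tri (k * x) = k * (2 * tri x) + (2 * tri k) * x * x"
    unfolding two_tri by (simp add: algebra_simps)
  then show ?thesis by simp
qed

text \<open>$[a^x, b] = c^{x + R \binom{x}{2}}$ when $[a,b] = c$ and $[c,a] = c^R$ with $c^{R^2} = 1$.\<close>

definition trix :: "int \<Rightarrow> int \<Rightarrow> int" where
  "trix R x = x + R * tri x"

lemma trix_simps [simp]: "trix R 0 = 0" "trix R 1 = 1"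
  by (simp_all add: trix_def)

lemma trix_Suc: "trix R (x + 1) = trix R x + 1 + R * x"
  by (simp add: trix_def tri_add algebra_simps)

lemma trix_add: "trix R (x + y) = trix R x + trix R y + R * x * y"
  by (simp add: trix_def tri_add algebra_simps)

type_synonym triple = "int \<times> int \<times> int"

text \<open>The exponents of $a^x b^y c^w \cdot a^{x'} b^{y'} c^{w'}$.\<close>

fun tmult :: "int \<Rightarrow> int \<Rightarrow> triple \<Rightarrow> triple \<Rightarrow> triple" where
  "tmult R S (x, y, w) (x', y', w') =
    (x + x', y + y', w * (1 + R * x') * (1 + S * y') - trix R x' * trix S y * (1 + S * y') + w')"

text \<open>Triples with the same value $a^x b^y c^w$ when $a^N = c^I$, $b^M = c^J$ and $c^P = 1$.\<close>

fun tequiv :: "int \<Rightarrow> int \<Rightarrow> int \<Rightarrow> int \<Rightarrow> int \<Rightarrow> triple \<Rightarrow> triple \<Rightarrow> bool" where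
  "tequiv N M P I J (x, y, w) (x', y', w') \<longleftrightarrow>
    (\<exists>k l. x' = x + N * k \<and> y' = y + M * l \<and> P dvd (w' - w + I * k + J * l))"

section \<open>Powers of a commutator under conjugation\<close>

context group
begin

lemma commutator_closed [simp]:
  "x \<in> carrier G \<Longrightarrow> y \<in> carrier G \<Longrightarrow> commutator G x y \<in> carrier G"
  by (simp add: commutator_def)

lemma mult_commutator:
  assumes "x \<in> carrier G" "y \<in> carrier G"
  shows "y \<otimes> x \<otimes> commutator G x y = x \<otimes> y"
  using assms by (simp add: commutator_def m_assoc inv_solve_left)
    (metis inv_closed inv_mult_group m_assoc m_closed r_inv l_one)

lemma commutator_unique:
  assumes "x \<in> carrier G" "y \<in> carrier G" "z \<in> carrier G" "x \<otimes> y = y \<otimes> x \<otimes> z"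
  shows "commutator G x y = z"
  using assms mult_commutator[of x y] by (metis commutator_closed l_cancel m_closed)

lemma int_pow_cong:
  assumes "x \<in> carrier G" "x [^] P = \<one>" "P dvd (v - u :: int)"
  shows "x [^] u = x [^] v"
proof -
  obtain k where "v = u + P * k" using assms(3) by (metis dvdE add_diff_cancel_left' diff_add_cancel add.commute)
  then show ?thesis
    using assms(1,2) by (simp add: int_pow_mult flip: int_pow_pow)
qed

text \<open>Conjugation by \<open>g\<close> raises the powers of \<open>c\<close> to the power
  \<open>1 + R\<close>. As \<open>R * R\<close> vanishes modulo \<open>P\<close>, the power
  \<open>(1 + R)^x\<close> is \<open>1 + R * x\<close> for every integer \<open>x\<close>, and
  \<open>1 + R\<close> has the inverse \<open>1 - R\<close>.\<close>

lemma conj_int_pow: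
  fixes R P :: int
  assumes g: "g \<in> carrier G" and c: "c \<in> carrier G" and P: "c [^] P = \<one>" "P dvd R * R"
    and cg: "commutator G c g = c [^] R"
  shows "c [^] (w::int) \<otimes> g [^] (x::int) = g [^] x \<otimes> c [^] (w * (1 + R * x))"
proof -
  have 1: "c \<otimes> g = g \<otimes> c [^] (1 + R)"
    using mult_commutator[OF c g] g c by (simp add: cg int_pow_mult m_assoc)
  then have h: "inv g \<otimes> c \<otimes> g = c [^] (1 + R)"
    using g c by (simp add: m_assoc inv_solve_left')
  have conjhom: "(\<lambda>y. inv g \<otimes> y \<otimes> g) \<in> hom G G"
    using g by (auto intro!: homI simp: m_assoc) (metis inv_closed l_one m_assoc m_closed r_inv)
  have conj: "inv g \<otimes> c [^] v \<otimes> g = c [^] (v * (1 + R))" for v :: int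
  proof -
    have "inv g \<otimes> c [^] v \<otimes> g = (inv g \<otimes> c \<otimes> g) [^] v"
      using hom_int_pow[OF conjhom c is_group is_group] by simp
    then show ?thesis by (simp only: h int_pow_pow[OF c]) (simp add: mult.commute)
  qed
  have fwd: "c [^] v \<otimes> g = g \<otimes> c [^] (v * (1 + R))" for v :: int
    using conj[of v] g c by (metis int_pow_closed inv_closed inv_solve_left' m_assoc m_closed)
  have bwd: "c [^] v \<otimes> inv g = inv g \<otimes> c [^] (v * (1 - R))" for v :: int
  proof -
    have "c [^] (v * (1 - R)) \<otimes> g = g \<otimes> c [^] (v * (1 - R) * (1 + R))" by (rule fwd)
    also have "c [^] (v * (1 - R) * (1 + R)) = c [^] v"
    proof (intro int_pow_cong[OF c P(1)])
      have "v - v * (1 - R) * (1 + R) = R * R * v" by (simp add: algebra_simps)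
      then show "P dvd v - v * (1 - R) * (1 + R)" using P(2) by (metis dvd_mult2)
    qed
    finally show ?thesis
      using g c by (metis int_pow_closed inv_closed inv_solve_left inv_solve_right m_assoc m_closed)
  qed
  show ?thesis
  proof (induction x arbitrary: w rule: int_induct[where k = 0])
    case base
    then show ?case using c by simp
  next
    case (step1 x)
    have "c [^] w \<otimes> g [^] (x + 1) = (c [^] w \<otimes> g [^] x) \<otimes> g"
      using g c by (simp add: int_pow_mult m_assoc)
    also have "\<dots> = g [^] x \<otimes> (c [^] (w * (1 + R * x)) \<otimes> g)"
      using g c by (simp add: step1 m_assoc)
    also have "\<dots> = g [^] (x + 1) \<otimes> c [^] (w * (1 + R * x) * (1 + R))"
      using g c by (simp add: fwd int_pow_mult m_assoc)
    also have "c [^] (w * (1 + R * x) * (1 + R)) = c [^] (w * (1 + R * (x + 1)))"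
    proof (intro int_pow_cong[OF c P(1)])
      have "w * (1 + R * (x + 1)) - w * (1 + R * x) * (1 + R) = R * R * (- w * x)" by (simp add: algebra_simps)
      then show "P dvd w * (1 + R * (x + 1)) - w * (1 + R * x) * (1 + R)" using P(2) by (metis dvd_mult2)
    qed
    finally show ?case .
  next
    case (step2 x)
    have "c [^] w \<otimes> g [^] (x - 1) = (c [^] w \<otimes> g [^] x) \<otimes> inv g"
      using g c by (simp add: int_pow_diff m_assoc)
    also have "\<dots> = g [^] x \<otimes> (c [^] (w * (1 + R * x)) \<otimes> inv g)"
      using g c by (simp add: step2 m_assoc)
    also have "\<dots> = g [^] (x - 1) \<otimes> c [^] (w * (1 + R * x) * (1 - R))"
      using g c by (simp add: bwd int_pow_diff m_assoc)
    also have "c [^] (w * (1 + R * x) * (1 - R)) = c [^] (w * (1 + R * (x - 1)))"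
    proof (intro int_pow_cong[OF c P(1)])
      have "w * (1 + R * (x - 1)) - w * (1 + R * x) * (1 - R) = R * R * (w * x)" by (simp add: algebra_simps)
      then show "P dvd w * (1 + R * (x - 1)) - w * (1 + R * x) * (1 - R)" using P(2) by (metis dvd_mult2)
    qed
    finally show ?case .
  qed
qed

end

text \<open>Two instances occur: \<open>P = p^2\<close> with the four exponents multiples of
  \<open>p\<close>, for \<open>G\<close> itself, and \<open>P = p\<close> with all four equal to 0,
  for \<open>M_p(n,m,1)\<close>. The divisibilities say that \<open>[c,a]\<close>,
  \<open>[c,b]\<close>, \<open>c^I\<close> and \<open>c^J\<close> commute with \<open>a\<close> and
  \<open>b\<close>.\<close>

locale pair_params =
  fixes N M P R S I J :: int
  assumes pos: "0 < N" "0 < M" "0 < P"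
    and RS: "P dvd R * R" "P dvd R * S" "P dvd S * S"
    and RS_IJ: "P dvd I * R" "P dvd I * S" "P dvd J * R" "P dvd J * S"

locale commutator_pair = group G + pair_params N M P R S I J
  for G (structure) and N M P R S I J +
  fixes a b :: 'a
  assumes a_closed [simp]: "a \<in> carrier G" and b_closed [simp]: "b \<in> carrier G"
    and c_pow_P: "commutator G a b [^] P = \<one>"
    and comm_ca: "commutator G (commutator G a b) a = commutator G a b [^] R"
    and comm_cb: "commutator G (commutator G a b) b = commutator G a b [^] S"
    and a_pow_N: "a [^] N = commutator G a b [^] I"
    and b_pow_M: "b [^] M = commutator G a b [^] J"
begin

abbreviation c :: 'a where "c \<equiv> commutator G a b"

fun \<phi> :: "triple \<Rightarrow> 'a" where
  "\<phi> (x, y, w) = a [^] x \<otimes> b [^] y \<otimes> c [^] w"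

lemma c_closed: "c \<in> carrier G" by simp

lemma phi_closed [simp]: "\<phi> u \<in> carrier G"
  by (cases u) simp

lemmas c_pow_cong = int_pow_cong[OF c_closed c_pow_P]

lemmas c_a = conj_int_pow[OF a_closed c_closed c_pow_P RS(1) comm_ca]
lemmas c_b = conj_int_pow[OF b_closed c_closed c_pow_P RS(3) comm_cb]

lemma b_a: "b \<otimes> a = a \<otimes> b \<otimes> c [^] (-1 :: int)"
  using mult_commutator[OF a_closed b_closed]
  by (simp add: inv_solve_right int_pow_neg)

lemma b_a_inv: "b \<otimes> a [^] (-1::int) = a [^] (-1::int) \<otimes> b \<otimes> c [^] (1 - R)"
proof -
  have "a [^] (-1::int) \<otimes> b \<otimes> c [^] (1 - R) \<otimes> a = a [^] (-1::int) \<otimes> (b \<otimes> (c [^] (1 - R) \<otimes> a [^] (1::int)))"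
    by (simp add: m_assoc)
  also have "\<dots> = a [^] (-1::int) \<otimes> ((b \<otimes> a) \<otimes> c [^] ((1 - R) * (1 + R * 1)))"
    unfolding c_a by (simp add: m_assoc)
  also have "c [^] ((1 - R) * (1 + R * 1)) = c [^] (1::int)"
    using RS(1) by (intro c_pow_cong) (simp add: algebra_simps)
  also have "a [^] (-1::int) \<otimes> ((b \<otimes> a) \<otimes> c [^] (1::int)) = b"
    by (simp add: mult_commutator int_pow_neg flip: m_assoc)
  finally show ?thesis
    by (simp add: int_pow_neg inv_solve_right')
qed

text \<open>Each further \<open>a\<close> that passes \<open>b\<close> contributes
  \<open>c^-1\<close>, and the power of \<open>c\<close> collected so far is multiplied by
  \<open>1 + R\<close>. Modulo \<open>R * R\<close> this is the recursion of
  \<open>trix\<close>.\<close>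

lemma b_apow: "b \<otimes> a [^] x = a [^] x \<otimes> b \<otimes> c [^] (- trix R x)"
proof (induction x rule: int_induct[where k = 0])
  case base
  then show ?case by simp
next
  case (step1 x)
  have "b \<otimes> a [^] (x + 1) = (b \<otimes> a [^] x) \<otimes> a" by (simp add: int_pow_mult m_assoc)
  also have "\<dots> = a [^] x \<otimes> b \<otimes> (c [^] (- trix R x) \<otimes> a [^] (1::int))"
    by (simp add: step1 m_assoc)
  also have "\<dots> = a [^] x \<otimes> (b \<otimes> a) \<otimes> c [^] (- trix R x * (1 + R * 1))"
    unfolding c_a by (simp add: m_assoc)
  also have "\<dots> = a [^] (x + 1) \<otimes> b \<otimes> c [^] (- 1 - trix R x * (1 + R * 1))"
    unfolding b_a by (simp add: m_assoc int_pow_mult int_pow_diff int_pow_neg)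
  also have "c [^] (- 1 - trix R x * (1 + R * 1)) = c [^] (- trix R (x + 1))"
  proof (intro c_pow_cong)
    have "- trix R (x + 1) - (- 1 - trix R x * (1 + R * 1)) = R * R * tri x"
      by (simp add: trix_def tri_add algebra_simps)
    then show "P dvd - trix R (x + 1) - (- 1 - trix R x * (1 + R * 1))" using RS(1) by (metis dvd_mult2)
  qed
  finally show ?case .
next
  case (step2 x)
  have "b \<otimes> a [^] (x - 1) = (b \<otimes> a [^] x) \<otimes> a [^] (-1::int)"
    by (simp add: int_pow_diff int_pow_neg m_assoc)
  also have "\<dots> = a [^] x \<otimes> b \<otimes> (c [^] (- trix R x) \<otimes> a [^] (-1::int))"
    by (simp add: step2 m_assoc)
  also have "\<dots> = a [^] x \<otimes> (b \<otimes> a [^] (-1::int)) \<otimes> c [^] (- trix R x * (1 + R * (-1)))"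
    unfolding c_a by (simp add: m_assoc)
  also have "\<dots> = a [^] (x - 1) \<otimes> b \<otimes> (c [^] (1 - R) \<otimes> c [^] (- trix R x * (1 + R * (-1))))"
    unfolding b_a_inv by (simp add: m_assoc int_pow_diff int_pow_neg)
  also have "c [^] (1 - R) \<otimes> c [^] (- trix R x * (1 + R * (-1))) = c [^] (- trix R (x - 1))"
    unfolding int_pow_mult[OF c_closed, symmetric]
  proof (intro c_pow_cong)
    have t: "tri x = tri (x - 1) + (x - 1)" using tri_add[of "x - 1" 1] by simp
    have "- trix R (x - 1) - (1 - R + - trix R x * (1 + R * (-1))) = R * R * (- tri x)"
      by (simp add: trix_def t algebra_simps)
    then show "P dvd - trix R (x - 1) - (1 - R + - trix R x * (1 + R * (-1)))" using RS(1) by (metis dvd_mult2)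
  qed
  finally show ?case .
qed

lemma bpow_apow: "b [^] y \<otimes> a [^] x = a [^] x \<otimes> b [^] y \<otimes> c [^] (- (trix R x * trix S y))"
proof -
  \<comment> \<open>Left multiplication by \<open>b\<close> can be undone, so passing from
    \<open>y'\<close> to \<open>y' + 1\<close> is an equivalence; it serves both directions of the
    integer induction.\<close>
  have step: "b [^] y' \<otimes> a [^] x = a [^] x \<otimes> b [^] y' \<otimes> c [^] (- (trix R x * trix S y'))
    \<longleftrightarrow> b [^] (y' + 1) \<otimes> a [^] x = a [^] x \<otimes> b [^] (y' + 1) \<otimes> c [^] (- trix R x * trix S (y' + 1))" for y' :: int
  proof -
    have "b [^] (y' + 1) \<otimes> a [^] x = b \<otimes> (b [^] y' \<otimes> a [^] x)"
      by (simp add: int_pow_mult m_assoc flip: int_pow_mult[of b 1 y', simplified] add: add.commute)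
    moreover have "a [^] x \<otimes> b [^] (y' + 1) \<otimes> c [^] (- trix R x * trix S (y' + 1))
      = b \<otimes> (a [^] x \<otimes> b [^] y' \<otimes> c [^] (- (trix R x * trix S y')))"
    proof -
      have "b \<otimes> (a [^] x \<otimes> b [^] y' \<otimes> c [^] (- (trix R x * trix S y')))
        = (b \<otimes> a [^] x) \<otimes> b [^] y' \<otimes> c [^] (- (trix R x * trix S y'))" by (simp add: m_assoc)
      also have "\<dots> = a [^] x \<otimes> b \<otimes> (c [^] (- trix R x) \<otimes> b [^] y') \<otimes> c [^] (- (trix R x * trix S y'))"
        by (simp add: b_apow m_assoc)
      also have "\<dots> = a [^] x \<otimes> b [^] (1 + y') \<otimes> (c [^] (- trix R x * (1 + S * y')) \<otimes> c [^] (- (trix R x * trix S y')))"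
        unfolding c_b by (simp add: m_assoc int_pow_mult)
      also have "c [^] (- trix R x * (1 + S * y')) \<otimes> c [^] (- (trix R x * trix S y')) = c [^] (- (trix R x * trix S (y' + 1)))"
        unfolding trix_Suc int_pow_mult[OF c_closed, symmetric] by (simp add: algebra_simps)
      finally show ?thesis by (simp add: add.commute)
    qed
    ultimately show ?thesis by simp
  qed
  show ?thesis
  proof (induction y rule: int_induct[where k = 0])
    case base
    then show ?case by simp
  next
    case (step1 y)
    then show ?case using step[of y] by simp
  next
    case (step2 y)
    then show ?case using step[of "y - 1"] by simp
  qed
qed

text \<open>\<open>c^w\<close> passes \<open>a^x'\<close> and \<open>b^y'\<close> and picks up both
  factors. The power of \<open>c\<close> born from exchanging \<open>b^y\<close> and
  \<open>a^x'\<close> already stands behind \<open>a^x'\<close>; it passes only \<open>b^y'\<close>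
  and picks up only \<open>1 + S * y'\<close>.\<close>

theorem phi_mult: "\<phi> u \<otimes> \<phi> v = \<phi> (tmult R S u v)"
proof -
  obtain x y w x' y' w' where uv: "u = (x, y, w)" "v = (x', y', w')" by (cases u, cases v) auto
  have "\<phi> u \<otimes> \<phi> v = a [^] x \<otimes> b [^] y \<otimes> (c [^] w \<otimes> a [^] x') \<otimes> b [^] y' \<otimes> c [^] w'"
    by (simp add: uv m_assoc)
  also have "\<dots> = a [^] x \<otimes> (b [^] y \<otimes> a [^] x') \<otimes> (c [^] (w * (1 + R * x')) \<otimes> b [^] y') \<otimes> c [^] w'"
    unfolding c_a by (simp add: m_assoc)
  also have "\<dots> = a [^] x \<otimes> a [^] x' \<otimes> b [^] y \<otimes> (c [^] (- (trix R x' * trix S y)) \<otimes> b [^] y') \<otimes>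
      c [^] (w * (1 + R * x') * (1 + S * y')) \<otimes> c [^] w'"
    unfolding bpow_apow c_b[of "w * (1 + R * x')"] by (simp add: m_assoc)
  also have "\<dots> = (a [^] x \<otimes> a [^] x') \<otimes> (b [^] y \<otimes> b [^] y') \<otimes> (c [^] (- (trix R x' * trix S y) * (1 + S * y')) \<otimes>
      c [^] (w * (1 + R * x') * (1 + S * y')) \<otimes> c [^] w')"
    unfolding c_b by (simp add: m_assoc)
  also have "\<dots> = \<phi> (tmult R S u v)"
    by (simp add: uv flip: int_pow_mult)
  finally show ?thesis .
qed

lemma phi_a: "\<phi> (1, 0, 0) = a" and phi_b: "\<phi> (0, 1, 0) = b"
  by simp_all

end

subsection \<open>The model\<close>

context pair_params
begin

lemma RR_dvd: "P dvd R * (R * z)" "P dvd R * (S * z)" "P dvd S * (S * z)"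
  using RS by (metis dvd_mult2 mult.assoc)+

text \<open>On integer triples the product is associative only modulo \<open>P\<close>: what remains
  of the expanded difference consists of monomials with two factors from \<open>R\<close> and
  \<open>S\<close>, in the nested shape of \<open>RR_dvd\<close>.\<close>

lemma tmult_assoc_dvd:
  "P dvd snd (snd (tmult R S (tmult R S u v) t)) - snd (snd (tmult R S u (tmult R S v t)))"
proof -
  obtain x y w x' y' w' x'' y'' w'' where uvt: "u = (x, y, w)" "v = (x', y', w')" "t = (x'', y'', w'')"
    by (cases u, cases v, cases t) auto
  show ?thesis
    unfolding uvt
    by (simp add: trix_add, simp add: trix_def algebra_simps) (intro dvd_add dvd_diff RR_dvd)
qed

abbreviation sim :: "triple \<Rightarrow> triple \<Rightarrow> bool" where
  "sim \<equiv> tequiv N M P I J"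

text \<open>The carries \<open>x div N\<close> and \<open>y div M\<close> count how often
  \<open>a^N\<close> and \<open>b^M\<close> are replaced by \<open>c^I\<close> and
  \<open>c^J\<close>. Canonical representatives make the quotient by \<open>sim\<close> a finite set
  of triples instead of classes.\<close>

fun reduce :: "triple \<Rightarrow> triple" where
  "reduce (x, y, w) = (x mod N, y mod M, (w + I * (x div N) + J * (y div M)) mod P)"

definition box :: "triple set" where
  "box = {0..<N} \<times> {0..<M} \<times> {0..<P}"

lemma reduce_in_box: "reduce u \<in> box"
  using pos by (cases u) (simp add: box_def)

lemma reduce_id: "u \<in> box \<Longrightarrow> reduce u = u"
  by (cases u) (auto simp: box_def)

lemma finite_box: "finite box" and card_box: "card box = nat (N * M * P)"
  using pos by (simp_all add: box_def card_cartesian_product nat_mult_distrib)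

lemma reduce_eq_iff: "reduce u = reduce v \<longleftrightarrow> sim u v"
proof -
  obtain x y w x' y' w' where uv: "u = (x, y, w)" "v = (x', y', w')" by (cases u, cases v) auto
  show ?thesis
  proof
    assume "sim u v"
    then obtain k l where kl: "x' = x + N * k" "y' = y + M * l" "P dvd (w' - w + I * k + J * l)"
      by (auto simp: uv)
    have "x' div N = x div N + k" "y' div M = y div M + l"
      using pos by (simp_all add: kl(1,2))
    then have "w' + I * (x' div N) + J * (y' div M) - (w + I * (x div N) + J * (y div M))
      = w' - w + I * k + J * l" by (simp add: algebra_simps)
    with kl(3) have "(w' + I * (x' div N) + J * (y' div M)) mod P = (w + I * (x div N) + J * (y div M)) mod P"
      by (simp only: mod_eq_dvd_iff)
    then show "reduce u = reduce v" by (simp add: uv kl(1,2))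
  next
    assume "reduce u = reduce v"
    then have e: "x mod N = x' mod N" "y mod M = y' mod M"
      "P dvd (w' + I * (x' div N) + J * (y' div M)) - (w + I * (x div N) + J * (y div M))"
      by (simp_all add: uv flip: mod_eq_dvd_iff)
    have "x' = x + N * (x' div N - x div N)" "y' = y + M * (y' div M - y div M)"
      using e(1,2) by (simp_all add: right_diff_distrib minus_mod_eq_mult_div[symmetric])
    moreover have "P dvd w' - w + I * (x' div N - x div N) + J * (y' div M - y div M)"
      using e(3) by (simp add: algebra_simps)
    ultimately show "sim u v" unfolding uv tequiv.simps by blast
  qed
qed

lemma sim_refl: "sim u u"
  by (simp flip: reduce_eq_iff)

lemma sim_reduce: "sim (reduce u) u" "sim u (reduce u)"
  by (simp_all add: reduce_id reduce_in_box flip: reduce_eq_iff)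

lemma sim_tmult_assoc: "sim (tmult R S (tmult R S u v) t) (tmult R S u (tmult R S v t))"
proof -
  obtain x y w x' y' w' x'' y'' w'' where uvt: "u = (x, y, w)" "v = (x', y', w')" "t = (x'', y'', w'')"
    by (cases u, cases v, cases t) auto
  obtain p where p: "tmult R S (tmult R S u v) t = (x + x' + x'', y + y' + y'', p)"
    by (simp add: uvt)
  obtain q where q: "tmult R S u (tmult R S v t) = (x + x' + x'', y + y' + y'', q)"
    by (simp add: uvt add.assoc)
  have "P dvd q - p" using tmult_assoc_dvd[of u v t] unfolding p q snd_conv by (subst dvd_diff_commute)
  then show ?thesis unfolding p q tequiv.simps by (intro exI[of _ 0]) simp
qed

end

text \<open>The conditions under which the product respects \<open>sim\<close>. As
  \<open>a^N\<close> and \<open>b^M\<close> equal powers of \<open>c\<close> that are to be central,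
  they must commute with \<open>c\<close>, which concerns \<open>R * N\<close> and
  \<open>S * M\<close>; and \<open>[a^N, b]\<close> and \<open>[a, b^M]\<close> must vanish, which
  concerns the two values of \<open>trix\<close>.\<close>

locale model_params = pair_params +
  assumes RS_NM: "P dvd R * N" "P dvd S * N" "P dvd R * M" "P dvd S * M"
    and trix_N: "P dvd trix R N" and trix_M: "P dvd trix S M"
begin

lemma trix_N_mult: "P dvd trix R (N * k)"
proof -
  have "trix R (N * k) = trix R N * k + R * N * (tri k * N)"
    unfolding trix_def mult.commute[of N k] tri_mult by (simp add: algebra_simps)
  then show ?thesis using RS_NM(1) trix_N by (simp only: dvd_add dvd_mult2)
qed

lemma trix_M_mult: "P dvd trix S (M * k)"
proof -
  have "trix S (M * k) = trix S M * k + S * M * (tri k * M)"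
    unfolding trix_def mult.commute[of M k] tri_mult by (simp add: algebra_simps)
  then show ?thesis using RS_NM(4) trix_M by (simp only: dvd_add dvd_mult2)
qed

lemma RS_IJ_NM_dvd: "P dvd R * (N * z)" "P dvd S * (N * z)" "P dvd R * (M * z)" "P dvd S * (M * z)"
  "P dvd N * (R * z)" "P dvd N * (S * z)" "P dvd M * (R * z)" "P dvd M * (S * z)"
  "P dvd I * (R * z)" "P dvd I * (S * z)" "P dvd J * (R * z)" "P dvd J * (S * z)"
proof -
  have "P dvd x * (y * z)" if "P dvd x * y" for x y
    using that by (metis dvd_mult2 mult.assoc)
  moreover have "P dvd y * (x * z)" if "P dvd x * y" for x y
    using that by (metis dvd_mult2 mult.assoc mult.commute)
  ultimately show "P dvd R * (N * z)" "P dvd S * (N * z)" "P dvd R * (M * z)" "P dvd S * (M * z)"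
    "P dvd N * (R * z)" "P dvd N * (S * z)" "P dvd M * (R * z)" "P dvd M * (S * z)"
    "P dvd I * (R * z)" "P dvd I * (S * z)" "P dvd J * (R * z)" "P dvd J * (S * z)"
    using RS_NM RS_IJ by blast+
qed

text \<open>With the shifts substituted explicitly, the change of the last coordinate plus the new
  carries is a sum of monomials. Each contains \<open>P\<close>, or two factors from
  \<open>R\<close> and \<open>S\<close>, or one of these together with one of \<open>N\<close>,
  \<open>M\<close>, \<open>I\<close>, \<open>J\<close>.\<close>

lemma sim_tmult_cong:
  assumes "sim u u'" "sim v v'"
  shows "sim (tmult R S u v) (tmult R S u' v')"
proof -
  obtain x y w x' y' w' where uv: "u = (x, y, w)" "v = (x', y', w')" by (cases u, cases v) auto
  obtain k l q where u': "u' = (x + N * k, y + M * l, w - I * k - J * l + P * q)"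
  proof -
    obtain k l w1 where 1: "u' = (x + N * k, y + M * l, w1)" "P dvd w1 - w + I * k + J * l"
      using assms(1) by (cases u') (auto simp: uv)
    then obtain q where "w1 - w + I * k + J * l = P * q" by (elim dvdE)
    then have "w1 = w - I * k - J * l + P * q" by simp
    with 1 that show ?thesis by blast
  qed
  obtain k' l' q' where v': "v' = (x' + N * k', y' + M * l', w' - I * k' - J * l' + P * q')"
  proof -
    obtain k l w1 where 1: "v' = (x' + N * k, y' + M * l, w1)" "P dvd w1 - w' + I * k + J * l"
      using assms(2) by (cases v') (auto simp: uv)
    then obtain q where "w1 - w' + I * k + J * l = P * q" by (elim dvdE)
    then have "w1 = w' - I * k - J * l + P * q" by simp
    with 1 that show ?thesis by blast
  qed
  obtain \<alpha> \<beta> where ab: "trix R (N * k') = P * \<alpha>" "trix S (M * l) = P * \<beta>"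
    using trix_N_mult trix_M_mult by (metis dvdE)
  have "P dvd snd (snd (tmult R S u' v')) - snd (snd (tmult R S u v)) + I * (k + k') + J * (l + l')"
    unfolding uv u' v'
    by (simp add: trix_add ab, simp add: trix_def algebra_simps) (rule dvd_add dvd_diff dvd_triv_left RR_dvd RS_IJ_NM_dvd | rule dvd_mult)+
  moreover obtain p where p: "tmult R S u v = (x + x', y + y', p)"
    by (simp add: uv)
  moreover define p' where "p' = snd (snd (tmult R S u' v'))"
  moreover have p': "tmult R S u' v' = (x + x' + N * (k + k'), y + y' + M * (l + l'), p')"
    unfolding p'_def u' v' by (simp add: distrib_left)
  ultimately show ?thesis
    unfolding p p' tequiv.simps by (intro exI[of _ "k + k'"] exI[of _ "l + l'"]) simp
qed

definition model :: "triple monoid" where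
  "model = \<lparr>carrier = box, monoid.mult = (\<lambda>u v. reduce (tmult R S u v)), one = (0, 0, 0)\<rparr>"

lemma reduce_tmult [simp]:
  "reduce (tmult R S (reduce u) v) = reduce (tmult R S u v)"
  "reduce (tmult R S u (reduce v)) = reduce (tmult R S u v)"
  by (auto simp: reduce_eq_iff intro: sim_tmult_cong sim_refl sim_reduce)

lemma model_mult: "reduce u \<otimes>\<^bsub>model\<^esub> reduce v = reduce (tmult R S u v)"
  by (simp add: model_def)

lemma model_one: "\<one>\<^bsub>model\<^esub> = reduce (0, 0, 0)"
  by (simp add: model_def)

lemma model_carrier: "carrier model = range reduce"
  using reduce_in_box reduce_id by (auto simp: model_def image_iff) metis

lemma model_inverse: "\<exists>v. sim (tmult R S v u) (0, 0, 0)"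
proof -
  obtain x y w where u: "u = (x, y, w)" by (cases u)
  \<comment> \<open>The inverse is read backwards, \<open>c^-w b^-y a^-x\<close>, so that its
    factors cancel against those of \<open>u\<close> one after the other.\<close>
  define v where "v = tmult R S (tmult R S (0, 0, - w) (0, - y, 0)) (- x, 0, 0)"
  have 1: "sim (tmult R S (0, 0, - w) (0, 0, w)) (0, 0, 0)" "sim (tmult R S (0, - y, 0) (0, y, 0)) (0, 0, 0)"
    "sim (tmult R S (- x, 0, 0) (x, 0, 0)) (0, 0, 0)"
    by (auto intro!: exI[of _ "0::int"])
  have id: "tmult R S t (0, 0, 0) = t" "tmult R S (0, 0, 0) t = t" for t
    by (cases t; simp)+
  have u': "u = tmult R S (x, 0, 0) (tmult R S (0, y, 0) (0, 0, w))"
    by (simp add: u)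
  let ?m = "tmult R S"
  have as: "reduce (?m (?m p q) r) = reduce (?m p (?m q r))" for p q r
    by (simp add: reduce_eq_iff sim_tmult_assoc)
  have r1: "reduce (?m (0, 0, - w) (0, 0, w)) = reduce (0, 0, 0)" "reduce (?m (0, - y, 0) (0, y, 0)) = reduce (0, 0, 0)"
    "reduce (?m (- x, 0, 0) (x, 0, 0)) = reduce (0, 0, 0)"
    using 1 by (simp_all only: reduce_eq_iff)
  have cong: "reduce (?m p q) = reduce (?m p q')" if "reduce q = reduce q'" for p q q'
    using reduce_tmult(2)[of p q] reduce_tmult(2)[of p q'] that by simp
  have cancel: "reduce (?m p (?m q t)) = reduce t" if "reduce (?m p q) = reduce (0, 0, 0)" for p q t
  proof -
    have "reduce (?m p (?m q t)) = reduce (?m (?m p q) t)" by (rule as[symmetric])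
    also have "\<dots> = reduce (?m (reduce (?m p q)) t)" by (rule reduce_tmult(1)[symmetric])
    also have "\<dots> = reduce (?m (0, 0, 0) t)" unfolding that by (rule reduce_tmult(1))
    finally show ?thesis unfolding id .
  qed
  have "reduce (?m v u) = reduce (?m (?m (0, 0, - w) (0, - y, 0)) (?m (- x, 0, 0) u))"
    unfolding v_def by (rule as)
  also have "\<dots> = reduce (?m (?m (0, 0, - w) (0, - y, 0)) (?m (0, y, 0) (0, 0, w)))"
    unfolding u' by (intro cong cancel r1)
  also have "\<dots> = reduce (?m (0, 0, - w) (?m (0, - y, 0) (?m (0, y, 0) (0, 0, w))))" by (rule as)
  also have "\<dots> = reduce (?m (0, 0, - w) (0, 0, w))" by (intro cong cancel r1)
  also have "\<dots> = reduce (0, 0, 0)" by (rule r1)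
  finally show ?thesis unfolding reduce_eq_iff by (rule exI)
qed

lemma group_model: "group model"
proof (rule groupI)
  fix U assume "U \<in> carrier model"
  then obtain u where "U = reduce u" by (auto simp: model_carrier)
  then show "\<exists>V\<in>carrier model. V \<otimes>\<^bsub>model\<^esub> U = \<one>\<^bsub>model\<^esub>"
    using model_inverse[of u]
    by (metis model_carrier model_mult model_one rangeI reduce_eq_iff)
next
  fix U assume "U \<in> carrier model"
  then obtain x y w where "U = reduce (x, y, w)" by (auto simp: model_carrier)
  then show "\<one>\<^bsub>model\<^esub> \<otimes>\<^bsub>model\<^esub> U = U"
    unfolding model_one by (simp only: model_mult) simp
next
  fix U V W assume "U \<in> carrier model" "V \<in> carrier model" "W \<in> carrier model"
  then obtain u v w where "U = reduce u" "V = reduce v" "W = reduce w"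
    by (auto simp only: model_carrier)
  then show "U \<otimes>\<^bsub>model\<^esub> V \<otimes>\<^bsub>model\<^esub> W = U \<otimes>\<^bsub>model\<^esub> (V \<otimes>\<^bsub>model\<^esub> W)"
    by (simp only: model_mult reduce_eq_iff sim_tmult_assoc)
next
  fix U V assume "U \<in> carrier model" "V \<in> carrier model"
  then obtain u v where "U = reduce u" "V = reduce v"
    by (auto simp only: model_carrier)
  then show "U \<otimes>\<^bsub>model\<^esub> V \<in> carrier model"
    unfolding model_carrier by (simp only: model_mult rangeI)
next
  show "\<one>\<^bsub>model\<^esub> \<in> carrier model"
    unfolding model_carrier model_one by (rule rangeI)
qed

lemma order_model: "order model = nat (N * M * P)"
  by (simp only: order_def model_def partial_object.simps card_box)

end

section \<open>Normal forms fill the group and are unique when its order is maximal\<close>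

context group
begin

text \<open>The recursion is required upwards only; downwards it follows by cancelling
  \<open>g\<close>.\<close>

lemma int_pow_unique:
  fixes f :: "int \<Rightarrow> 'a"
  assumes "g \<in> carrier G" "f 0 = \<one>" "\<And>x. f x \<in> carrier G" "\<And>x. f (x + 1) = f x \<otimes> g"
  shows "g [^] x = f x"
proof (induction x rule: int_induct[where k = 0])
  case base
  then show ?case by (simp add: assms)
next
  case (step1 x)
  then show ?case by (simp add: assms int_pow_mult)
next
  case (step2 x)
  have "f (x - 1) \<otimes> g = g [^] x" using assms(4)[of "x - 1"] step2 by simp
  then have "f (x - 1) = g [^] x \<otimes> inv g"
    using assms(1,3) by (metis inv_solve_right int_pow_closed)
  then show ?case using assms(1) by (simp add: int_pow_diff)
qed

lemma int_pow_in_generate: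
  assumes "x \<in> generate G A" "A \<subseteq> carrier G"
  shows "x [^] (k :: int) \<in> generate G A"
  using subgroup_int_pow_closed[OF generate_is_subgroup[OF assms(2)] assms(1)] .

lemma commutator_in_generate:
  assumes "x \<in> generate G A" "y \<in> generate G A" "A \<subseteq> carrier G"
  shows "commutator G x y \<in> generate G A"
  using assms(1,2) generate_is_subgroup[OF assms(3)]
  by (simp add: commutator_def subgroup.m_closed subgroup.m_inv_closed)

end

context commutator_pair
begin

lemma cong_central:
  fixes k x :: int
  shows "c [^] (I * k) \<otimes> a [^] x = a [^] x \<otimes> c [^] (I * k)"
  "c [^] (J * k) \<otimes> a [^] x = a [^] x \<otimes> c [^] (J * k)"
  "c [^] (I * k) \<otimes> b [^] x = b [^] x \<otimes> c [^] (I * k)"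
  "c [^] (J * k) \<otimes> b [^] x = b [^] x \<otimes> c [^] (J * k)"
proof -
  have "c [^] (I * k * (1 + R * x)) = c [^] (I * k)" "c [^] (J * k * (1 + R * x)) = c [^] (J * k)"
    "c [^] (I * k * (1 + S * x)) = c [^] (I * k)" "c [^] (J * k * (1 + S * x)) = c [^] (J * k)"
  proof -
    have e: "z * k - z * k * (1 + q * x) = - (z * q) * (k * x)" for z q :: int by (simp add: algebra_simps)
    have d: "P dvd z * k - z * k * (1 + q * x)" if "P dvd z * q" for z q
      unfolding e using that by (simp add: dvd_mult2)
    show "c [^] (I * k * (1 + R * x)) = c [^] (I * k)" "c [^] (J * k * (1 + R * x)) = c [^] (J * k)"
      "c [^] (I * k * (1 + S * x)) = c [^] (I * k)" "c [^] (J * k * (1 + S * x)) = c [^] (J * k)"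
      by (intro c_pow_cong d RS_IJ)+
  qed
  then show "c [^] (I * k) \<otimes> a [^] x = a [^] x \<otimes> c [^] (I * k)"
    "c [^] (J * k) \<otimes> a [^] x = a [^] x \<otimes> c [^] (J * k)"
    "c [^] (I * k) \<otimes> b [^] x = b [^] x \<otimes> c [^] (I * k)"
    "c [^] (J * k) \<otimes> b [^] x = b [^] x \<otimes> c [^] (J * k)"
    by (simp_all add: c_a c_b)
qed

lemma phi_sim:
  assumes "sim u v"
  shows "\<phi> u = \<phi> v"
proof -
  obtain x y w x' y' w' where uv: "u = (x, y, w)" "v = (x', y', w')" by (cases u, cases v) auto
  obtain k l where kl: "x' = x + N * k" "y' = y + M * l" "P dvd (w' - w + I * k + J * l)"
    using assms by (auto simp: uv)
  have "\<phi> v = a [^] x \<otimes> (a [^] N) [^] k \<otimes> (b [^] y \<otimes> (b [^] M) [^] l) \<otimes> c [^] w'"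
    unfolding uv kl by (simp add: int_pow_mult int_pow_pow)
  also have "\<dots> = a [^] x \<otimes> (c [^] (I * k) \<otimes> b [^] y) \<otimes> c [^] (J * l) \<otimes> c [^] w'"
    by (simp add: a_pow_N b_pow_M int_pow_pow m_assoc)
  also have "\<dots> = a [^] x \<otimes> b [^] y \<otimes> (c [^] (I * k) \<otimes> c [^] (J * l) \<otimes> c [^] w')"
    unfolding cong_central by (simp add: m_assoc)
  also have "c [^] (I * k) \<otimes> c [^] (J * l) \<otimes> c [^] w' = c [^] (w' + I * k + J * l)"
    by (simp add: add.commute add.left_commute flip: int_pow_mult)
  also have "\<dots> = c [^] w"
  proof (intro c_pow_cong)
    have "w - (w' + I * k + J * l) = - (w' - w + I * k + J * l)" by simp
    then show "P dvd w - (w' + I * k + J * l)" using kl(3) by (metis dvd_minus_iff)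
  qed
  finally show ?thesis by (simp add: uv)
qed

lemma inv_phi: "inv \<phi> (x, y, w) \<in> range \<phi>"
proof -
  have "inv \<phi> (x, y, w) = \<phi> (0, 0, - w) \<otimes> (\<phi> (0, - y, 0) \<otimes> \<phi> (- x, 0, 0))"
    by (simp add: inv_mult_group int_pow_neg m_assoc)
  then show ?thesis unfolding phi_mult by blast
qed

lemma subgroup_range_phi: "subgroup (range \<phi>) G"
proof (rule subgroupI)
  show "range \<phi> \<subseteq> carrier G" by auto
  show "range \<phi> \<noteq> {}" by simp
  show "inv g \<in> range \<phi>" if "g \<in> range \<phi>" for g
    using that inv_phi by force
  show "g \<otimes> h \<in> range \<phi>" if "g \<in> range \<phi>" "h \<in> range \<phi>" for g h
    using that by (auto simp: phi_mult simp del: tmult.simps \<phi>.simps)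
qed

lemma range_phi: "range \<phi> = generate G {a, b}"
proof
  have "a \<in> range \<phi>" "b \<in> range \<phi>"
    using phi_a phi_b by (metis rangeI)+
  then show "generate G {a, b} \<subseteq> range \<phi>"
    by (intro generate_subgroup_incl[OF _ subgroup_range_phi]) simp
  have "a \<in> generate G {a, b}" "b \<in> generate G {a, b}" by (auto intro: generate.incl)
  moreover have ab: "{a, b} \<subseteq> carrier G" by simp
  ultimately have "\<phi> (x, y, w) \<in> generate G {a, b}" for x y w
    unfolding \<phi>.simps
    by (intro generate.eng int_pow_in_generate commutator_in_generate) auto
  then show "range \<phi> \<subseteq> generate G {a, b}" by auto
qed

lemma range_phi_box: "range \<phi> = \<phi> ` box"
proof -
  have "\<phi> u \<in> \<phi> ` box" for u
    unfolding phi_sim[OF sim_reduce(2), of u] by (intro imageI reduce_in_box)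
  then show ?thesis by blast
qed

end

locale generating_pair = commutator_pair +
  assumes gen: "generate G {a, b} = carrier G"
begin

lemma carrier_eq: "carrier G = range \<phi>"
  using gen range_phi by simp

lemma finite_carrier: "finite (carrier G)" and order_le: "order G \<le> nat (N * M * P)"
proof -
  show "finite (carrier G)" by (simp only: carrier_eq range_phi_box finite_box finite_imageI)
  show "order G \<le> nat (N * M * P)"
    unfolding order_def carrier_eq range_phi_box card_box[symmetric] by (rule card_image_le[OF finite_box])
qed

text \<open>Counting: \<open>\<phi>\<close> maps the box of reduced triples onto the group, so when
  both have the same size it is injective there.\<close>

lemma phi_eq_iff:
  assumes "order G = nat (N * M * P)"
  shows "\<phi> u = \<phi> v \<longleftrightarrow> sim u v"
proof
  assume eq: "\<phi> u = \<phi> v"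
  have "inj_on \<phi> box"
    using assms unfolding order_def carrier_eq range_phi_box card_box[symmetric]
    by (intro eq_card_imp_inj_on finite_box)
  moreover have "\<phi> (reduce u) = \<phi> (reduce v)"
    using eq phi_sim[OF sim_reduce(1)] by metis
  ultimately have "reduce u = reduce v" by (auto dest: inj_onD simp: reduce_in_box simp del: \<phi>.simps)
  then show "sim u v" by (simp only: reduce_eq_iff)
qed (rule phi_sim)

end

context model_params
begin

abbreviation "mod_a \<equiv> reduce (1, 0, 0)"
abbreviation "mod_b \<equiv> reduce (0, 1, 0)"

lemma reduce_carrier: "reduce u \<in> carrier model"
  unfolding model_carrier by (rule rangeI)

lemma model_pows: "mod_a [^]\<^bsub>model\<^esub> x = reduce (x, 0, 0)" "mod_b [^]\<^bsub>model\<^esub> x = reduce (0, x, 0)"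
  "reduce (0, 0, 1) [^]\<^bsub>model\<^esub> x = reduce (0, 0, x)" for x :: int
proof -
  interpret model: group model by (rule group_model)
  have 1: "reduce (y + 1, 0, 0) = reduce (y, 0, 0) \<otimes>\<^bsub>model\<^esub> mod_a"
    "reduce (0, y + 1, 0) = reduce (0, y, 0) \<otimes>\<^bsub>model\<^esub> mod_b"
    "reduce (0, 0, y + 1) = reduce (0, 0, y) \<otimes>\<^bsub>model\<^esub> reduce (0, 0, 1)" for y
    unfolding model_mult by (simp_all only: tmult.simps trix_simps) simp_all
  show "mod_a [^]\<^bsub>model\<^esub> x = reduce (x, 0, 0)"
    by (intro model.int_pow_unique reduce_carrier 1 model_one[symmetric])
  show "mod_b [^]\<^bsub>model\<^esub> x = reduce (0, x, 0)"
    by (intro model.int_pow_unique[of _ "\<lambda>x. reduce (0, x, 0)"] reduce_carrier 1 model_one[symmetric])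
  show "reduce (0, 0, 1) [^]\<^bsub>model\<^esub> x = reduce (0, 0, x)"
    by (intro model.int_pow_unique[of _ "\<lambda>x. reduce (0, 0, x)"] reduce_carrier 1 model_one[symmetric])
qed

lemma model_commutator: "commutator model mod_a mod_b = reduce (0, 0, 1)"
  by (intro group.commutator_unique[OF group_model] reduce_carrier) (simp only: model_mult tmult.simps, simp)

lemma generating_pair_model: "generating_pair model N M P R S I J mod_a mod_b"
proof -
  interpret model: group model by (rule group_model)
  interpret commutator_pair model N M P R S I J mod_a mod_b
  proof (unfold_locales, unfold model_commutator model_pows)
    show "reduce (0, 0, P) = \<one>\<^bsub>model\<^esub>"
      unfolding model_one reduce_eq_iff tequiv.simps by (intro exI[of _ 0]) simp
    show "commutator model (reduce (0, 0, 1)) mod_a = reduce (0, 0, R)"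
      by (intro group.commutator_unique[OF group_model] reduce_carrier) (simp only: model_mult tmult.simps, simp)
    show "commutator model (reduce (0, 0, 1)) mod_b = reduce (0, 0, S)"
      by (intro group.commutator_unique[OF group_model] reduce_carrier) (simp only: model_mult tmult.simps, simp)
    show "reduce (N, 0, 0) = reduce (0, 0, I)"
      unfolding reduce_eq_iff tequiv.simps by (intro exI[of _ "-1"] exI[of _ 0]) simp
    show "reduce (0, M, 0) = reduce (0, 0, J)"
      unfolding reduce_eq_iff tequiv.simps by (intro exI[of _ 0] exI[of _ "-1"]) simp
  qed (rule reduce_carrier)+
  \<comment> \<open>In the model the element with exponents \<open>u\<close> is the reduced triple
    itself, so the two generators reach everything.\<close>
  have "\<phi> u = reduce u" for u
    by (cases u) (simp only: \<phi>.simps model_commutator model_pows model_mult tmult.simps, simp)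
  then have "\<phi> = reduce" by (rule ext)
  then have "range \<phi> = carrier model" by (simp only: model_carrier)
  then show ?thesis by unfold_locales (simp only: range_phi)
qed

end

subsection \<open>The presented groups\<close>

lemma word_val_append:
  assumes "group H" "\<And>x. f x \<in> carrier H"
  shows "word_val H f (u @ v) = word_val H f u \<otimes>\<^bsub>H\<^esub> word_val H f v"
    and "word_val H f u \<in> carrier H"
proof -
  interpret H: group H by fact
  have cl: "word_val H f w \<in> carrier H" for w
    by (induction w) (auto simp: assms)
  then show "word_val H f u \<in> carrier H" .
  show "word_val H f (u @ v) = word_val H f u \<otimes>\<^bsub>H\<^esub> word_val H f v"
    by (induction u) (auto simp: assms cl H.m_assoc)
qed

lemma word_val_wpow:
  assumes "group H" "\<And>x. f x \<in> carrier H"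
  shows "word_val H f (w \<up> k) = word_val H f w [^]\<^bsub>H\<^esub> k"
proof (induction k)
  case 0
  then show ?case by (simp add: wpow_def)
next
  case (Suc k)
  have "w \<up> Suc k = w @ w \<up> k" by (simp add: wpow_def)
  then show ?case
    using Suc monoid.nat_pow_Suc2[OF group.is_monoid[OF assms(1)] word_val_append(2)[of H f w, OF assms]] by (simp add: word_val_append[OF assms])
qed

lemma word_val_wcomm:
  assumes "group H" "\<And>x. f x \<in> carrier H"
  shows "word_val H f (wcomm [(x, True)] [(y, True)]) = commutator H (f x) (f y)"
proof -
  interpret H: group H by fact
  show ?thesis by (simp add: wcomm_def winv_def commutator_def assms(2) H.m_assoc)
qed

lemma inv_word_class:
  "inv\<^bsub>presented_group R\<^esub> (word_class R [(x, True)]) = word_class R [(x, False)]"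
proof -
  interpret group "presented_group R" by (rule group_presented_group)
  show ?thesis
  proof (rule inv_equality)
    show "word_class R [(x, False)] \<otimes>\<^bsub>presented_group R\<^esub> word_class R [(x, True)] = \<one>\<^bsub>presented_group R\<^esub>"
      using word_eq.cancel[of R x False]
      by (simp add: mult_word_class one_presented_group word_class_eq_iff)
  qed (auto simp: carrier_presented_group)
qed

definition gen_class :: "('g word \<times> 'g word) set \<Rightarrow> 'g \<Rightarrow> 'g word set" where
  "gen_class R x = word_class R [(x, True)]"

lemma gen_class_closed: "gen_class R x \<in> carrier (presented_group R)"
  by (simp add: gen_class_def carrier_presented_group)

lemma word_val_gen_class: "word_val (presented_group R) (gen_class R) w = word_class R w"
proof (induction w)
  case Nil
  then show ?case by (simp add: one_presented_group)
next
  case (Cons xs w)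
  then show ?case
    by (cases xs) (auto simp: gen_class_def inv_word_class mult_word_class)
qed

lemma word_val_in_generate:
  assumes "group H" "\<And>x. f x \<in> carrier H"
  shows "word_val H f w \<in> generate H (range f)"
proof -
  interpret H: group H by fact
  have sub: "subgroup (generate H (range f)) H"
    by (rule H.generate_is_subgroup) (auto simp: assms(2))
  have "f x \<in> generate H (range f)" "inv\<^bsub>H\<^esub> f x \<in> generate H (range f)" for x
    by (auto intro: generate.incl generate.inv)
  then show ?thesis
  proof (induction w)
    case (Cons xs w)
    then show ?case by (cases xs) (auto intro!: generate.eng simp del: generate.intros)
  qed (simp add: generate.one)
qed

lemma generate_gen_class: "generate (presented_group R) (range (gen_class R)) = carrier (presented_group R)"
proof -
  interpret group "presented_group R" by (rule group_presented_group)
  have "word_class R w \<in> generate (presented_group R) (range (gen_class R))" for w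
    using word_val_in_generate[of "presented_group R" "gen_class R" w, OF group_presented_group gen_class_closed]
    unfolding word_val_gen_class .
  then have "carrier (presented_group R) \<subseteq> generate (presented_group R) (range (gen_class R))"
    unfolding carrier_presented_group by (rule image_subsetI)
  moreover have "range (gen_class R) \<subseteq> carrier (presented_group R)"
    using gen_class_closed by (rule image_subsetI)
  ultimately show ?thesis by (intro subset_antisym generate_incl)
qed

lemma gen_class_relations: "(u, v) \<in> R \<Longrightarrow>
    word_val (presented_group R) (gen_class R) u = word_val (presented_group R) (gen_class R) v"
  unfolding word_val_gen_class by (simp add: word_class_eq_iff word_eq.rel)

lemma presented_group_surj:
  assumes "group H" "\<And>x. f x \<in> carrier H"
    and "\<And>u v. (u, v) \<in> R \<Longrightarrow> word_val H f u = word_val H f v"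
    and "generate H (range f) = carrier H"
  shows "\<exists>h \<in> hom (presented_group R) H. h ` carrier (presented_group R) = carrier H"
proof -
  obtain h where h: "h \<in> hom (presented_group R) H" "\<And>w. h (word_class R w) = word_val H f w"
    using presented_group_universal[of H f R] assms(1,2,3) by blast
  interpret group_hom "presented_group R" H h
    using h(1) assms(1) group_presented_group by (simp add: group_hom_def group_hom_axioms_def)
  have "f x = h (gen_class R x)" for x
    using assms(1,2) by (simp add: gen_class_def h(2) group.is_monoid monoid.r_one)
  then have "f x \<in> h ` carrier (presented_group R)" for x
    by (simp only: imageI gen_class_closed)
  then have "range f \<subseteq> h ` carrier (presented_group R)" by (rule image_subsetI)
  then have "carrier H \<subseteq> h ` carrier (presented_group R)"
    unfolding assms(4)[symmetric] by (intro H.generate_subgroup_incl img_is_subgroup)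
  then have "h ` carrier (presented_group R) = carrier H" using hom_closed by (intro subset_antisym) auto
  show ?thesis by (intro bexI[of _ h] h(1)) fact
qed

lemma surj_hom_iso:
  assumes "h \<in> hom G H" "h ` carrier G = carrier H" "finite (carrier G)" "order G = order H"
  shows "G \<cong> H"
proof -
  have "inj_on h (carrier G)"
    using assms by (intro eq_card_imp_inj_on) (simp_all add: order_def)
  then have "h \<in> iso G H" using assms by (simp add: iso_def bij_betw_def)
  then show ?thesis by (auto simp: is_iso_def)
qed

fun gen_map :: "'a \<Rightarrow> 'a \<Rightarrow> 'a \<Rightarrow> gen \<Rightarrow> 'a" where
  "gen_map x y z Gen_a = x"
| "gen_map x y z Gen_b = y"
| "gen_map x y z Gen_c = z"

lemma range_gen: "range f = {f Gen_a, f Gen_b, f Gen_c}"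
proof -
  have "(UNIV :: gen set) = {Gen_a, Gen_b, Gen_c}"
    using gen.exhaust by auto
  then have "range f = f ` {Gen_a, Gen_b, Gen_c}" by (rule arg_cong)
  then show ?thesis by simp
qed

lemma (in group) generate_insert_commutator:
  assumes "x \<in> carrier G" "y \<in> carrier G"
  shows "generate G {x, y, commutator G x y} = generate G {x, y}"
proof
  have "{x, y, commutator G x y} \<subseteq> generate G {x, y}"
    using commutator_in_generate[of x "{x, y}" y] assms by (auto intro: generate.incl)
  then show "generate G {x, y, commutator G x y} \<subseteq> generate G {x, y}"
    using assms by (intro generate_subgroup_incl generate_is_subgroup) auto
qed (rule mono_generate, auto)

text \<open>The tuple \<open>(n, m, i, j, r, s)\<close> stands for $a^{p^n} = c^{pi}$, $b^{p^m} = c^{pj}$,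
  $[c,a] = c^{pr}$, $[c,b] = c^{ps}$, with $c = [a,b]$ and $c^{p^2} = 1$.\<close>

type_synonym params = "nat \<times> nat \<times> nat \<times> nat \<times> nat \<times> nat"

text \<open>In A2 the generator of order $4$ modulo $\langle c \rangle$ is \<open>b\<close>, so that $n < m$ there.\<close>

fun params_of :: "family \<Rightarrow> params" where
  "params_of A1 = (2, 1, 0, 0, 1, 1)"
| "params_of A2 = (1, 2, 1, 0, 1, 1)"
| "params_of A3 = (2, 1, 1, 0, 1, 1)"
| "params_of (B1 n) = (n, 1, 1, 0, 0, 1)"
| "params_of (B2 n) = (n, 1, 0, 0, 0, 1)"
| "params_of (B3 n) = (n, 1, 0, 1, 0, 1)"
| "params_of C1 = (2, 2, 1, 1, 0, 0)"
| "params_of C2 = (2, 2, 1, 0, 0, 0)"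
| "params_of C3 = (2, 2, 1, 1, 0, 1)"
| "params_of C4 = (2, 2, 1, 0, 0, 1)"
| "params_of C5 = (2, 2, 1, 0, 1, 0)"
| "params_of (D1 n t) = (n, n, 1, 0, 0, t)"
| "params_of (D2 n) = (n, n, 1, 0, 1, 0)"
| "params_of (D3 n) = (n, n, 1, 0, 0, 0)"
| "params_of (D4 n) = (n, n, 0, 0, 1, 0)"
| "params_of (D5 n) = (n, n, 0, 0, 0, 0)"
| "params_of (E1 n m t) = (n, m, 1, 0, 0, t)"
| "params_of (E2 n m) = (n, m, 1, 0, 1, 0)"
| "params_of (E3 n m) = (n, m, 1, 0, 0, 0)"
| "params_of (E4 n m) = (n, m, 0, 1, 0, 1)"
| "params_of (E5 n m t) = (n, m, 0, 1, t, 0)"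
| "params_of (E6 n m) = (n, m, 0, 1, 0, 0)"
| "params_of (E7 n m) = (n, m, 0, 0, 0, 1)"
| "params_of (E8 n m) = (n, m, 0, 0, 1, 0)"
| "params_of (E9 n m) = (n, m, 0, 0, 0, 0)"

fun satisfies :: "nat \<Rightarrow> ('a, 'b) monoid_scheme \<Rightarrow> 'a \<Rightarrow> 'a \<Rightarrow> 'a \<Rightarrow> params \<Rightarrow> bool" where
  "satisfies p H x y z (n, m, i, j, r, s) \<longleftrightarrow>
     commutator H x y = z \<and> z [^]\<^bsub>H\<^esub> (p ^ 2) = \<one>\<^bsub>H\<^esub> \<and>
     x [^]\<^bsub>H\<^esub> (p ^ n) = z [^]\<^bsub>H\<^esub> (p * i) \<and> y [^]\<^bsub>H\<^esub> (p ^ m) = z [^]\<^bsub>H\<^esub> (p * j) \<and>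
     commutator H z x = z [^]\<^bsub>H\<^esub> (p * r) \<and> commutator H z y = z [^]\<^bsub>H\<^esub> (p * s)"

text \<open>Where a presentation does not list \<open>c^(p^2) = 1\<close>, it follows, because
  \<open>c^p\<close> equals a power of \<open>a\<close> or \<open>b\<close> whose
  \<open>p\<close>-th power is trivial. Conversely \<open>c^(p^2) = 1\<close> gives back the order
  relation of that generator.\<close>

lemma relations_iff:
  assumes "group H" "\<And>x. f x \<in> carrier H" "admissible p L"
  shows "(\<forall>(u, v) \<in> relations p L. word_val H f u = word_val H f v) \<longleftrightarrow>
    satisfies p H (f Gen_a) (f Gen_b) (f Gen_c) (params_of L)"
proof -
  interpret H: group H by fact
  note cl = assms(2)
  have single: "word_val H f [(x, True)] = f x" for x by (simp add: cl)
  note wv = word_val_wpow[OF assms(1,2)] word_val_wcomm[OF assms(1,2)] single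
  define x where "x = f Gen_a"
  define y where "y = f Gen_b"
  define z where "z = f Gen_c"
  have cl: "x \<in> carrier H" "y \<in> carrier H" "z \<in> carrier H" by (simp_all add: x_def y_def z_def cl)
  \<comment> \<open>All exponents become iterated powers, so that a relation such as
    \<open>x^(p^n) = z^p\<close> can be substituted inside a further power.\<close>
  have pow_simps: "g [^]\<^bsub>H\<^esub> (k * p ^ l) = (g [^]\<^bsub>H\<^esub> (p ^ l)) [^]\<^bsub>H\<^esub> k"
    "g [^]\<^bsub>H\<^esub> (k * 2 ^ l) = (g [^]\<^bsub>H\<^esub> ((2 :: nat) ^ l)) [^]\<^bsub>H\<^esub> k"
    "g [^]\<^bsub>H\<^esub> (k * p) = (g [^]\<^bsub>H\<^esub> p) [^]\<^bsub>H\<^esub> k"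
    "g [^]\<^bsub>H\<^esub> (p * k) = (g [^]\<^bsub>H\<^esub> p) [^]\<^bsub>H\<^esub> k"
    "g [^]\<^bsub>H\<^esub> (p ^ 2) = (g [^]\<^bsub>H\<^esub> p) [^]\<^bsub>H\<^esub> p"
    "g [^]\<^bsub>H\<^esub> (4 :: nat) = (g [^]\<^bsub>H\<^esub> (2 :: nat)) [^]\<^bsub>H\<^esub> (2 :: nat)"
    "g [^]\<^bsub>H\<^esub> (8 :: nat) = ((g [^]\<^bsub>H\<^esub> (2 :: nat)) [^]\<^bsub>H\<^esub> (2 :: nat)) [^]\<^bsub>H\<^esub> (2 :: nat)"
    if "g \<in> carrier H" for g and k l :: nat
    using that by (simp_all add: H.nat_pow_pow power2_eq_square mult.commute)
  note D = wv x_def[symmetric] y_def[symmetric] z_def[symmetric]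
  show ?thesis
  proof (cases L)
    case A1
    with assms(3) cl show ?thesis by (auto simp: D pow_simps)
  next
    case A2
    with assms(3) cl show ?thesis by (auto simp: D pow_simps)
  next
    case A3
    with assms(3) cl show ?thesis by (auto simp: D pow_simps)
  next
    case (B1 n)
    with assms(3) cl show ?thesis by (auto simp: D pow_simps)
  next
    case (B2 n)
    with assms(3) cl show ?thesis by (auto simp: D pow_simps)
  next
    case (B3 n)
    with assms(3) cl show ?thesis by (auto simp: D pow_simps)
  next
    case C1
    with assms(3) cl show ?thesis by (auto simp: D pow_simps)
  next
    case C2
    with assms(3) cl show ?thesis by (auto simp: D pow_simps)
  next
    case C3
    with assms(3) cl show ?thesis by (auto simp: D pow_simps)
  next
    case C4
    with assms(3) cl show ?thesis by (auto simp: D pow_simps)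
  next
    case C5
    with assms(3) cl show ?thesis by (auto simp: D pow_simps)
  next
    case (D1 n t)
    with assms(3) cl show ?thesis by (auto simp: D pow_simps)
  next
    case (D2 n)
    with assms(3) cl show ?thesis by (auto simp: D pow_simps)
  next
    case (D3 n)
    with assms(3) cl show ?thesis by (auto simp: D pow_simps)
  next
    case (D4 n)
    with assms(3) cl show ?thesis by (auto simp: D pow_simps)
  next
    case (D5 n)
    with assms(3) cl show ?thesis by (auto simp: D pow_simps)
  next
    case (E1 n m t)
    with assms(3) cl show ?thesis by (auto simp: D pow_simps)
  next
    case (E2 n m)
    with assms(3) cl show ?thesis by (auto simp: D pow_simps)
  next
    case (E3 n m)
    with assms(3) cl show ?thesis by (auto simp: D pow_simps)
  next
    case (E4 n m)
    with assms(3) cl show ?thesis by (auto simp: D pow_simps)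
  next
    case (E5 n m t)
    with assms(3) cl show ?thesis by (auto simp: D pow_simps)
  next
    case (E6 n m)
    with assms(3) cl show ?thesis by (auto simp: D pow_simps)
  next
    case (E7 n m)
    with assms(3) cl show ?thesis by (auto simp: D pow_simps)
  next
    case (E8 n m)
    with assms(3) cl show ?thesis by (auto simp: D pow_simps)
  next
    case (E9 n m)
    with assms(3) cl show ?thesis by (auto simp: D pow_simps)
  qed
qed

section \<open>Orders of the listed groups\<close>

definition has_pair ::
    "nat \<Rightarrow> ('a, 'b) monoid_scheme \<Rightarrow> 'a \<Rightarrow> 'a \<Rightarrow> nat \<Rightarrow> nat \<Rightarrow> int \<Rightarrow> int \<Rightarrow> int \<Rightarrow> int \<Rightarrow> bool" where
  "has_pair p G x y n m i j r s \<longleftrightarrow>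
     generating_pair G (int p ^ n) (int p ^ m) (int p ^ 2) (int p * r) (int p * s) (int p * i) (int p * j) x y"

lemma sq_dvd: "int p ^ 2 dvd (int p * u) * (int p * v)"
  by (simp add: power2_eq_square mult.left_commute mult.assoc)

lemma pair_params_p:
  "0 < p \<Longrightarrow> pair_params (int p ^ n) (int p ^ m) (int p ^ 2) (int p * r) (int p * s) (int p * i) (int p * j)"
  unfolding pair_params_def by (intro conjI sq_dvd) simp_all

lemma has_pair_iff:
  assumes "0 < p"
  shows "has_pair p G x y n m i j r s \<longleftrightarrow> group G \<and> x \<in> carrier G \<and> y \<in> carrier G \<and>
    generate G {x, y} = carrier G \<and> commutator G x y [^]\<^bsub>G\<^esub> (int p ^ 2) = \<one>\<^bsub>G\<^esub> \<and>
    x [^]\<^bsub>G\<^esub> (int p ^ n) = commutator G x y [^]\<^bsub>G\<^esub> (int p * i) \<and>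
    y [^]\<^bsub>G\<^esub> (int p ^ m) = commutator G x y [^]\<^bsub>G\<^esub> (int p * j) \<and>
    commutator G (commutator G x y) x = commutator G x y [^]\<^bsub>G\<^esub> (int p * r) \<and>
    commutator G (commutator G x y) y = commutator G x y [^]\<^bsub>G\<^esub> (int p * s)"
  unfolding has_pair_def generating_pair_def generating_pair_axioms_def commutator_pair_def
    commutator_pair_axioms_def using pair_params_p[OF assms] by blast

lemma satisfies_iff_has_pair:
  assumes "group H" "x \<in> carrier H" "y \<in> carrier H" "0 < p"
  shows "satisfies p H x y z (n, m, i, j, r, s) \<and> generate H {x, y} = carrier H \<longleftrightarrow>
    z = commutator H x y \<and> has_pair p H x y n m (int i) (int j) (int r) (int s)"
proof -
  interpret H: group H by fact
  have "g [^]\<^bsub>H\<^esub> (int p ^ k) = g [^]\<^bsub>H\<^esub> (p ^ k)" "g [^]\<^bsub>H\<^esub> (int p * int k) = g [^]\<^bsub>H\<^esub> (p * k)" for g k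
    by (simp_all add: int_pow_int flip: of_nat_power of_nat_mult)
  then show ?thesis unfolding has_pair_iff[OF assms(4)] satisfies.simps using assms by auto
qed

text \<open>Twice this number is a multiple of \<open>p^n\<close>, which settles odd
  \<open>p\<close>. For \<open>p = 2\<close> one factor 2 is lost, whence
  \<open>n \<ge> 2\<close>.\<close>

lemma prime_dvd_tri_power:
  assumes "Factorial_Ring.prime p" "n \<ge> 2"
  shows "int p dvd tri (int p ^ n)"
proof (cases "p = 2")
  case True
  have "n = Suc (Suc (n - 2))" using assms(2) by simp
  then have "(2::int) ^ n = 2 * (2 * 2 ^ (n - 2))" by (metis power_Suc)
  then have "2 * tri (2 ^ n) = 2 * (2 * (2 ^ (n - 2) * (2 ^ n - 1)))"
    unfolding two_tri by simp
  then show ?thesis using True by simp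
next
  case False
  have "int p dvd 2 * tri (int p ^ n)"
    unfolding two_tri using assms(2) by (intro dvd_mult2) simp
  moreover have "\<not> int p dvd 2"
    using False assms(1) by (metis int_dvd_int_iff of_nat_numeral primes_dvd_imp_eq two_is_prime_nat)
  ultimately show ?thesis using assms(1) by (simp add: prime_dvd_mult_iff)
qed

lemma sq_dvd_trix_power:
  assumes "Factorial_Ring.prime p" "n \<ge> 2"
  shows "int p ^ 2 dvd trix (int p * r) (int p ^ n)"
proof -
  have "int p ^ 2 dvd int p ^ n" using assms(2) by (rule le_imp_power_dvd)
  moreover have "int p ^ 2 dvd int p * r * tri (int p ^ n)"
    using prime_dvd_tri_power[OF assms] by (auto simp: power2_eq_square mult.assoc)
  ultimately show ?thesis by (simp add: trix_def)
qed

lemma model_params_p: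
  assumes "Factorial_Ring.prime p" "n \<ge> 1" "m \<ge> 1"
    "n \<ge> 2 \<or> int p ^ 2 dvd trix (int p * r) (int p ^ n)" "m \<ge> 2 \<or> int p ^ 2 dvd trix (int p * s) (int p ^ m)"
  shows "model_params (int p ^ n) (int p ^ m) (int p ^ 2) (int p * r) (int p * s) (int p * i) (int p * j)"
proof -
  have "int p ^ 2 dvd int p * q * int p ^ k" if "k \<ge> 1" for q k
  proof -
    have "int p ^ k = int p * int p ^ (k - 1)" using that by (metis power_eq_if not_one_le_zero)
    then show ?thesis by (simp only: sq_dvd)
  qed
  then show ?thesis
    unfolding model_params_def model_params_axioms_def
    using assms sq_dvd_trix_power[OF assms(1)] pair_params_p[OF prime_gt_0_nat[OF assms(1)]] by blast
qed

text \<open>The exponent 1 occurs only for \<open>p = 2\<close>, and the commutator parameter of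
  that generator is then 1. The condition holds because \<open>trix 2 2 = 2 + 2 * tri 2\<close> is
  4.\<close>

lemma model_params_listed:
  assumes "Factorial_Ring.prime p" "admissible p L" "params_of L = (n, m, i, j, r, s)"
  shows "model_params (int p ^ n) (int p ^ m) (int p ^ 2)
    (int p * int r) (int p * int s) (int p * int i) (int p * int j)"
proof -
  have t: "tri 2 = 1" by (simp add: tri_def)
  have "case params_of L of (n, m, i, j, r, s) \<Rightarrow> n \<ge> 1 \<and> m \<ge> 1 \<and>
    (n \<ge> 2 \<or> int p ^ 2 dvd trix (int p * int r) (int p ^ n)) \<and>
    (m \<ge> 2 \<or> int p ^ 2 dvd trix (int p * int s) (int p ^ m))"
    using assms(2) by (cases L) (simp_all add: trix_def t)
  then have "n \<ge> 1 \<and> m \<ge> 1 \<and>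
    (n \<ge> 2 \<or> int p ^ 2 dvd trix (int p * int r) (int p ^ n)) \<and>
    (m \<ge> 2 \<or> int p ^ 2 dvd trix (int p * int s) (int p ^ m))"
    unfolding assms(3) prod.case .
  then show ?thesis by (intro model_params_p assms(1)) auto
qed

lemma generate_listed:
  "generate (listed_group p L) {gen_class (relations p L) Gen_a, gen_class (relations p L) Gen_b, gen_class (relations p L) Gen_c}
    = carrier (listed_group p L)"
  unfolding listed_group_def range_gen[symmetric] by (rule generate_gen_class)

lemma listed_has_pair:
  assumes "Factorial_Ring.prime p" "admissible p L" "params_of L = (n, m, i, j, r, s)"
  shows "\<exists>x y. has_pair p (listed_group p L) x y n m (int i) (int j) (int r) (int s)"
proof -
  let ?G = "listed_group p L"
  have G: "group ?G" unfolding listed_group_def by (rule group_presented_group)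
  define g where "g = gen_class (relations p L)"
  have g: "g x \<in> carrier ?G" for x
    unfolding g_def listed_group_def by (rule gen_class_closed)
  have "satisfies p ?G (g Gen_a) (g Gen_b) (g Gen_c) (params_of L)"
  proof (rule iffD1[OF relations_iff[OF G g assms(2)]])
    show "\<forall>(u, v)\<in>relations p L. word_val ?G g u = word_val ?G g v"
      unfolding g_def listed_group_def by (clarify, rule gen_class_relations)
  qed
  moreover from this have "g Gen_c = commutator ?G (g Gen_a) (g Gen_b)" by (simp add: assms(3))
  then have "generate ?G {g Gen_a, g Gen_b} = carrier ?G"
    using generate_listed[of p L] group.generate_insert_commutator[OF G g g, of Gen_a Gen_b] by (simp add: g_def)
  ultimately show ?thesis
    using satisfies_iff_has_pair[OF G g g prime_gt_0_nat[OF assms(1)]] unfolding assms(3) by blast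
qed

lemma listed_surj:
  assumes "Factorial_Ring.prime p" "admissible p L" "params_of L = (n, m, i, j, r, s)"
    and "has_pair p H x y n m (int i) (int j) (int r) (int s)"
  shows "\<exists>h \<in> hom (listed_group p L) H. h ` carrier (listed_group p L) = carrier H"
proof -
  have p: "0 < p" using assms(1) by (rule prime_gt_0_nat)
  have H: "group H" and xy: "x \<in> carrier H" "y \<in> carrier H"
    using assms(4) unfolding has_pair_iff[OF p] by auto
  define f where "f = gen_map x y (commutator H x y)"
  have f: "f u \<in> carrier H" for u
    by (cases u) (simp_all add: f_def xy group.commutator_closed[OF H])
  have sat: "satisfies p H x y (commutator H x y) (n, m, i, j, r, s)" "generate H {x, y} = carrier H"
    using satisfies_iff_has_pair[OF H xy p] assms(4) by blast+
  have rel: "\<forall>(u, v) \<in> relations p L. word_val H f u = word_val H f v"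
    unfolding relations_iff[OF H f assms(2)] using sat(1) by (simp add: f_def assms(3))
  have gen: "generate H (range f) = carrier H"
    unfolding range_gen using sat(2) group.generate_insert_commutator[OF H xy] by (simp add: f_def)
  show ?thesis unfolding listed_group_def
    by (rule presented_group_surj[OF H f _ gen]) (use rel in blast)
qed

lemma nat_pow3: "nat (int p ^ n * int p ^ m * int p ^ 2) = p ^ (n + m + 2)"
  by (simp add: power_add nat_mult_distrib nat_power_eq power2_eq_square)

lemma has_pair_order_le:
  assumes "has_pair p G x y n m i j r s"
  shows "finite (carrier G)" "order G \<le> p ^ (n + m + 2)"
  using generating_pair.finite_carrier[OF assms[unfolded has_pair_def]]
    generating_pair.order_le[OF assms[unfolded has_pair_def]] unfolding nat_pow3 by auto

text \<open>Normal forms bound the order from above; from below it is bounded by the order of the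
  model, which is an image of the presented group.\<close>

lemma order_listed:
  assumes "Factorial_Ring.prime p" "admissible p L" "params_of L = (n, m, i, j, r, s)"
  shows "finite (carrier (listed_group p L))" "order (listed_group p L) = p ^ (n + m + 2)"
proof -
  let ?G = "listed_group p L"
  interpret model_params "int p ^ n" "int p ^ m" "int p ^ 2" "int p * r" "int p * s" "int p * i" "int p * j"
    by (rule model_params_listed[OF assms])
  obtain x y where xy: "has_pair p ?G x y n m (int i) (int j) (int r) (int s)"
    using listed_has_pair[OF assms] by blast
  show fin: "finite (carrier ?G)" using has_pair_order_le(1)[OF xy] .
  have "has_pair p model mod_a mod_b n m (int i) (int j) (int r) (int s)"
    unfolding has_pair_def by (rule generating_pair_model)
  from listed_surj[OF assms this] obtain h where "h ` carrier ?G = carrier model"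
    by (rule bexE)
  then have "order model \<le> order ?G"
    unfolding order_def using card_image_le[OF fin, of h] by simp
  then show "order ?G = p ^ (n + m + 2)"
    using has_pair_order_le(2)[OF xy] unfolding order_model nat_pow3 by simp
qed

text \<open>Reduces an isomorphism to finding in \<open>G\<close> one pair of generators with the
  parameters of \<open>L\<close>: equal orders make the surjection from the presented group
  injective.\<close>

lemma listed_iso:
  assumes "Factorial_Ring.prime p" "admissible p L" "params_of L = (n, m, i, j, r, s)"
    and "has_pair p G x y n m (int i) (int j) (int r) (int s)" "order G = p ^ (n + m + 2)"
  shows "G \<cong> listed_group p L"
proof -
  from listed_surj[OF assms(1-4)]
  obtain h where "h \<in> hom (listed_group p L) G" "h ` carrier (listed_group p L) = carrier G"
    by (rule bexE)
  then have "listed_group p L \<cong> G"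
    using order_listed[OF assms(1-3)] assms(5) by (intro surj_hom_iso) simp_all
  then show ?thesis
    unfolding listed_group_def by (rule group.iso_sym[OF group_presented_group])
qed

subsection \<open>Change of generators\<close>

lemma tri_Suc: "tri (int (Suc k)) = tri (int k) + int k"
  using tri_add[of "int k" 1] by (simp add: add.commute)

lemma tri_choose: "tri (int k) = int (k choose 2)"
proof (induction k)
  case 0
  then show ?case by simp
next
  case (Suc k)
  then show ?case by (simp only: tri_Suc numeral_2_eq_2 binomial_Suc_Suc, simp)
qed

lemma choose_3_Suc: "int (Suc k choose 3) = int (k choose 3) + tri (int k)"
  by (simp only: tri_choose numeral_3_eq_3 numeral_2_eq_2 binomial_Suc_Suc of_nat_add add.commute)

context commutator_pair
begin

lemma phi_cong: "P dvd w' - w \<Longrightarrow> \<phi> (x, y, w) = \<phi> (x, y, w')"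
  using c_pow_cong by simp

text \<open>One more factor adds a term linear in \<open>k\<close> and a term in
  \<open>binom(k, 2)\<close>; the latter comes from \<open>trix S (k * y)\<close> and from the
  collected power of \<open>c\<close> passing \<open>a^x b^y\<close>. Summation turns these into
  \<open>binom(k, 2)\<close> and \<open>binom(k, 3)\<close>; the remaining terms contain two factors
  from \<open>R\<close> and \<open>S\<close>.\<close>

lemma phi_pow:
  fixes k :: nat
  shows "\<phi> (x, y, w) [^] k = \<phi> (int k * x, int k * y,
    int k * w + tri (int k) * (R * x + S * y) * w
    - tri (int k) * (x * y + R * tri x * y + S * x * (tri y + y * y))
    - int (k choose 3) * (S * x * y * y + (R * x + S * y) * x * y))"
proof (induction k)
  case 0
  then show ?case by (simp add: binomial_eq_0)
next
  case (Suc k)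
  define q where "q = int k"
  define d where "d = tri q"
  define e where "e = int (k choose 3)"
  have d: "tri (q * y) = q * tri y + d * y * y" by (simp add: d_def tri_mult)
  have "\<phi> (x, y, w) [^] Suc k = \<phi> (x, y, w) [^] k \<otimes> \<phi> (x, y, w)" by simp
  also have "\<dots> = \<phi> (int (Suc k) * x, int (Suc k) * y,
    int (Suc k) * w + tri (int (Suc k)) * (R * x + S * y) * w
    - tri (int (Suc k)) * (x * y + R * tri x * y + S * x * (tri y + y * y))
    - int (Suc k choose 3) * (S * x * y * y + (R * x + S * y) * x * y))"
    unfolding Suc.IH phi_mult tmult.simps choose_3_Suc tri_Suc
    unfolding of_nat_Suc q_def[symmetric] d_def[symmetric] e_def[symmetric]
  proof -
    have *: "q * x + x = (1 + q) * x" "q * y + y = (1 + q) * y" by (simp_all add: algebra_simps)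
    show "\<phi> (q * x + x, q * y + y, (q * w + d * (R * x + S * y) * w
    - d * (x * y + R * tri x * y + S * x * (tri y + y * y))
    - e * (S * x * y * y + (R * x + S * y) * x * y)) * (1 + R * x) * (1 + S * y)
      - trix R x * trix S (q * y) * (1 + S * y) + w) =
     \<phi> ((1 + q) * x, (1 + q) * y, (1 + q) * w + (d + q) * (R * x + S * y) * w
    - (d + q) * (x * y + R * tri x * y + S * x * (tri y + y * y))
    - (e + d) * (S * x * y * y + (R * x + S * y) * x * y))"
      unfolding *
    proof (rule phi_cong)
      show "P dvd (1 + q) * w + (d + q) * (R * x + S * y) * w
    - (d + q) * (x * y + R * tri x * y + S * x * (tri y + y * y))
    - (e + d) * (S * x * y * y + (R * x + S * y) * x * y)
    - ((q * w + d * (R * x + S * y) * w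
    - d * (x * y + R * tri x * y + S * x * (tri y + y * y))
    - e * (S * x * y * y + (R * x + S * y) * x * y)) * (1 + R * x) * (1 + S * y)
      - trix R x * trix S (q * y) * (1 + S * y) + w)"
        unfolding trix_def d
        by (simp add: algebra_simps) (rule dvd_add dvd_diff dvd_triv_left RR_dvd | rule dvd_mult)+
    qed
  qed
  finally show ?case .
qed

text \<open>The two products have the same exponents of \<open>a\<close> and \<open>b\<close>, so
  they differ by a power of \<open>c\<close> alone.\<close>

lemma commutator_phi:
  "commutator G (\<phi> u) (\<phi> v) = c [^] (snd (snd (tmult R S u v)) - snd (snd (tmult R S v u)))"
proof (rule commutator_unique)
  obtain x y w x' y' w' where uv: "u = (x, y, w)" "v = (x', y', w')" by (cases u, cases v) auto
  obtain f where f: "tmult R S u v = (x + x', y + y', f)" by (simp add: uv)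
  obtain g where g: "tmult R S v u = (x + x', y + y', g)" by (simp add: uv)
  show "\<phi> u \<otimes> \<phi> v = \<phi> v \<otimes> \<phi> u \<otimes> c [^] (snd (snd (tmult R S u v)) - snd (snd (tmult R S v u)))"
    unfolding phi_mult f g snd_conv by (simp add: m_assoc flip: int_pow_mult)
qed simp_all

lemma commutator_c_phi:
  "commutator G (c [^] k) (\<phi> (x, y, w)) = c [^] (k * (R * x + S * y))"
proof -
  have "commutator G (c [^] k) (\<phi> (x, y, w)) = commutator G (\<phi> (0, 0, k)) (\<phi> (x, y, w))" by simp
  also have "\<dots> = c [^] (k * (1 + R * x) * (1 + S * y) - k)"
    unfolding commutator_phi by simp
  also have "\<dots> = c [^] (k * (R * x + S * y))"
  proof (rule c_pow_cong)
    have "k * (R * x + S * y) - (k * (1 + R * x) * (1 + S * y) - k) = R * S * (- k * x * y)" by (simp add: algebra_simps)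
    then show "P dvd k * (R * x + S * y) - (k * (1 + R * x) * (1 + S * y) - k)" using RS(2) by (metis dvd_mult2)
  qed
  finally show ?thesis .
qed

end

section \<open>Pairs in groups of order \<open>p^(n+m+2)\<close>\<close>

locale full_pair =
  fixes p n m :: nat and i j r s :: int and G (structure) and a b
  assumes pair: "has_pair p G a b n m i j r s"
    and prime_p: "Factorial_Ring.prime p" and order_G: "order G = p ^ (n + m + 2)"

sublocale full_pair \<subseteq> generating_pair G "int p ^ n" "int p ^ m" "int p ^ 2" "int p * r" "int p * s" "int p * i" "int p * j" a b
  using pair unfolding has_pair_def .

context full_pair
begin

lemma p_pos: "0 < p" using prime_p by (rule prime_gt_0_nat)

lemma sim_if_phi_eq: "\<phi> u = \<phi> v \<Longrightarrow> sim u v"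
  using phi_eq_iff order_G by (simp only: nat_pow3)

lemma c_pow_eq_iff: "c [^] u = c [^] v \<longleftrightarrow> int p ^ 2 dvd v - u"
proof
  assume "c [^] u = c [^] v"
  then have "\<phi> (0, 0, u) = \<phi> (0, 0, v)" by simp
  then show "int p ^ 2 dvd v - u" using sim_if_phi_eq pos by fastforce
qed (rule c_pow_cong)

lemma c_pow_p_eq_iff: "c [^] (int p * u) = c [^] (int p * v) \<longleftrightarrow> int p dvd v - u"
  unfolding c_pow_eq_iff using p_pos by (simp add: power2_eq_square flip: right_diff_distrib)

text \<open>Modulo \<open>p\<close> the exponents \<open>R\<close> and \<open>S\<close> vanish and
  \<open>trix\<close> is the identity. What is left of \<open>D\<close> is the determinant of the
  change of generators.\<close>

lemma commutator_phi_mod_p: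
  obtains D where "commutator G (\<phi> (x, y, w)) (\<phi> (x', y', w')) = c [^] D" "int p dvd D - (x * y' - y * x')"
proof
  show "commutator G (\<phi> (x, y, w)) (\<phi> (x', y', w'))
    = c [^] (snd (snd (tmult (int p * r) (int p * s) (x, y, w) (x', y', w'))) - snd (snd (tmult (int p * r) (int p * s) (x', y', w') (x, y, w))))"
    by (rule commutator_phi)
  show "int p dvd snd (snd (tmult (int p * r) (int p * s) (x, y, w) (x', y', w'))) - snd (snd (tmult (int p * r) (int p * s) (x', y', w') (x, y, w))) - (x * y' - y * x')"
    by (simp add: trix_def algebra_simps)
qed

end

text \<open>In \<open>3 binom(q, 3) = q binom(q - 1, 2)\<close> with \<open>q = p^k\<close> the
  right side contains \<open>p^2\<close>. At least one factor \<open>p\<close> survives division by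
  3, even for \<open>p = 3\<close>.\<close>

lemma prime_dvd_choose_3:
  assumes "Factorial_Ring.prime p" "k \<ge> 2"
  shows "int p dvd int (p ^ k choose 3)"
proof -
  have "3 * (p ^ k choose 3) = p ^ k * ((p ^ k - 1) choose 2)"
    using times_binomial_minus1_eq[of 3 "p ^ k"] by simp
  moreover have "p ^ 2 dvd p ^ k" using assms(2) by (rule le_imp_power_dvd)
  ultimately have d: "p * p dvd 3 * (p ^ k choose 3)" by (simp add: power2_eq_square dvd_mult2)
  have "p dvd (p ^ k choose 3)"
  proof (cases "p = 3")
    case True
    then show ?thesis using d by simp
  next
    case False
    have "Factorial_Ring.prime (3::nat)" by simp
    then have "\<not> p dvd 3" using False assms(1) primes_dvd_imp_eq by blast
    moreover have "p dvd 3 * (p ^ k choose 3)" using d by (rule dvd_mult_left)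
    ultimately show ?thesis using assms(1) by (simp only: prime_dvd_mult_iff) simp
  qed
  then show ?thesis by simp
qed

text \<open>For $k \ge 2$, $(a^x b^y)^{p^k} = a^{p^k x} b^{p^k y} c^{-p\,\mathrm{eps}(p,k)\,xy}$.
  Modulo \<open>p\<close> this is nonzero only for $p = k = 2$.\<close>

definition eps :: "nat \<Rightarrow> nat \<Rightarrow> int" where
  "eps p k = tri (int p ^ k) div int p"

lemma eps_mult: "Factorial_Ring.prime p \<Longrightarrow> k \<ge> 2 \<Longrightarrow> int p * eps p k = tri (int p ^ k)"
  unfolding eps_def by (rule dvd_mult_div_cancel[OF prime_dvd_tri_power])

lemma int_inverse_mod_prime_power:
  assumes "Factorial_Ring.prime p" "\<not> int p dvd x"
  obtains x' where "int p ^ k dvd x * x' - 1"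
proof -
  have "coprime (int p ^ k) x"
    using assms by (intro coprime_power_left_iff[THEN iffD2] disjI1 prime_imp_coprime) simp_all
  then obtain u v where "u * (int p ^ k) + v * x = 1"
    using bezout_int[of "int p ^ k" x] by auto
  then have "x * v - 1 = int p ^ k * (- u)" by (simp add: algebra_simps)
  then show thesis using that by (metis dvd_triv_left)
qed

context full_pair
begin

text \<open>In \<open>phi_pow\<close> both binomials are divisible by \<open>p\<close>, and
  \<open>p^k\<close> is divisible by \<open>p^2\<close>. So every term with a further factor
  \<open>R\<close> or \<open>S\<close> vanishes, \<open>w\<close> has no influence, and only the
  term in \<open>x * y\<close> remains.\<close>

lemma phi_pow_prime_power:
  assumes "k \<ge> 2"
  shows "\<phi> (x, y, w) [^] (int p ^ k) = \<phi> (int p ^ k * x, int p ^ k * y, - (int p * eps p k * x * y))"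
proof -
  define q where "q = int p"
  obtain e where e: "int (p ^ k choose 3) = q * e"
    using prime_dvd_choose_3[OF prime_p assms] q_def by blast
  have t: "tri (q ^ k) = q * eps p k" unfolding q_def using eps_mult[OF prime_p assms] by simp
  obtain f where f: "q ^ k = q * q * f"
    using le_imp_power_dvd[OF assms, of q] by (metis dvdE power2_eq_square)
  have "\<phi> (x, y, w) [^] (int p ^ k) = \<phi> (x, y, w) [^] (p ^ k)"
    by (simp flip: int_pow_int)
  also have "\<dots> = \<phi> (int p ^ k * x, int p ^ k * y, - (int p * eps p k * x * y))"
    unfolding phi_pow of_nat_power q_def[symmetric] t e
  proof (rule phi_cong, unfold power2_eq_square q_def[symmetric])
    show "q * q dvd - (q * eps p k * x * y) - (q ^ k * w + q * eps p k * (q * r * x + q * s * y) * w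
      - q * eps p k * (x * y + q * r * tri x * y + q * s * x * (tri y + y * y))
      - q * e * (q * s * x * y * y + (q * r * x + q * s * y) * x * y))"
      unfolding f dvd_def
      by (intro exI[of _ "- f * w - eps p k * (r * x + s * y) * w
        + eps p k * (r * tri x * y + s * x * (tri y + y * y))
        + e * (s * x * y * y + (r * x + s * y) * x * y)"]) (simp add: algebra_simps)
  qed
  finally show ?thesis .
qed

lemma phi_NM: "\<phi> (int p ^ n * x, int p ^ m * y, w) = c [^] (int p * (i * x + j * y) + w)"
proof -
  have "\<phi> (0, 0, int p * (i * x + j * y) + w) = \<phi> (int p ^ n * x, int p ^ m * y, w)"
    by (rule phi_sim, unfold tequiv.simps, intro exI[of _ x] exI[of _ y]) (simp add: algebra_simps)
  then show ?thesis by simp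
qed

lemma pow_a_type:
  assumes "n \<ge> 2" "m \<le> n"
  shows "\<phi> (x, y, w) [^] (int p ^ n) = c [^] (int p * (i * x + j * (int p ^ (n - m) * y) - eps p n * x * y))"
proof -
  have "int p ^ n * y = int p ^ m * (int p ^ (n - m) * y)"
    using assms(2) by (simp flip: power_add mult.assoc)
  then show ?thesis
    unfolding phi_pow_prime_power[OF assms(1)] by (simp only: phi_NM) (simp add: algebra_simps)
qed

lemma pow_b_type:
  assumes "m \<ge> 2" "m \<le> n"
  shows "\<phi> (int p ^ (n - m) * g, y, w) [^] (int p ^ m) =
    c [^] (int p * (i * g + j * y - eps p m * (int p ^ (n - m) * g) * y))"
proof -
  have "int p ^ m * (int p ^ (n - m) * g) = int p ^ n * g"
    using assms(2) by (simp flip: power_add mult.assoc)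
  then show ?thesis
    unfolding phi_pow_prime_power[OF assms(1)] by (simp only: phi_NM) (simp add: algebra_simps)
qed

text \<open>For exponent 1 the square is computed directly, with \<open>binom(2, 2) = 1\<close> and
  \<open>binom(2, 3) = 0\<close>. The correction is half the exponent of \<open>a\<close> times
  \<open>1 + r\<close>: the 1 comes from exchanging \<open>a\<close> and \<open>b\<close>, the
  \<open>r\<close> from the quadratic part of \<open>trix\<close>.\<close>

lemma pow_b_type_2:
  assumes "p = 2" "m = 1" "n \<ge> 2" "odd s" "odd y"
  shows "\<phi> (2 ^ (n - 1) * g, y, w) [^] (2 :: int) = c [^] (2 * (i * g + j * y + 2 ^ (n - 2) * g * (1 + r)))"
proof -
  define h where "h = 2 ^ (n - 2) * g"
  have n1: "(2::int) ^ (n - 1) * g = 2 * h"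
    using assms(3) by (cases n) (auto simp: h_def Suc_diff_Suc numeral_2_eq_2 power_eq_if)
  have nn: "2 * (2 * h) = 2 ^ n * g"
    using assms(3) unfolding n1[symmetric] by (simp add: power_eq_if)
  have t: "tri (2 * h) = h * (2 * h - 1)" using two_tri[of "2 * h"] by simp
  have t2: "tri (int 2) = 1" by (simp add: tri_def)
  have b: "int (2 choose 3) = 0" by (simp add: binomial_eq_0)
  \<comment> \<open>Here the oddness of \<open>s\<close> and \<open>y\<close> enters: doubled, these
    factors vanish modulo 4. The third one removes \<open>w\<close> from the square.\<close>
  have y1: "even (1 + y)" "even (1 - y)" "even (1 + s * y)" using assms(4,5) by auto
  obtain y1 y2 y3 where y: "1 + y = 2 * y1" "1 - y = 2 * y2" "1 + s * y = 2 * y3"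
    using y1 by (metis evenE)
  have "\<phi> (2 * h, y, w) [^] (2 :: int) = \<phi> (2 * h, y, w) [^] (2 :: nat)"
    by (simp flip: int_pow_int)
  also have "\<dots> = \<phi> (2 * (2 * h), 2 * y, 2 * h * (1 + r))"
  proof -
    define W where "W = int 2 * w + tri (int 2) * (int p * r * (2 * h) + int p * s * y) * w
        - tri (int 2) * (2 * h * y + int p * r * tri (2 * h) * y + int p * s * (2 * h) * (tri y + y * y))
        - int (2 choose 3) * (int p * s * (2 * h) * y * y + (int p * r * (2 * h) + int p * s * y) * (2 * h) * y)"
    have "2 * h * (1 + r) - W = 2 * h * (1 + y) + 2 * h * r * (1 - y) - 2 * w * (1 + s * y)
        + 4 * (- r * h * w + r * h * h * y + s * h * (tri y + y * y))"
      unfolding W_def t t2 b assms(1) by (simp add: algebra_simps)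
    also have "\<dots> = 4 * (h * y1 + h * r * y2 - w * y3 - r * h * w + r * h * h * y + s * h * (tri y + y * y))"
      unfolding y by (simp add: algebra_simps)
    finally have "int p ^ 2 dvd 2 * h * (1 + r) - W" by (simp add: assms(1))
    then have "\<phi> (int 2 * (2 * h), int 2 * y, W) = \<phi> (int 2 * (2 * h), int 2 * y, 2 * h * (1 + r))"
      by (rule phi_cong)
    then show ?thesis unfolding phi_pow W_def by simp
  qed
  also have "\<dots> = c [^] (2 * (i * g + j * y + h * (1 + r)))"
    using phi_NM[of g y "2 * h * (1 + r)"] unfolding nn by (simp add: assms(1,2) algebra_simps)
  finally show ?thesis unfolding n1 h_def .
qed

section \<open>Transformation law of the parameters\<close>

lemma inv_phi_coords: "\<exists>w'. inv \<phi> (x, y, w) = \<phi> (- x, - y, w')"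
proof -
  have "inv \<phi> (x, y, w) = \<phi> (0, 0, - w) \<otimes> (\<phi> (0, - y, 0) \<otimes> \<phi> (- x, 0, 0))"
    by (simp add: inv_mult_group int_pow_neg m_assoc)
  then show ?thesis unfolding phi_mult tmult.simps by auto
qed

lemma int_pow_phi_coords: "\<exists>w'. \<phi> (x, y, w) [^] (k :: int) = \<phi> (k * x, k * y, w')"
proof (cases "k \<ge> 0")
  case True
  then obtain l where "k = int l" using nonneg_int_cases by blast
  then show ?thesis by (simp only: int_pow_int) (rule exI, rule phi_pow)
next
  case False
  then obtain l where l: "k = - int l" by (metis add.inverse_inverse nle_le neg_0_le_iff_le nonneg_int_cases)
  obtain w' where "\<phi> (x, y, w) [^] l = \<phi> (int l * x, int l * y, w')" by (rule that[OF phi_pow])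
  then show ?thesis using inv_phi_coords[of "int l * x" "int l * y" w'] by (simp add: l int_pow_neg_int)
qed

text \<open>The commutator of the new pair is \<open>c^D\<close> with \<open>D\<close> prime to
  \<open>p\<close>, so \<open>c\<close> lies in \<open>H\<close>. Up to powers of \<open>c\<close>
  the exponents combine linearly, and Cramer's rule puts \<open>a^\<Delta>\<close> and
  \<open>b^\<Delta>\<close> into \<open>H\<close>; as \<open>\<Delta>\<close> is prime to the orders
  of \<open>a\<close> and \<open>b\<close>, these follow.\<close>

lemma generate_change:
  assumes "\<not> int p dvd x * y' - y * x'"
  shows "generate G {\<phi> (x, y, w), \<phi> (x', y', w')} = carrier G"
proof -
  define \<Delta> where "\<Delta> = x * y' - y * x'"
  define H where "H = generate G {\<phi> (x, y, w), \<phi> (x', y', w')}"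
  have sub: "{\<phi> (x, y, w), \<phi> (x', y', w')} \<subseteq> carrier G" by simp
  have H: "subgroup H G" unfolding H_def by (rule generate_is_subgroup[OF sub])
  have uv: "\<phi> (x, y, w) \<in> H" "\<phi> (x', y', w') \<in> H" unfolding H_def by (auto intro: generate.incl)
  note pow = subgroup_int_pow_closed[OF H]
  obtain D where D: "commutator G (\<phi> (x, y, w)) (\<phi> (x', y', w')) = c [^] D" "int p dvd D - \<Delta>"
    unfolding \<Delta>_def by (rule commutator_phi_mod_p)
  have nD: "\<not> int p dvd D" using dvd_add_right_iff[OF D(2), of \<Delta>] assms by (simp add: \<Delta>_def)
  have cD: "c [^] D \<in> H"
    unfolding D(1)[symmetric] H_def by (intro commutator_in_generate sub generate.incl) auto
  obtain E where E: "int p ^ 2 dvd D * E - 1" by (rule int_inverse_mod_prime_power[OF prime_p nD])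
  have "(c [^] D) [^] E = c [^] (1::int)"
    unfolding int_pow_pow[OF c_closed] using E by (intro c_pow_cong) (simp add: dvd_diff_commute)
  then have "c \<in> H" using pow[OF cD, of E] by simp
  then have cH: "c [^] k \<in> H" for k :: int by (rule pow)
  have lin: "\<exists>w''. \<phi> (k * x + l * x', k * y + l * y', w'') \<in> H" for k l
  proof -
    obtain w1 where w1: "\<phi> (x, y, w) [^] k = \<phi> (k * x, k * y, w1)" using int_pow_phi_coords by blast
    obtain w2 where w2: "\<phi> (x', y', w') [^] l = \<phi> (l * x', l * y', w2)" using int_pow_phi_coords by blast
    have "\<phi> (k * x, k * y, w1) \<otimes> \<phi> (l * x', l * y', w2) \<in> H"
      unfolding w1[symmetric] w2[symmetric] by (intro subgroup.m_closed[OF H] pow uv)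
    then show ?thesis unfolding phi_mult tmult.simps by blast
  qed
  have strip: "a [^] x'' \<otimes> b [^] y'' \<in> H" if "\<phi> (x'', y'', w'') \<in> H" for x'' y'' w''
  proof -
    have "a [^] x'' \<otimes> b [^] y'' = \<phi> (x'', y'', w'') \<otimes> c [^] (- w'')"
      by (simp add: m_assoc flip: int_pow_mult)
    then show ?thesis using that cH subgroup.m_closed[OF H] by (simp del: \<phi>.simps)
  qed
  have lin0: "a [^] (k * x + l * x') \<otimes> b [^] (k * y + l * y') \<in> H" for k l
    using lin strip by blast
  have a\<Delta>: "a [^] \<Delta> \<in> H" using lin0[of y' "- y"] by (simp add: \<Delta>_def algebra_simps)
  have b\<Delta>: "b [^] \<Delta> \<in> H" using lin0[of "- x'" x] by (simp add: \<Delta>_def algebra_simps)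
  have cp1: "c [^] (int p * z * int p ^ 2) = \<one>" for z
    using c_pow_cong[of 0 "int p * z * int p ^ 2"] by simp
  have a1: "a [^] (int p ^ (n + 2)) = \<one>"
    unfolding power_add int_pow_pow[OF a_closed, symmetric] a_pow_N int_pow_pow[OF c_closed] by (rule cp1)
  have b1: "b [^] (int p ^ (m + 2)) = \<one>"
    unfolding power_add int_pow_pow[OF b_closed, symmetric] b_pow_M int_pow_pow[OF c_closed] by (rule cp1)
  have n\<Delta>: "\<not> int p dvd \<Delta>" using assms by (simp add: \<Delta>_def)
  have aH: "a \<in> H"
  proof -
    obtain E where "int p ^ (n + 2) dvd \<Delta> * E - 1" by (rule int_inverse_mod_prime_power[OF prime_p n\<Delta>])
    then have "a [^] (1::int) = a [^] (\<Delta> * E)" by (intro int_pow_cong[OF a_closed a1])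
    then show ?thesis using pow[OF a\<Delta>, of E] by (simp add: int_pow_pow)
  qed
  have bH: "b \<in> H"
  proof -
    obtain E where "int p ^ (m + 2) dvd \<Delta> * E - 1" by (rule int_inverse_mod_prime_power[OF prime_p n\<Delta>])
    then have "b [^] (1::int) = b [^] (\<Delta> * E)" by (intro int_pow_cong[OF b_closed b1])
    then show ?thesis using pow[OF b\<Delta>, of E] by (simp add: int_pow_pow)
  qed
  have "carrier G \<subseteq> H" unfolding gen[symmetric] using aH bH by (intro generate_subgroup_incl H) simp
  then show ?thesis using subgroup.subset[OF H] unfolding H_def by blast
qed

text \<open>The new commutator is \<open>c^D\<close> with \<open>D\<close> congruent to
  \<open>\<Delta>\<close>. The power relations contain it on the right only, hence the factor at
  \<open>i'\<close> and \<open>j'\<close>. In \<open>[c^D, a'] = (c^D)^(p r')\<close> it cancels, so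
  \<open>(r, s)\<close> transforms as a plain linear form.\<close>

theorem pair_change_iff:
  assumes nD: "\<not> int p dvd x * y' - y * x'"
    and e1: "\<phi> (x, y, w) [^] (int p ^ n') = c [^] (int p * e1)"
    and e2: "\<phi> (x', y', w') [^] (int p ^ m') = c [^] (int p * e2)"
  shows "has_pair p G (\<phi> (x, y, w)) (\<phi> (x', y', w')) n' m' i' j' r' s' \<longleftrightarrow>
    int p dvd (x * y' - y * x') * i' - e1 \<and> int p dvd (x * y' - y * x') * j' - e2 \<and>
    int p dvd r' - (r * x + s * y) \<and> int p dvd s' - (r * x' + s * y')"
proof -
  define \<Delta> where "\<Delta> = x * y' - y * x'"
  obtain D where D: "commutator G (\<phi> (x, y, w)) (\<phi> (x', y', w')) = c [^] D" "int p dvd D - \<Delta>"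
    unfolding \<Delta>_def by (rule commutator_phi_mod_p)
  have nD': "\<not> int p dvd D" using dvd_add_right_iff[OF D(2), of \<Delta>] nD by (simp add: \<Delta>_def)
  have 1: "c [^] (int p * e) = (c [^] D) [^] (int p * k) \<longleftrightarrow> int p dvd \<Delta> * k - e" for e k
  proof -
    have "(c [^] D) [^] (int p * k) = c [^] (int p * (D * k))"
      unfolding int_pow_pow[OF c_closed] by (simp add: mult.left_commute)
    moreover have "int p dvd D * k - e \<longleftrightarrow> int p dvd \<Delta> * k - e"
      using dvd_add_left_iff[OF dvd_mult2[OF D(2), of k], of "\<Delta> * k - e"] by (simp add: algebra_simps)
    ultimately show ?thesis by (simp only: c_pow_p_eq_iff)
  qed
  have 2: "c [^] (D * (int p * r * x'' + int p * s * y'')) = (c [^] D) [^] (int p * k) \<longleftrightarrow>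
      int p dvd k - (r * x'' + s * y'')" for x'' y'' k
  proof -
    have "(c [^] D) [^] (int p * k) = c [^] (int p * (D * k))"
      unfolding int_pow_pow[OF c_closed] by (simp add: mult.left_commute)
    moreover have "D * (int p * r * x'' + int p * s * y'') = int p * (D * (r * x'' + s * y''))"
      by (simp add: algebra_simps)
    moreover have "int p dvd D * k - D * (r * x'' + s * y'') \<longleftrightarrow> int p dvd k - (r * x'' + s * y'')"
      unfolding right_diff_distrib[symmetric] using nD' prime_p by (simp add: prime_dvd_mult_iff)
    ultimately show ?thesis by (simp only: c_pow_p_eq_iff)
  qed
  have p2: "(c [^] D) [^] (int p ^ 2) = \<one>"
    using c_pow_cong[of 0 "D * int p ^ 2"] by (simp add: int_pow_pow)
  show ?thesis
    unfolding has_pair_iff[OF p_pos] D(1) commutator_c_phi e1 e2 1 2 \<Delta>_def[symmetric]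
    using p2 generate_change[OF nD] is_group phi_closed by blast
qed

end

text \<open>The parameters \<open>i', j', r', s'\<close> belong to generators $a' = a^x b^y c^*$, $b' = a^{x'} b^{y'} c^*$ with
  $x' = p^{n-m} g$; the exponent of \<open>a\<close> in \<open>b'\<close> must be of this form for $b'^{p^m}$ to be a power of \<open>c\<close>.
  The case $m = 1$ occurs only for $p = 2$ and odd \<open>s\<close>.\<close>

definition step :: "nat \<Rightarrow> nat \<Rightarrow> nat \<Rightarrow> int \<Rightarrow> int \<Rightarrow> int \<Rightarrow> int \<Rightarrow> int \<Rightarrow> int \<Rightarrow> int \<Rightarrow> int \<Rightarrow>
    int \<Rightarrow> int \<Rightarrow> int \<Rightarrow> int \<Rightarrow> bool" where
  "step p n m i j r s i' j' r' s' x y g y' \<longleftrightarrow>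
    (let x' = int p ^ (n - m) * g; \<Delta> = x * y' - y * x' in
     \<not> int p dvd \<Delta> \<and>
     int p dvd \<Delta> * i' - (i * x + j * (int p ^ (n - m) * y) - eps p n * x * y) \<and>
     int p dvd \<Delta> * j' - (i * g + j * y' + (if m = 1 then 2 ^ (n - 2) * g * (1 + r) else - (eps p m * x' * y'))) \<and>
     int p dvd r' - (r * x + s * y) \<and> int p dvd s' - (r * x' + s * y'))"

context full_pair
begin

lemma step_iff:
  assumes "n \<ge> 2" "m \<le> n" "m \<ge> 2 \<or> m = 1 \<and> p = 2 \<and> odd s"
    and nD: "\<not> int p dvd x * y' - y * (int p ^ (n - m) * g)"
  shows "has_pair p G (\<phi> (x, y, w)) (\<phi> (int p ^ (n - m) * g, y', w')) n m i' j' r' s' \<longleftrightarrow>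
    step p n m i j r s i' j' r' s' x y g y'"
proof -
  have "\<phi> (int p ^ (n - m) * g, y', w') [^] (int p ^ m) =
    c [^] (int p * (i * g + j * y' + (if m = 1 then 2 ^ (n - 2) * g * (1 + r) else - (eps p m * (int p ^ (n - m) * g) * y'))))"
  proof (cases "m = 1")
    case True
    then have 1: "p = 2" "odd s" using assms(3) by auto
    \<comment> \<open>As \<open>n > m = 1\<close>, the exponent of \<open>a\<close> in the second
      generator is even, and an odd determinant forces \<open>y'\<close> to be odd.\<close>
    have "even (2 ^ (n - m) * g)" using True assms(1) by simp
    then have "odd y'" using nD unfolding 1 by auto
    then show ?thesis using pow_b_type_2[OF 1(1) True assms(1) 1(2)] True 1 by simp
  next
    case False
    then show ?thesis using pow_b_type[OF _ assms(2)] assms(3) by simp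
  qed
  from pair_change_iff[OF nD pow_a_type[OF assms(1,2)] this] show ?thesis
    unfolding step_def Let_def using nD by blast
qed

lemma has_pair_if_step:
  assumes "n \<ge> 2" "m \<le> n" "m \<ge> 2 \<or> m = 1 \<and> p = 2 \<and> odd s"
    and "step p n m i j r s i' j' r' s' x y g y'"
  shows "\<exists>a' b'. has_pair p G a' b' n m i' j' r' s'"
proof -
  have "\<not> int p dvd x * y' - y * (int p ^ (n - m) * g)" using assms(4) by (simp add: step_def Let_def)
  from step_iff[OF assms(1-3) this] assms(4) show ?thesis by blast
qed

lemma phi_eq_fst:
  assumes "\<phi> (x, y, w) = \<phi> (x', y', w')"
  shows "int p ^ n dvd x' - x"
proof -
  have "\<exists>k. x' = x + int p ^ n * k"
    using sim_if_phi_eq[OF assms] unfolding tequiv.simps by (elim exE conjE) (rule exI)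
  then show ?thesis by auto
qed

text \<open>Otherwise \<open>c^D\<close> would have order at most \<open>p\<close>, but in a group
  of full order the commutator of a pair has order \<open>p^2\<close>.\<close>

lemma commutator_unit:
  assumes "full_pair p n' m' i' j' r' s' G a' b'" "commutator G a' b' = c [^] D"
  shows "\<not> int p dvd D"
proof
  interpret F: full_pair p n' m' i' j' r' s' G a' b' by fact
  assume "int p dvd D"
  then have "int p ^ 2 dvd D * int p" by (auto simp: power2_eq_square)
  then have "c [^] (D * int p) = c [^] (0::int)" by (intro c_pow_cong) simp
  then have "commutator G a' b' [^] (int p * 1) = commutator G a' b' [^] (int p * 0)"
    unfolding assms(2) by (simp add: int_pow_pow)
  then have "int p dvd 1" unfolding F.c_pow_p_eq_iff by simp
  then show False using prime_p by simp
qed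

lemma obtain_coords:
  assumes "g \<in> carrier G"
  obtains x y w where "g = \<phi> (x, y, w)"
proof -
  obtain u where "g = \<phi> u" using assms carrier_eq by blast
  then show thesis using that by (cases u) blast
qed

text \<open>Since \<open>b'^(p^m)\<close> is a power of \<open>c\<close>, uniqueness of normal forms
  makes its exponent \<open>p^m x'\<close> of \<open>a\<close> a multiple of \<open>p^n\<close>.
  This is the shape \<open>x' = p^(n-m) g\<close> that \<open>step\<close> presupposes.\<close>

lemma step_if_has_pair:
  assumes "n \<ge> 2" "m \<le> n" "m \<ge> 2 \<or> m = 1 \<and> p = 2 \<and> odd s"
    and "has_pair p G a' b' n m i' j' r' s'"
  shows "\<exists>x y g y'. step p n m i j r s i' j' r' s' x y g y'"
proof -
  have F: "full_pair p n m i' j' r' s' G a' b'"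
    by unfold_locales (fact assms(4), fact prime_p, fact order_G)
  interpret F: full_pair p n m i' j' r' s' G a' b' by (fact F)
  obtain x y w where a': "a' = \<phi> (x, y, w)" by (rule obtain_coords[OF F.a_closed])
  obtain x' y' w' where b': "b' = \<phi> (x', y', w')" by (rule obtain_coords[OF F.b_closed])
  obtain D where D: "commutator G a' b' = c [^] D" "int p dvd D - (x * y' - y * x')"
    unfolding a' b' by (rule commutator_phi_mod_p)
  have nD: "\<not> int p dvd x * y' - y * x'"
    using dvd_add_right_iff[OF D(2), of "x * y' - y * x'"] commutator_unit[OF F D(1)] by simp
  have "b' [^] (int p ^ m) = c [^] (D * (int p * j'))"
    unfolding F.b_pow_M D(1) by (simp add: int_pow_pow)
  moreover obtain w1 where "b' [^] (int p ^ m) = \<phi> (int p ^ m * x', int p ^ m * y', w1)"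
    unfolding b' using int_pow_phi_coords by blast
  ultimately have "\<phi> (0, 0, D * (int p * j')) = \<phi> (int p ^ m * x', int p ^ m * y', w1)"
    by simp
  from phi_eq_fst[OF this] obtain k where k: "int p ^ m * x' = int p ^ n * k" by auto
  have "int p ^ n = int p ^ m * int p ^ (n - m)" using assms(2) by (simp flip: power_add)
  with k have x': "x' = int p ^ (n - m) * k" using p_pos by simp
  show ?thesis
    using step_iff[OF assms(1-3) nD[unfolded x'], of w w' i' j' r' s'] assms(4) unfolding a' b' x' by blast
qed

text \<open>The two commutators generate the same cyclic group. As \<open>m \<le> n\<close>, it
  contains all \<open>p^n\<close>-th powers, in particular that of \<open>a'\<close>, and the normal
  form of the second pair then gives \<open>p^n' dvd p^n\<close>.\<close>

lemma exponent_le: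
  assumes "m \<le> n" "full_pair p n' m' i' j' r' s' G a' b'"
  shows "n' \<le> n"
proof -
  interpret F: full_pair p n' m' i' j' r' s' G a' b' by fact
  obtain x y w where a': "a' = \<phi> (x, y, w)" by (rule obtain_coords[OF F.a_closed])
  obtain x' y' w' where b': "b' = \<phi> (x', y', w')" by (rule obtain_coords[OF F.b_closed])
  obtain D where D: "commutator G a' b' = c [^] D" "int p dvd D - (x * y' - y * x')"
    unfolding a' b' by (rule commutator_phi_mod_p)
  obtain E where E: "int p ^ 2 dvd D * E - 1"
    by (rule int_inverse_mod_prime_power[OF prime_p commutator_unit[OF assms(2) D(1)]])
  have "c [^] (1::int) = (c [^] D) [^] E"
    unfolding int_pow_pow[OF c_closed] using E by (intro c_pow_cong)
  then have cE: "c = commutator G a' b' [^] E" by (simp add: D(1))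
  obtain w1 where w1: "a' [^] (int p ^ n) = \<phi> (int p ^ n * x, int p ^ n * y, w1)"
    unfolding a' using int_pow_phi_coords by blast
  have e: "int p ^ n * y = int p ^ m * (int p ^ (n - m) * y)"
    using assms(1) by (simp flip: power_add mult.assoc)
  obtain k :: int where "a' [^] (int p ^ n) = c [^] k"
    using w1 unfolding e phi_NM by (rule that)
  then have "a' [^] (int p ^ n) = commutator G a' b' [^] (E * k)"
    by (subst (asm) cE) (simp add: int_pow_pow)
  then have "F.\<phi> (0, 0, E * k) = F.\<phi> (int p ^ n, 0, 0)" by simp
  from F.phi_eq_fst[OF this] have "int p ^ n' dvd int p ^ n" by simp
  then show ?thesis using prime_p by (metis dvd_power_iff_le of_nat_dvd_iff of_nat_power prime_ge_2_nat)
qed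

text \<open>Exchanging the generators has determinant -1, hence the signs. This serves A2, where
  \<open>p = 2\<close> makes them invisible.\<close>

lemma swap:
  assumes "int p dvd i' + j" "int p dvd j' + i"
  shows "has_pair p G b a m n i' j' s r"
proof -
  have d: "\<not> int p dvd 0 * 0 - 1 * 1" using prime_gt_1_nat[OF prime_p] by simp
  have b: "\<phi> (0, 1, 0) [^] (int p ^ m) = c [^] (int p * j)" "\<phi> (1, 0, 0) [^] (int p ^ n) = c [^] (int p * i)"
    unfolding phi_a phi_b by (rule b_pow_M a_pow_N)+
  from pair_change_iff[OF d b, of i' j' s r] show ?thesis
    using assms unfolding phi_a phi_b by (simp add: dvd_minus_iff[of _ "_ + _", symmetric] del: dvd_minus_iff)
qed

end

lemma full_pair_params_unique:
  assumes "full_pair p n m i j r s G a b" "full_pair p n' m' i' j' r' s' G a' b'" "m \<le> n" "m' \<le> n'"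
  shows "n = n' \<and> m = m'"
proof -
  have "n = n'"
    using full_pair.exponent_le[OF assms(1,3,2)] full_pair.exponent_le[OF assms(2,4,1)] by simp
  moreover have "p ^ (n + m + 2) = p ^ (n' + m' + 2)"
    using assms(1,2) unfolding full_pair_def by metis
  then have "n + m + 2 = n' + m' + 2"
    using prime_gt_1_nat full_pair.prime_p[OF assms(1)] by (metis power_inject_exp)
  ultimately show ?thesis by simp
qed

lemma generating_pair_iso:
  assumes "generating_pair G N M P R S I J x y" "h \<in> iso G H" "group H"
  shows "generating_pair H N M P R S I J (h x) (h y)"
proof -
  interpret G: generating_pair G N M P R S I J x y by fact
  interpret group_hom G H h
    using assms(2,3) G.is_group by (simp add: group_hom_def group_hom_axioms_def iso_def)
  have comm: "commutator H (h u) (h v) = h (commutator G u v)" if "u \<in> carrier G" "v \<in> carrier G" for u v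
    using that by (simp add: commutator_def)
  note c = comm[OF G.a_closed G.b_closed]
  show ?thesis
  proof unfold_locales
    have "generate H (h ` {x, y}) = h ` generate G {x, y}"
      by (intro generate_img) simp
    also have "\<dots> = carrier H" using G.gen assms(2) by (auto simp: iso_def bij_betw_def)
    finally show "generate H {h x, h y} = carrier H" by simp
    show "commutator H (h x) (h y) [^]\<^bsub>H\<^esub> P = \<one>\<^bsub>H\<^esub>"
      unfolding c using G.c_pow_P by (simp flip: hom_int_pow)
    show "commutator H (commutator H (h x) (h y)) (h x) = commutator H (h x) (h y) [^]\<^bsub>H\<^esub> R"
      unfolding c using G.comm_ca by (simp add: comm flip: hom_int_pow)
    show "commutator H (commutator H (h x) (h y)) (h y) = commutator H (h x) (h y) [^]\<^bsub>H\<^esub> S"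
      unfolding c using G.comm_cb by (simp add: comm flip: hom_int_pow)
    show "h x [^]\<^bsub>H\<^esub> N = commutator H (h x) (h y) [^]\<^bsub>H\<^esub> I"
      unfolding c using G.a_pow_N by (simp flip: hom_int_pow)
    show "h y [^]\<^bsub>H\<^esub> M = commutator H (h x) (h y) [^]\<^bsub>H\<^esub> J"
      unfolding c using G.b_pow_M by (simp flip: hom_int_pow)
  qed simp_all
qed

lemma has_pair_iso:
  assumes "has_pair p G x y n m i j r s" "h \<in> iso G H" "group H"
  shows "has_pair p H (h x) (h y) n m i j r s"
  using generating_pair_iso[OF assms(1)[unfolded has_pair_def] assms(2,3)] unfolding has_pair_def .

subsection \<open>The listed groups are pairwise non-isomorphic\<close>

text \<open>A2 with its generators exchanged, so that \<open>m \<le> n\<close> holds throughout and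
  one transformation law covers all types.\<close>

fun std_params :: "family \<Rightarrow> params" where
  "std_params A2 = (2, 1, 0, 1, 1, 1)"
| "std_params L = params_of L"

fun tag :: "family \<Rightarrow> nat" where
  "tag A1 = 0" | "tag A2 = 0" | "tag A3 = 0"
| "tag (B1 n) = 1" | "tag (B2 n) = 1" | "tag (B3 n) = 1"
| "tag C1 = 2" | "tag C2 = 2" | "tag C3 = 2" | "tag C4 = 2" | "tag C5 = 2"
| "tag (D1 n t) = 3" | "tag (D2 n) = 3" | "tag (D3 n) = 3" | "tag (D4 n) = 3" | "tag (D5 n) = 3"
| "tag L = 4"

lemma std_params_eq: "L \<noteq> A2 \<Longrightarrow> std_params L = params_of L"
  by (cases L) simp_all

text \<open>The tag depends on \<open>p\<close>, \<open>n\<close> and \<open>m\<close> alone, which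
  an isomorphism preserves. So only groups with the same tag have to be compared.\<close>

lemma regular_std_params:
  assumes "admissible p L" "std_params L = (n, m, i, j, r, s)"
  shows "n \<ge> 2" "m \<le> n" "m \<ge> 2 \<or> m = 1 \<and> p = 2 \<and> odd (int s)" "has_params n m L"
    "tag L = (if m = 1 then if n = 2 then 0 else 1 else if n = m then if p = 2 \<and> n = 2 then 2 else 3 else 4)"
proof -
  have "case std_params L of (n, m, i, j, r, s) \<Rightarrow> n \<ge> 2 \<and> m \<le> n \<and> (m \<ge> 2 \<or> m = 1 \<and> p = 2 \<and> odd (int s))
    \<and> has_params n m L \<and> tag L = (if m = 1 then if n = 2 then 0 else 1 else if n = m then if p = 2 \<and> n = 2 then 2 else 3 else 4)"
    using assms(1) by (cases L) auto
  then show "n \<ge> 2" "m \<le> n" "m \<ge> 2 \<or> m = 1 \<and> p = 2 \<and> odd (int s)" "has_params n m L"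
    "tag L = (if m = 1 then if n = 2 then 0 else 1 else if n = m then if p = 2 \<and> n = 2 then 2 else 3 else 4)"
    unfolding assms(2) by auto
qed

lemma listed_full_pair:
  assumes "Factorial_Ring.prime p" "admissible p L" "std_params L = (n, m, i, j, r, s)"
  shows "\<exists>a b. full_pair p n m (int i) (int j) (int r) (int s) (listed_group p L) a b"
proof (cases "L = A2")
  case True
  then have p: "params_of L = (1, 2, 1, 0, 1, 1)" "p = 2" "(n, m, i, j, r, s) = (2, 1, 0, 1, 1, 1)"
    using assms(2,3) by auto
  obtain a b where "has_pair p (listed_group p L) a b 1 2 (int 1) (int 0) (int 1) (int 1)"
    using listed_has_pair[OF assms(1,2) p(1)] by blast
  then interpret full_pair p 1 2 "int 1" "int 0" "int 1" "int 1" "listed_group p L" a b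
    using assms(1) order_listed[OF assms(1,2) p(1)] by unfold_locales simp_all
  have "has_pair p (listed_group p L) b a 2 1 0 1 1 1"
    using swap[of 0 1] p(2) by simp
  then show ?thesis using p(3) assms(1) order_G
    by (intro exI[of _ b, OF exI[of _ a]] full_pair.intro) (simp_all add: eval_nat_numeral)
next
  case False
  then have p: "params_of L = (n, m, i, j, r, s)" using assms(3) std_params_eq by simp
  obtain a b where "has_pair p (listed_group p L) a b n m (int i) (int j) (int r) (int s)"
    using listed_has_pair[OF assms(1,2) p] by blast
  from full_pair.intro[OF this assms(1) order_listed(2)[OF assms(1,2) p]] show ?thesis by blast
qed

lemma (in full_pair) iso_listed:
  assumes "admissible p L" "std_params L = (n, m, i', j', r', s')"
    and "has_pair p G x y n m (int i') (int j') (int r') (int s')"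
  shows "G \<cong> listed_group p L"
proof (cases "L = A2")
  case True
  then have p: "params_of L = (1, 2, 1, 0, 1, 1)" "p = 2" "(n, m, i', j', r', s') = (2, 1, 0, 1, 1, 1)"
    using assms(1,2) by auto
  interpret F: full_pair p n m "int i'" "int j'" "int r'" "int s'" G x y
    using assms(3) prime_p order_G by (rule full_pair.intro)
  have "has_pair p G y x 1 2 (int 1) (int 0) (int 1) (int 1)"
    using F.swap[of 1 0] p(2,3) by simp
  then show ?thesis
    using p(3) order_G by (intro listed_iso[OF prime_p assms(1) p(1)]) (simp_all add: eval_nat_numeral)
next
  case False
  then have "params_of L = (n, m, i', j', r', s')" using assms(2) std_params_eq by simp
  then show ?thesis by (rule listed_iso[OF prime_p assms(1) _ assms(3) order_G])
qed

text \<open>\<open>binom(p^k, 2)\<close> is a multiple of \<open>p^2\<close> for odd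
  \<open>p\<close> and of \<open>2^(k-1)\<close> for \<open>p = 2\<close>. So outside
  \<open>p = k = 2\<close> the quadratic term of the power map disappears modulo
  \<open>p\<close>.\<close>

lemma dvd_eps:
  assumes "Factorial_Ring.prime p" "k \<ge> 2" "p \<noteq> 2 \<or> k \<ge> 3"
  shows "int p dvd eps p k"
proof (cases "p = 2")
  case True
  then have "k = Suc (Suc (Suc (k - 3)))" using assms(3) by simp
  then have "(2::int) ^ k = 2 * (2 * (2 * 2 ^ (k - 3)))" by (metis power_Suc)
  then have "2 * (2 * eps 2 k) = 2 * (2 * (2 * (2 ^ (k - 3) * (2 ^ k - 1))))"
    using two_tri[of "2 ^ k"] eps_mult[of 2 k] assms(2) by simp
  then show ?thesis using True by simp
next
  case False
  have "int p * int p dvd int p ^ k"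
    using le_imp_power_dvd[OF assms(2), of "int p"] by (simp add: power2_eq_square)
  then have "int p * int p dvd 2 * (int p * eps p k)"
    unfolding eps_mult[OF assms(1,2)] two_tri by (rule dvd_mult2)
  then have "int p dvd 2 * eps p k" using prime_gt_0_nat[OF assms(1)] by (simp add: mult.left_commute)
  moreover have "\<not> int p dvd 2"
    using False assms(1) by (metis int_dvd_int_iff of_nat_numeral primes_dvd_imp_eq two_is_prime_nat)
  ultimately show ?thesis using assms(1) by (simp add: prime_dvd_mult_iff)
qed

section \<open>The transformation law in each type, and its invariants\<close>

lemma eps_2_2: "eps 2 2 = 3"
  by (simp add: eps_def tri_def)

text \<open>Both corrections survive here: \<open>eps 2 2\<close> is odd, which gives
  \<open>x * y\<close>, and \<open>2^(n-2) = 1\<close>, which gives \<open>g * (1 + r)\<close>. For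
  \<open>n \<ge> 3\<close> both are even, whence the simpler law of type B.\<close>

lemma step_A_iff:
  "step 2 2 1 i j r s i' j' r' s' x y g y' \<longleftrightarrow> odd (x * y') \<and> even (i' - (i * x + x * y)) \<and>
    even (j' - (i * g + j * y' + g * (1 + r))) \<and> even (r' - (r * x + s * y)) \<and> even (s' - s * y')"
  unfolding step_def Let_def eps_2_2 by (cases "odd x \<and> odd y'") auto

lemma step_B_iff:
  assumes "n \<ge> 3"
  shows "step 2 n 1 i j r s i' j' r' s' x y g y' \<longleftrightarrow> odd (x * y') \<and> even (i' - i * x) \<and>
    even (j' - (i * g + j * y')) \<and> even (r' - (r * x + s * y)) \<and> even (s' - s * y')"
proof -
  have "even (eps 2 n)" using dvd_eps[of 2 n] assms by simp
  moreover have "even ((2::int) ^ (n - 2))" "even ((2::int) ^ (n - 1))" "even ((2::int) ^ (n - Suc 0))" using assms by simp_all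
  ultimately show ?thesis
    unfolding step_def Let_def by (cases "odd x \<and> odd y'") auto
qed

lemma step_C_iff:
  "step 2 2 2 i j r s i' j' r' s' x y g y' \<longleftrightarrow> odd (x * y' - y * g) \<and>
    even (i' - (i * x + j * y - x * y)) \<and> even (j' - (i * g + j * y' - g * y')) \<and>
    even (r' - (r * x + s * y)) \<and> even (s' - (r * g + s * y'))"
proof -
  define \<Delta> where "\<Delta> = x * y' - y * g"
  have 1: "even (\<Delta> * z - (u + v - 3 * k * l)) \<longleftrightarrow> even (z - (u + v - k * l))" if "odd \<Delta>" for z u v k l :: int
  proof -
    have "even (\<Delta> * z - (u + v - 3 * k * l)) \<longleftrightarrow> even (\<Delta> * z - z + (z - (u + v - k * l)) + 2 * (k * l))"
      by (simp add: algebra_simps)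
    also have "\<dots> \<longleftrightarrow> even (z - (u + v - k * l))"
    proof -
      have "even (\<Delta> * z - z)" using that by simp
      then show ?thesis by (simp only: even_add) simp
    qed
    finally show ?thesis .
  qed
  show ?thesis
    unfolding step_def Let_def eps_2_2 using 1[of i' "i * x" "j * y" x y] 1[of j' "i * g" "j * y'" g y']
    by (auto simp: \<Delta>_def[symmetric] simp del: even_add even_diff even_mult_iff even_diff_iff)
qed

lemma step_D_iff:
  assumes "Factorial_Ring.prime p" "n \<ge> 2" "p \<noteq> 2 \<or> n \<ge> 3"
  shows "step p n n i j r s i' j' r' s' x y g y' \<longleftrightarrow> \<not> int p dvd (x * y' - y * g) \<and>
    int p dvd (x * y' - y * g) * i' - (i * x + j * y) \<and> int p dvd (x * y' - y * g) * j' - (i * g + j * y') \<and>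
    int p dvd r' - (r * x + s * y) \<and> int p dvd s' - (r * g + s * y')"
proof -
  obtain e where e: "eps p n = int p * e" using dvd_eps[OF assms] by blast
  have "int p dvd u - (v - int p * e * x * y) \<longleftrightarrow> int p dvd u - v" for u v
    using dvd_add_left_iff[of "int p" "int p * e * x * y" "u - v"] by (simp add: algebra_simps)
  moreover have "int p dvd u - (v - (int p * e * g * y')) \<longleftrightarrow> int p dvd u - v" for u v
    using dvd_add_left_iff[of "int p" "int p * e * g * y'" "u - v"] by (simp add: algebra_simps)
  ultimately show ?thesis unfolding step_def Let_def e using assms(2) by simp
qed

lemma step_E_iff:
  assumes "Factorial_Ring.prime p" "m \<ge> 2" "m < n"
  shows "step p n m i j r s i' j' r' s' x y g y' \<longleftrightarrow> \<not> int p dvd x * y' \<and>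
    int p dvd x * y' * i' - i * x \<and> int p dvd x * y' * j' - (i * g + j * y') \<and>
    int p dvd r' - (r * x + s * y) \<and> int p dvd s' - s * y'"
proof -
  have "n \<ge> 2" "p \<noteq> 2 \<or> n \<ge> 3" using assms(2,3) by auto
  then obtain e where e: "eps p n = int p * e" using dvd_eps[OF assms(1)] by blast
  \<comment> \<open>For \<open>m < n\<close> the exponent of \<open>a\<close> in the second
    generator is a multiple of \<open>p\<close>, so modulo \<open>p\<close> the change is triangular
    with determinant \<open>x * y'\<close>.\<close>
  have "int p ^ (n - m) = int p * int p ^ (n - m - 1)"
    using assms(3) by (metis power_eq_if not_less_iff_gr_or_eq zero_less_diff)
  then obtain f where f: "int p ^ (n - m) = int p * f" by blast
  have shift: "int p dvd u \<longleftrightarrow> int p dvd v" if "u = v + int p * z" for u v z :: int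
    using that by (simp add: dvd_add_left_iff)
  have 1: "int p dvd x * y' - y * (int p * f * g) \<longleftrightarrow> int p dvd x * y'"
    by (rule shift[of _ _ "- y * f * g"]) (simp add: algebra_simps)
  have 2: "int p dvd (x * y' - y * (int p * f * g)) * i' - (i * x + j * (int p * f * y) - int p * e * x * y)
      \<longleftrightarrow> int p dvd x * y' * i' - i * x"
    by (rule shift[of _ _ "- y * f * g * i' - j * f * y + e * x * y"]) (simp add: algebra_simps)
  have 3: "int p dvd (x * y' - y * (int p * f * g)) * j' - (i * g + j * y' + - (eps p m * (int p * f * g) * y'))
      \<longleftrightarrow> int p dvd x * y' * j' - (i * g + j * y')"
    by (rule shift[of _ _ "- y * f * g * j' + eps p m * f * g * y'"]) (simp add: algebra_simps)
  have 4: "int p dvd s' - (r * (int p * f * g) + s * y') \<longleftrightarrow> int p dvd s' - s * y'"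
    by (rule shift[of _ _ "- r * f * g"]) (simp add: algebra_simps)
  have "m \<noteq> 1" using assms(2) by simp
  then show ?thesis unfolding step_def Let_def e f by (simp only: 1 2 3 4 if_False)
qed

text \<open>The last invariant is the determinant of the linear forms $(i,j)$ and $(r,s)$.\<close>

lemma step_D_invariants:
  assumes "Factorial_Ring.prime p" "n \<ge> 2" "p \<noteq> 2 \<or> n \<ge> 3" and st: "step p n n i j r s i' j' r' s' x y g y'"
  shows "int p dvd i \<and> int p dvd j \<Longrightarrow> int p dvd i' \<and> int p dvd j'"
    and "int p dvd r \<and> int p dvd s \<Longrightarrow> int p dvd r' \<and> int p dvd s'"
    and "int p dvd (i * s - j * r) - (i' * s' - j' * r')"
proof -
  define \<Delta> where "\<Delta> = x * y' - y * g"
  have P: "prime_elem (int p)" using assms(1) by simp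
  note st = st[unfolded step_D_iff[OF assms(1-3)] \<Delta>_def[symmetric]]
  have n\<Delta>: "int p dvd \<Delta> * z \<longleftrightarrow> int p dvd z" for z using st P by (simp add: prime_elem_dvd_mult_iff)
  obtain e1 e2 e3 e4 where e: "\<Delta> * i' = i * x + j * y + int p * e1" "\<Delta> * j' = i * g + j * y' + int p * e2"
    "r' = r * x + s * y + int p * e3" "s' = r * g + s * y' + int p * e4"
  proof -
    have "\<exists>e. u = v + int p * e" if "int p dvd u - v" for u v
      using that by (metis diff_add_cancel add.commute dvdE)
    then show ?thesis using st that by metis
  qed
  show "int p dvd i \<and> int p dvd j \<Longrightarrow> int p dvd i' \<and> int p dvd j'"
    using n\<Delta>[of i'] n\<Delta>[of j'] unfolding e by simp
  show "int p dvd r \<and> int p dvd s \<Longrightarrow> int p dvd r' \<and> int p dvd s'"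
    unfolding e by simp
  \<comment> \<open>The change of basis multiplies the determinant of two linear forms by
    \<open>\<Delta>\<close>; the factor in front of \<open>i'\<close> and \<open>j'\<close> divides
    it by \<open>\<Delta>\<close> again.\<close>
  have "\<Delta> * ((i * s - j * r) - (i' * s' - j' * r')) = \<Delta> * (i * s - j * r) - ((\<Delta> * i') * s' - (\<Delta> * j') * r')"
    by (simp add: algebra_simps)
  also have "\<dots> = int p * (- (i * x + j * y) * e4 - e1 * s' + (i * g + j * y') * e3 + e2 * r')"
    unfolding e unfolding \<Delta>_def by (simp add: algebra_simps)
  finally have "int p dvd \<Delta> * ((i * s - j * r) - (i' * s' - j' * r'))" by simp
  then show "int p dvd (i * s - j * r) - (i' * s' - j' * r')" unfolding n\<Delta> .
qed

text \<open>Modulo \<open>p\<close>, \<open>i' = i / y'\<close> and \<open>s' = s y'\<close>, so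
  \<open>s i\<close> is invariant. If \<open>i\<close> and \<open>s\<close> vanish, then
  \<open>j' = j / x\<close> and \<open>r' = r x\<close>, so \<open>r j\<close> is invariant. These
  products are the parameters \<open>t\<close> of E1 and E5.\<close>

lemma step_E_invariants:
  assumes "Factorial_Ring.prime p" "m \<ge> 2" "m < n" and st: "step p n m i j r s i' j' r' s' x y g y'"
  shows "int p dvd i \<Longrightarrow> int p dvd i'" "int p dvd s \<Longrightarrow> int p dvd s'" "int p dvd s * i - s' * i'"
    "int p dvd i \<Longrightarrow> int p dvd j \<Longrightarrow> int p dvd j'" "int p dvd s \<Longrightarrow> int p dvd r \<Longrightarrow> int p dvd r'"
    "int p dvd i \<Longrightarrow> int p dvd s \<Longrightarrow> int p dvd r * j - r' * j'"
proof -
  have P: "prime_elem (int p)" using assms(1) by simp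
  note st = st[unfolded step_E_iff[OF assms(1-3)]]
  have nx: "int p dvd x * z \<longleftrightarrow> int p dvd z" "int p dvd y' * z \<longleftrightarrow> int p dvd z" for z
    using st P by (auto simp: prime_elem_dvd_mult_iff)
  obtain e1 e2 e3 e4 where e: "x * (y' * i') = i * x + int p * e1" "x * (y' * j') = i * g + j * y' + int p * e2"
    "r' = r * x + s * y + int p * e3" "s' = s * y' + int p * e4"
  proof -
    have "\<exists>e. u = v + int p * e" if "int p dvd u - v" for u v
      using that by (metis diff_add_cancel add.commute dvdE)
    then show ?thesis using st that unfolding mult.assoc by metis
  qed
  have xy: "int p dvd z \<longleftrightarrow> int p dvd x * (y' * z)" for z by (simp only: nx)
  show "int p dvd i \<Longrightarrow> int p dvd i'" "int p dvd i \<Longrightarrow> int p dvd j \<Longrightarrow> int p dvd j'"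
    using xy[of i'] xy[of j'] unfolding e by simp_all
  show "int p dvd s \<Longrightarrow> int p dvd s'" "int p dvd s \<Longrightarrow> int p dvd r \<Longrightarrow> int p dvd r'"
    unfolding e by simp_all
  have "x * (s * i - s' * i') = s * i * x - s * (x * (y' * i')) - int p * (x * e4 * i')"
    unfolding e(4) by (simp add: algebra_simps)
  also have "\<dots> = int p * (- s * e1 - x * e4 * i')" unfolding e by (simp add: algebra_simps)
  finally have "int p dvd x * (s * i - s' * i')" by simp
  then show "int p dvd s * i - s' * i'" unfolding nx .
  show "int p dvd r * j - r' * j'" if d: "int p dvd i" "int p dvd s"
  proof -
    obtain i1 s1 where is1: "i = int p * i1" "s = int p * s1" using d by blast
    have "y' * (r * j - r' * j') = y' * r * j - r * (x * (y' * j')) - int p * ((s1 * y + e3) * y' * j')"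
      unfolding e(3) is1 by (simp add: algebra_simps)
    also have "\<dots> = int p * (- r * (i1 * g + e2) - (s1 * y + e3) * y' * j')"
      unfolding e is1 by (simp add: algebra_simps)
    finally have "int p dvd y' * (r * j - r' * j')" by simp
    then show ?thesis unfolding nx .
  qed
qed

section \<open>The invariants separate the families\<close>

lemma residue_unique: "t < p \<Longrightarrow> t' < p \<Longrightarrow> int p dvd int t - int t' \<Longrightarrow> t = t'"
  by (metis mod_eq_dvd_iff mod_less of_nat_eq_iff of_nat_mod)

lemma not_prime_dvd_1: "Factorial_Ring.prime p \<Longrightarrow> \<not> int p dvd 1"
  using prime_gt_1_nat by fastforce

lemma tag_cases:
  "tag L = 0 \<Longrightarrow> L = A1 \<or> L = A2 \<or> L = A3"
  "tag L = 1 \<Longrightarrow> (\<exists>n. L = B1 n) \<or> (\<exists>n. L = B2 n) \<or> (\<exists>n. L = B3 n)"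
  "tag L = 2 \<Longrightarrow> L = C1 \<or> L = C2 \<or> L = C3 \<or> L = C4 \<or> L = C5"
  "tag L = 3 \<Longrightarrow> (\<exists>n t. L = D1 n t) \<or> (\<exists>n. L = D2 n) \<or> (\<exists>n. L = D3 n) \<or> (\<exists>n. L = D4 n) \<or> (\<exists>n. L = D5 n)"
  "tag L = 4 \<Longrightarrow> (\<exists>n m t. L = E1 n m t) \<or> (\<exists>n m. L = E2 n m) \<or> (\<exists>n m. L = E3 n m) \<or> (\<exists>n m. L = E4 n m) \<or>
    (\<exists>n m t. L = E5 n m t) \<or> (\<exists>n m. L = E6 n m) \<or> (\<exists>n m. L = E7 n m) \<or> (\<exists>n m. L = E8 n m) \<or> (\<exists>n m. L = E9 n m)"
  by (cases L; simp)+

text \<open>In type A always \<open>r = s = 1\<close>; with \<open>x\<close> odd this makes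
  \<open>y\<close> even, and \<open>i\<close> is preserved, which singles out A3. In A1 and A2
  \<open>i\<close> is 0 and \<open>j\<close> is preserved.\<close>

lemma tag_0_unique:
  fixes x y g y' :: int
  assumes t: "tag L = 0" "tag L' = 0"
    and L: "std_params L = (n, m, i, j, r, s)" "std_params L' = (n, m, i', j', r', s')"
    and st: "odd (x * y')" "even (int i' - (int i * x + x * y))"
      "even (int j' - (int i * g + int j * y' + g * (1 + int r)))" "even (int r' - (int r * x + int s * y))"
  shows "L = L'"
  using tag_cases(1)[OF t(1)] tag_cases(1)[OF t(2)] L st
  by (elim disjE; clarsimp)

text \<open>The parity of \<open>i\<close> singles out B1; where \<open>i\<close> is 0, that of
  \<open>j\<close> separates B2 from B3.\<close>

lemma tag_1_unique:
  fixes x g y' :: int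
  assumes t: "tag L = 1" "tag L' = 1"
    and L: "std_params L = (n, m, i, j, r, s)" "std_params L' = (n, m, i', j', r', s')"
    and st: "odd (x * y')" "even (int i' - int i * x)" "even (int j' - (int i * g + int j * y'))"
  shows "L = L'"
  using tag_cases(2)[OF t(1)] tag_cases(2)[OF t(2)] L st
  by (elim disjE exE; clarsimp)

text \<open>Modulo 2, $(i,j)$ stands for the quadratic form $ix + jy + xy$ and $ij$ is its Arf invariant. If
  that is zero, the form takes the value 1 at a single vector, and the third invariant is the
  value of the linear form $(r,s)$ there.\<close>

lemma step_C_invariants:
  fixes i j r s i' j' r' s' x y g y' :: int
  assumes "odd (x * y' - y * g)" "even (i' - (i * x + j * y - x * y))" "even (j' - (i * g + j * y' - g * y'))"
    "even (r' - (r * x + s * y))" "even (s' - (r * g + s * y'))"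
  shows "odd i \<and> odd j \<longleftrightarrow> odd i' \<and> odd j'" and "odd r \<or> odd s \<longleftrightarrow> odd r' \<or> odd s'"
    and "\<not> (odd i \<and> odd j) \<Longrightarrow> odd (i * r + j * s + (1 + i) * (1 + j) * (r + s)) \<longleftrightarrow> odd (i' * r' + j' * s' + (1 + i') * (1 + j') * (r' + s'))"
proof -
  note st = assms[simplified]
  \<comment> \<open>The congruences modulo 2 in propositional form: for each of the sixteen parity
    patterns of \<open>x\<close>, \<open>y\<close>, \<open>g\<close>, \<open>y'\<close> the claims
    become Boolean identities.\<close>
  have eq: "even i' \<longleftrightarrow> ((even i \<or> even x) \<longleftrightarrow> ((even j \<or> even y) \<longleftrightarrow> (even x \<or> even y)))"
    "even j' \<longleftrightarrow> ((even i \<or> even g) \<longleftrightarrow> ((even j \<or> even y') \<longleftrightarrow> (even g \<or> even y')))"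
    "even r' \<longleftrightarrow> ((even r \<or> even x) \<longleftrightarrow> (even s \<or> even y))"
    "even s' \<longleftrightarrow> ((even r \<or> even g) \<longleftrightarrow> (even s \<or> even y'))"
    using st by argo+
  have d: "(even x \<or> even y') \<noteq> (even y \<or> even g)" using st by argo
  show "odd i \<and> odd j \<longleftrightarrow> odd i' \<and> odd j'"
    unfolding eq using d by (cases "even x"; cases "even y"; cases "even g"; cases "even y'"; simp; argo)
  show "odd r \<or> odd s \<longleftrightarrow> odd r' \<or> odd s'"
    unfolding eq using d by (cases "even x"; cases "even y"; cases "even g"; cases "even y'"; simp; argo)
  show "odd (i * r + j * s + (1 + i) * (1 + j) * (r + s)) \<longleftrightarrow> odd (i' * r' + j' * s' + (1 + i') * (1 + j') * (r' + s'))"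
    if "\<not> (odd i \<and> odd j)"
    using d that by (cases "even x"; cases "even y"; cases "even g"; cases "even y'"; auto simp: eq)
qed

text \<open>The Arf invariant is 1 exactly for C1 and C3. The vanishing of \<open>(r, s)\<close>
  separates C1 from C3 and isolates C2 among the rest; the third invariant is 0 for C4 and 1 for
  C5.\<close>

lemma tag_2_unique:
  assumes t: "tag L = 2" "tag L' = 2"
    and L: "std_params L = (n, m, i, j, r, s)" "std_params L' = (n, m, i', j', r', s')"
    and st: "odd (int i) \<and> odd (int j) \<longleftrightarrow> odd (int i') \<and> odd (int j')"
      "odd (int r) \<or> odd (int s) \<longleftrightarrow> odd (int r') \<or> odd (int s')"
      "\<not> (odd (int i) \<and> odd (int j)) \<Longrightarrow> odd (int i * int r + int j * int s + (1 + int i) * (1 + int j) * (int r + int s)) \<longleftrightarrow>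
       odd (int i' * int r' + int j' * int s' + (1 + int i') * (1 + int j') * (int r' + int s'))"
  shows "L = L'"
  using tag_cases(3)[OF t(1)] tag_cases(3)[OF t(2)] L st
  by (elim disjE; clarsimp)

text \<open>D3, D4 and D5 are recognised by which of the forms \<open>(i, j)\<close> and
  \<open>(r, s)\<close> vanish. In D1 and D2 neither does; the determinant is \<open>t\<close> for
  D1 and 0 for D2.\<close>

lemma tag_3_unique:
  assumes t: "tag L = 3" "tag L' = 3"
    and L: "std_params L = (n, m, i, j, r, s)" "std_params L' = (n, m, i', j', r', s')"
    and adm: "admissible p L" "admissible p L'" "\<not> int p dvd 1"
    and st: "int p dvd int i \<and> int p dvd int j \<longleftrightarrow> int p dvd int i' \<and> int p dvd int j'"
      "int p dvd int r \<and> int p dvd int s \<longleftrightarrow> int p dvd int r' \<and> int p dvd int s'"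
      "int p dvd (int i * int s - int j * int r) - (int i' * int s' - int j' * int r')"
  shows "L = L'"
  using tag_cases(4)[OF t(1)] tag_cases(4)[OF t(2)] L adm st
  apply (elim disjE exE)
  apply (clarsimp; (rule residue_unique[of _ p]; simp | drule dvd_imp_le; simp))+
  done

text \<open>The vanishing of \<open>i\<close> and of \<open>s\<close> gives four blocks: E1; E2, E3;
  E4, E7; E5, E6, E8, E9. In the first \<open>s i = t\<close>, the second is split by
  \<open>r\<close>, the third by \<open>j\<close>, and the last by both, with \<open>r j = t\<close>
  in E5.\<close>

lemma tag_4_unique:
  assumes t: "tag L = 4" "tag L' = 4"
    and L: "std_params L = (n, m, i, j, r, s)" "std_params L' = (n, m, i', j', r', s')"
    and adm: "admissible p L" "admissible p L'" "\<not> int p dvd 1"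
    and st: "int p dvd int i \<longleftrightarrow> int p dvd int i'" "int p dvd int s \<longleftrightarrow> int p dvd int s'"
      "int p dvd int s * int i - int s' * int i'"
      "int p dvd int i \<Longrightarrow> int p dvd int j \<longleftrightarrow> int p dvd int j'"
      "int p dvd int s \<Longrightarrow> int p dvd int r \<longleftrightarrow> int p dvd int r'"
      "int p dvd int i \<Longrightarrow> int p dvd int s \<Longrightarrow> int p dvd int r * int j - int r' * int j'"
  shows "L = L'"
  using tag_cases(5)[OF t(1)] tag_cases(5)[OF t(2)] L adm st
  apply (elim disjE exE)
  apply (clarsimp; (rule residue_unique[of _ p]; simp | drule dvd_imp_le; simp))+
  done

text \<open>In types D and E several invariants are known only as implications; the step back from
  \<open>L'\<close> to \<open>L\<close> turns them into equivalences.\<close>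

lemma steps_imp_eq:
  assumes pr: "Factorial_Ring.prime p" and adm: "admissible p L" "admissible p L'"
    and L: "std_params L = (n, m, i, j, r, s)" "std_params L' = (n, m, i', j', r', s')"
    and st: "step p n m (int i) (int j) (int r) (int s) (int i') (int j') (int r') (int s') x y g y'"
    and st': "step p n m (int i') (int j') (int r') (int s') (int i) (int j) (int r) (int s) x1 y1 g1 y1'"
  shows "L = L'"
proof -
  note reg = regular_std_params[OF adm(1) L(1)]
  have tag: "tag L' = tag L" using regular_std_params(5)[OF adm(1) L(1)] regular_std_params(5)[OF adm(2) L(2)] by simp
  note not1 = not_prime_dvd_1[OF pr]
  have "tag L = 0 \<and> p = 2 \<and> n = 2 \<and> m = 1 \<or> tag L = 1 \<and> p = 2 \<and> n \<ge> 3 \<and> m = 1 \<or> tag L = 2 \<and> p = 2 \<and> n = 2 \<and> m = 2 \<or>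
      tag L = 3 \<and> m = n \<and> (p \<noteq> 2 \<or> n \<ge> 3) \<or> tag L = 4 \<and> 2 \<le> m \<and> m < n"
    unfolding reg(5) using reg(1-3) by (cases "m = 1"; cases "n = m"; cases "n = 2"; simp; linarith)
  then consider "tag L = 0" "p = 2" "n = 2" "m = 1" | "tag L = 1" "p = 2" "n \<ge> 3" "m = 1" | "tag L = 2" "p = 2" "n = 2" "m = 2"
    | "tag L = 3" "m = n" "p \<noteq> 2 \<or> n \<ge> 3" | "tag L = 4" "2 \<le> m" "m < n"
    by argo
  then show ?thesis
  proof cases
    case 1
    note st = st[unfolded 1(2-4) step_A_iff]
    show ?thesis by (rule tag_0_unique[OF 1(1) tag[unfolded 1(1)] L]) (use st in blast)+
  next
    case 2
    note st = st[unfolded 2(2,4) step_B_iff[OF 2(3)]]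
    show ?thesis by (rule tag_1_unique[OF 2(1) tag[unfolded 2(1)] L]) (use st in blast)+
  next
    case 3
    note st = st[unfolded 3(2-4) step_C_iff]
    from st have st: "odd (x * y' - y * g)" "even (int i' - (int i * x + int j * y - x * y))"
      "even (int j' - (int i * g + int j * y' - g * y'))"
      "even (int r' - (int r * x + int s * y))" "even (int s' - (int r * g + int s * y'))" by blast+
    show ?thesis by (rule tag_2_unique[OF 3(1) tag[unfolded 3(1)] L step_C_invariants[OF st]])
  next
    case 4
    note inv = step_D_invariants[OF pr reg(1) 4(3) st[unfolded 4(2)]] and inv' = step_D_invariants[OF pr reg(1) 4(3) st'[unfolded 4(2)]]
    show ?thesis
    proof (rule tag_3_unique[OF 4(1) tag[unfolded 4(1)] L adm not1])
      show "int p dvd int i \<and> int p dvd int j \<longleftrightarrow> int p dvd int i' \<and> int p dvd int j'"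
        by (rule iffI, rule inv(1), assumption, rule inv'(1), assumption)
      show "int p dvd int r \<and> int p dvd int s \<longleftrightarrow> int p dvd int r' \<and> int p dvd int s'"
        by (rule iffI, rule inv(2), assumption, rule inv'(2), assumption)
    qed (rule inv(3))
  next
    case 5
    note inv = step_E_invariants[OF pr 5(2,3) st] and inv' = step_E_invariants[OF pr 5(2,3) st']
    show ?thesis
    proof (rule tag_4_unique[OF 5(1) tag[unfolded 5(1)] L adm not1 _ _ inv(3)])
      show i: "int p dvd int i \<longleftrightarrow> int p dvd int i'" using inv(1) inv'(1) by (rule iffI)
      show s: "int p dvd int s \<longleftrightarrow> int p dvd int s'" using inv(2) inv'(2) by (rule iffI)
      show "int p dvd int i \<Longrightarrow> int p dvd int j \<longleftrightarrow> int p dvd int j'" using i inv(4) inv'(4) by blast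
      show "int p dvd int s \<Longrightarrow> int p dvd int r \<longleftrightarrow> int p dvd int r'" using s inv(5) inv'(5) by blast
    qed (rule inv(6))
  qed
qed

text \<open>The isomorphism carries the pair of the first group into the second. There both pairs
  live in one group, and each has coordinates with respect to the other.\<close>

theorem listed_groups_not_iso:
  assumes pr: "Factorial_Ring.prime p" and adm: "admissible p L" "admissible p L'"
    and iso: "listed_group p L \<cong> listed_group p L'"
  shows "L = L'"
proof -
  obtain n m i j r s where L: "std_params L = (n, m, i, j, r, s)" by (cases "std_params L")
  obtain n' m' i' j' r' s' where L': "std_params L' = (n', m', i', j', r', s')" by (cases "std_params L'")
  let ?H = "listed_group p L'"
  have H: "group ?H" unfolding listed_group_def by (rule group_presented_group)
  obtain a b where ab: "full_pair p n m (int i) (int j) (int r) (int s) (listed_group p L) a b"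
    using listed_full_pair[OF pr adm(1) L] by blast
  obtain a' b' where ab': "full_pair p n' m' (int i') (int j') (int r') (int s') ?H a' b'"
    using listed_full_pair[OF pr adm(2) L'] by blast
  obtain h where h: "h \<in> iso (listed_group p L) ?H" using iso by (auto simp: is_iso_def)
  have "order ?H = order (listed_group p L)"
    using h by (auto simp: order_def iso_def dest: bij_betw_same_card)
  then have hab: "full_pair p n m (int i) (int j) (int r) (int s) ?H (h a) (h b)"
    using ab has_pair_iso[OF _ h H] by (simp add: full_pair_def)
  note reg = regular_std_params(1-3)[OF adm(1) L] and reg' = regular_std_params(1-3)[OF adm(2) L']
  have nm: "n' = n" "m' = m" using full_pair_params_unique[OF hab ab' reg(2) reg'(2)] by auto
  note F = full_pair.step_if_has_pair
  obtain x y g y' where st: "step p n m (int i) (int j) (int r) (int s) (int i') (int j') (int r') (int s') x y g y'"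
    using F[OF hab reg full_pair.pair[OF ab'[unfolded nm]]] by (elim exE)
  obtain x1 y1 g1 y1' where st': "step p n m (int i') (int j') (int r') (int s') (int i) (int j) (int r) (int s) x1 y1 g1 y1'"
    using F[OF ab'[unfolded nm] reg'[unfolded nm] full_pair.pair[OF hab]] by (elim exE)
  show ?thesis by (rule steps_imp_eq[OF pr adm L L'[unfolded nm] st st'])
qed

subsection \<open>Normalisation of the parameters\<close>

definition reaches :: "nat \<Rightarrow> nat \<Rightarrow> nat \<Rightarrow> int \<Rightarrow> int \<Rightarrow> int \<Rightarrow> int \<Rightarrow> family \<Rightarrow> int \<Rightarrow> int \<Rightarrow> int \<Rightarrow> int \<Rightarrow> bool" where
  "reaches p n m i j r s L x y g y' \<longleftrightarrow> admissible p L \<and>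
    (case std_params L of (n', m', i', j', r', s') \<Rightarrow>
      n' = n \<and> m' = m \<and> step p n m i j r s (int i') (int j') (int r') (int s') x y g y')"

text \<open>As \<open>s\<close> is odd, \<open>y = 1 + r\<close> gives \<open>r' = 1\<close> and
  \<open>i' = i + 1 + r\<close> modulo 2. If this is odd, \<open>g = j\<close> clears
  \<open>j'\<close>; if it is even, \<open>j'\<close> equals \<open>j\<close> for every
  \<open>g\<close>.\<close>

lemma reaches_A:
  assumes "odd s"
  shows "\<exists>L x y g y'. reaches 2 2 1 i j r s L x y g y'"
proof (cases "odd (i + 1 + r)")
  case True
  then have "reaches 2 2 1 i j r s A3 1 (1 + r) j 1"
    using assms unfolding reaches_def by (auto simp: step_A_iff simp del: One_nat_def)
  then show ?thesis by blast
next
  case False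
  then have "reaches 2 2 1 i j r s (if even j then A1 else A2) 1 (1 + r) 0 1"
    using assms unfolding reaches_def by (auto simp: step_A_iff simp del: One_nat_def)
  then show ?thesis by blast
qed

text \<open>Here \<open>y = r\<close> clears \<open>r'\<close>, \<open>i\<close> is kept, and
  \<open>g = j\<close> clears \<open>j'\<close> when \<open>i\<close> is odd.\<close>

lemma reaches_B:
  assumes "odd s" "n \<ge> 3"
  shows "\<exists>L x y g y'. reaches 2 n 1 i j r s L x y g y'"
proof (cases "odd i")
  case True
  then have "reaches 2 n 1 i j r s (B1 n) 1 r j 1"
    using assms unfolding reaches_def by (auto simp: step_B_iff simp del: One_nat_def)
  then show ?thesis by blast
next
  case False
  then have "reaches 2 n 1 i j r s (if even j then B2 n else B3 n) 1 r 0 1"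
    using assms unfolding reaches_def by (auto simp: step_B_iff simp del: One_nat_def)
  then show ?thesis by blast
qed

text \<open>Only parities matter, so in each of the sixteen cases the entries 0 and 1 are
  tried.\<close>

lemma reaches_C: "\<exists>L x y g y'. reaches 2 2 2 i j r s L x y g y'"
proof -
  have "\<exists>x\<in>{0, 1}. \<exists>y\<in>{0, 1}. \<exists>g\<in>{0, 1}. \<exists>y'\<in>{0, 1}. \<exists>L\<in>{C1, C2, C3, C4, C5}. reaches 2 2 2 i j r s L x y g y'"
    by (cases "even i"; cases "even j"; cases "even r"; cases "even s"; (auto simp: reaches_def step_C_iff)?)
  then show ?thesis by blast
qed

lemma obtain_residue:
  assumes "\<not> int p dvd z" "p > 0"
  obtains t where "1 \<le> t" "t < p" "int p dvd int t - z"
proof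
  have z: "0 \<le> z mod int p" "z mod int p < int p" using assms(2) by simp_all
  moreover have "z mod int p \<noteq> 0" using assms(1) by (simp add: dvd_eq_mod_eq_0)
  ultimately show "1 \<le> nat (z mod int p)" "nat (z mod int p) < p" by linarith+
  show "int p dvd int (nat (z mod int p)) - z"
    using z by (simp add: mod_eq_dvd_iff[symmetric])
qed

lemma obtain_inverse:
  assumes "Factorial_Ring.prime p" "\<not> int p dvd z"
  obtains v k where "z * v = 1 + int p * k" "\<not> int p dvd v"
proof -
  obtain v where v: "int p ^ 1 dvd z * v - 1" by (rule int_inverse_mod_prime_power[OF assms])
  then obtain k where k: "z * v - 1 = int p * k" unfolding power_one_right by (elim dvdE)
  have "\<not> int p dvd v"
  proof
    assume "int p dvd v"
    then have "int p dvd z * v - int p * k" by simp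
    then show False using k not_prime_dvd_1[OF assms(1)] by (simp add: algebra_simps)
  qed
  moreover have "z * v = 1 + int p * k" using k by simp
  ultimately show thesis using that by blast
qed

text \<open>Rows of the change are taken from kernels: \<open>(-j, i)\<close> kills the form
  \<open>(i, j)\<close>, while \<open>(s, -r)\<close> and \<open>(-s, r)\<close> kill
  \<open>(r, s)\<close>. With second row \<open>(-j, i)\<close> the determinant is
  \<open>i x + j y\<close>, so \<open>i' = 1\<close> and \<open>j' = 0\<close>. In D1 the first row
  \<open>(s, -r)\<close> makes it \<open>i s - j r\<close>, which is also \<open>s'\<close>, the
  parameter \<open>t\<close>.\<close>

lemma reaches_D:
  assumes pr: "Factorial_Ring.prime p" and n: "n \<ge> 2" "p \<noteq> 2 \<or> n \<ge> 3"
  shows "\<exists>L x y g y'. reaches p n n i j r s L x y g y'"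
proof -
  note iff = step_D_iff[OF pr n]
  have P: "prime_elem (int p)" using pr by simp
  note not1 = not_prime_dvd_1[OF pr]
  have n': "p = 2 \<longrightarrow> n \<ge> 3" using n by auto
  consider (D5) "int p dvd i" "int p dvd j" "int p dvd r" "int p dvd s"
    | (D3) "\<not> (int p dvd i \<and> int p dvd j)" "int p dvd r" "int p dvd s"
    | (D4) "int p dvd i" "int p dvd j" "\<not> (int p dvd r \<and> int p dvd s)"
    | (D2) "\<not> (int p dvd i \<and> int p dvd j)" "\<not> (int p dvd r \<and> int p dvd s)" "int p dvd i * s - j * r"
    | (D1) "\<not> int p dvd i * s - j * r"
    by blast
  then show ?thesis
  proof cases
    case D5
    then have "reaches p n n i j r s (D5 n) 1 0 0 1"
      using n(1) n' not1 unfolding reaches_def by (simp add: iff)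
    then show ?thesis by blast
  next
    case D3
    then obtain x y where "\<not> int p dvd i * x + j * y"
      by (cases "int p dvd i") (metis add_0 mult_zero_right mult.right_neutral add_0_right)+
    then have "reaches p n n i j r s (D3 n) x y (- j) i"
      using n(1) n' D3(2,3) unfolding reaches_def by (simp add: iff algebra_simps)
    then show ?thesis by blast
  next
    case D4
    then obtain x y k where k: "r * x + s * y = 1 + int p * k"
      using obtain_inverse[OF pr, of r] obtain_inverse[OF pr, of s] by (metis add_0 mult_zero_right add_0_right)
    have "\<not> int p dvd r * x + s * y" unfolding k using not1 dvd_add_left_iff[of "int p" "int p * k" 1] by simp
    moreover have "int p dvd 1 - (r * x + s * y)" unfolding k by simp
    ultimately have "reaches p n n i j r s (D4 n) x y (- s) r"
      using n(1) n' D4(1,2) unfolding reaches_def by (simp add: iff algebra_simps)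
    then show ?thesis by blast
  next
    case D2
    \<comment> \<open>Determinant 0 means that the forms are proportional, so \<open>(-j, i)\<close>
      kills both. If \<open>r\<close>, or else \<open>s\<close>, is invertible, so is the
      corresponding entry of \<open>(i, j)\<close>, and a multiple of one coordinate vector
      suffices.\<close>
    obtain x y k where k: "r * x + s * y = 1 + int p * k" and d: "\<not> int p dvd i * x + j * y"
    proof (cases "int p dvd r")
      case False
      then have "\<not> int p dvd i"
      proof (rule contrapos_nn)
        assume i: "int p dvd i"
        have "int p dvd i * s - (i * s - j * r)" by (rule dvd_diff[OF dvd_mult2[OF i] D2(3)])
        also have "i * s - (i * s - j * r) = j * r" by simp
        finally have "int p dvd j * r" .
        with i D2(1) show "int p dvd r" using P by (auto simp: prime_elem_dvd_mult_iff)
      qed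
      moreover obtain v k where "r * v = 1 + int p * k" "\<not> int p dvd v" by (rule obtain_inverse[OF pr False])
      ultimately show thesis using P by (intro that[of v 0 k]) (simp_all add: prime_elem_dvd_mult_iff)
    next
      case True
      then have s: "\<not> int p dvd s" using D2(2) by simp
      have "int p dvd (i * s - j * r) + j * r" using D2(3) True by (intro dvd_add) simp_all
      then have "int p dvd i" using s P by (simp add: prime_elem_dvd_mult_iff)
      then have "\<not> int p dvd j" using D2(1) by simp
      moreover obtain v k where "s * v = 1 + int p * k" "\<not> int p dvd v" by (rule obtain_inverse[OF pr s])
      ultimately show thesis using P by (intro that[of 0 v k]) (simp_all add: prime_elem_dvd_mult_iff)
    qed
    have "int p dvd 1 - (r * x + s * y)" unfolding k by simp
    moreover have "int p dvd j * r - i * s" using D2(3) by (simp add: dvd_diff_commute)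
    ultimately have "reaches p n n i j r s (D2 n) x y (- j) i"
      using n(1) n' d unfolding reaches_def by (simp add: iff algebra_simps)
    then show ?thesis by blast
  next
    case D1
    obtain t where t: "1 \<le> t" "t < p" "int p dvd int t - (i * s - j * r)"
      by (rule obtain_residue[OF D1 prime_gt_0_nat[OF pr]])
    then have "reaches p n n i j r s (D1 n t) s (- r) (- j) i"
      using n(1) n' D1 unfolding reaches_def by (simp add: iff algebra_simps)
    then show ?thesis by blast
  qed
qed

text \<open>A triangular change clears \<open>r\<close> by \<open>y\<close> if \<open>s\<close> is
  invertible and \<open>j\<close> by \<open>g\<close> if \<open>i\<close> is; the diagonal rescales
  the rest. What cannot be rescaled is \<open>s i\<close>, or \<open>r j\<close> when
  \<open>i\<close> and \<open>s\<close> vanish; this is the parameter \<open>t\<close>.\<close>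

lemma reaches_E:
  assumes pr: "Factorial_Ring.prime p" and m: "m \<ge> 2" "m < n"
  shows "\<exists>L x y g y'. reaches p n m i j r s L x y g y'"
proof -
  note iff = step_E_iff[OF pr m]
  have P: "prime_elem (int p)" using pr by simp
  note not1 = not_prime_dvd_1[OF pr]
  note mult_iff = prime_elem_dvd_mult_iff[OF P]
  have inv: "int p dvd 1 - z" "int p dvd z * u - u" "int p dvd u - z * u" if "z = 1 + int p * k" for z k u
    unfolding that by (simp_all add: algebra_simps)
  show ?thesis
  proof (cases "int p dvd i")
    case i: False
    show ?thesis
    proof (cases "int p dvd s")
      case s: False
      then have si: "\<not> int p dvd s * i" using i by (simp add: mult_iff)
      obtain t where "1 \<le> t" "t < p" "int p dvd int t - s * i"
        by (rule obtain_residue[OF si prime_gt_0_nat[OF pr]])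
      then have "reaches p n m i j r s (E1 n m t) s (- r) (- j) i"
        using m i s unfolding reaches_def by (simp add: iff mult_iff algebra_simps)
      then show ?thesis by blast
    next
      case s: True
      show ?thesis
      proof (cases "int p dvd r")
        case r: False
        obtain v k where v: "r * v = 1 + int p * k" "\<not> int p dvd v" by (rule obtain_inverse[OF pr r])
        then have "reaches p n m i j r s (E2 n m) v 0 (- j) i"
          using m i s inv(1)[OF v(1)] unfolding reaches_def by (simp add: iff mult_iff)
        then show ?thesis by blast
      next
        case r: True
        then have "reaches p n m i j r s (E3 n m) 1 0 (- j) i"
          using m i s unfolding reaches_def by (simp add: iff mult_iff)
        then show ?thesis by blast
      qed
    qed
  next
    case i: True
    show ?thesis
    proof (cases "int p dvd s")
      case s: False
      obtain v k where v: "s * v = 1 + int p * k" "\<not> int p dvd v" by (rule obtain_inverse[OF pr s])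
      show ?thesis
      proof (cases "int p dvd j")
        case j: False
        have "reaches p n m i j r s (E4 n m) j (- (r * j * v)) 0 v"
          using m i j v(2) inv(1)[OF v(1)] inv(2)[OF v(1), of "r * j"] unfolding reaches_def
          by (simp add: iff mult_iff algebra_simps)
        then show ?thesis by blast
      next
        case j: True
        have "reaches p n m i j r s (E7 n m) 1 (- (r * v)) 0 v"
          using m i j v(2) inv(1)[OF v(1)] inv(2)[OF v(1), of r] unfolding reaches_def
          by (simp add: iff mult_iff algebra_simps)
        then show ?thesis by blast
      qed
    next
      case s: True
      show ?thesis
      proof (cases "int p dvd j")
        case j: False
        show ?thesis
        proof (cases "int p dvd r")
          case r: False
          then have rj: "\<not> int p dvd r * j" using j by (simp add: mult_iff)
          obtain t where "1 \<le> t" "t < p" "int p dvd int t - r * j"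
            by (rule obtain_residue[OF rj prime_gt_0_nat[OF pr]])
          then have "reaches p n m i j r s (E5 n m t) j 0 0 1"
            using m i j s unfolding reaches_def by (simp add: iff mult_iff)
          then show ?thesis by blast
        next
          case r: True
          then have "reaches p n m i j r s (E6 n m) j 0 0 1"
            using m i j s unfolding reaches_def by (simp add: iff mult_iff)
          then show ?thesis by blast
        qed
      next
        case j: True
        show ?thesis
        proof (cases "int p dvd r")
          case r: False
          obtain v k where v: "r * v = 1 + int p * k" "\<not> int p dvd v" by (rule obtain_inverse[OF pr r])
          then have "reaches p n m i j r s (E8 n m) v 0 0 1"
            using m i j s inv(1)[OF v(1)] unfolding reaches_def by (simp add: iff mult_iff)
          then show ?thesis by blast
        next
          case r: True
          then have "reaches p n m i j r s (E9 n m) 1 0 0 1"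
            using m i j s not1 unfolding reaches_def by (simp add: iff mult_iff)
          then show ?thesis by blast
        qed
      qed
    qed
  qed
qed

theorem (in full_pair) classification:
  assumes "n \<ge> 2" "m \<le> n" "m \<ge> 2 \<or> m = 1 \<and> p = 2 \<and> odd s"
  shows "\<exists>L. admissible p L \<and> has_params n m L \<and> G \<cong> listed_group p L"
proof -
  have "\<exists>L x y g y'. reaches p n m i j r s L x y g y'"
  proof (cases "m = 1")
    case True
    then have ps: "p = 2" "odd s" using assms(3) by auto
    show ?thesis
    proof (cases "n = 2")
      case n: True
      show ?thesis unfolding ps(1) True n by (rule reaches_A[OF ps(2)])
    next
      case False
      then have "n \<ge> 3" using assms(1) by simp
      then show ?thesis unfolding ps(1) True by (rule reaches_B[OF ps(2)])
    qed
  next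
    case m: False
    show ?thesis
    proof (cases "n = m")
      case n: True
      show ?thesis
      proof (cases "p = 2 \<and> n = 2")
        case True
        then show ?thesis using n reaches_C by simp
      next
        case False
        then have "p \<noteq> 2 \<or> n \<ge> 3" using assms(1) by auto
        then show ?thesis unfolding n[symmetric] by (rule reaches_D[OF prime_p assms(1)])
      qed
    next
      case False
      then show ?thesis using assms(2,3) m by (intro reaches_E[OF prime_p]) auto
    qed
  qed
  then obtain L x y g y' where "reaches p n m i j r s L x y g y'" by (elim exE)
  moreover obtain n' m' i' j' r' s' where L: "std_params L = (n', m', i', j', r', s')" by (cases "std_params L")
  ultimately have adm: "admissible p L" and nm: "n' = n" "m' = m"
    and st: "step p n m i j r s (int i') (int j') (int r') (int s') x y g y'"
    by (auto simp: reaches_def)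
  obtain a' b' where "has_pair p G a' b' n m (int i') (int j') (int r') (int s')"
    using has_pair_if_step[OF assms st] by (elim exE)
  then have "G \<cong> listed_group p L" by (rule iso_listed[OF adm L[unfolded nm]])
  then show ?thesis using adm regular_std_params(4)[OF adm L[unfolded nm]] by blast
qed

subsection \<open>Lifting the generators of the quotient\<close>

definition M_relations :: "nat \<Rightarrow> nat \<Rightarrow> nat \<Rightarrow> (gen word \<times> gen word) set" where
  "M_relations p n m = {(Defs.a \<up> p ^ n, Defs.e), (Defs.b \<up> p ^ m, Defs.e), (Defs.c \<up> p, Defs.e),
     (wcomm Defs.a Defs.b, Defs.c), (wcomm Defs.c Defs.a, Defs.e), (wcomm Defs.c Defs.b, Defs.e)}"

lemma M_group_eq: "M_group p n m = presented_group (M_relations p n m)"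
  by (simp add: M_group_def M_relations_def)

lemma M_relations_iff:
  assumes "group H" "\<And>x. f x \<in> carrier H"
  shows "(\<forall>(u, v) \<in> M_relations p n m. word_val H f u = word_val H f v) \<longleftrightarrow>
    f Gen_a [^]\<^bsub>H\<^esub> (p ^ n) = \<one>\<^bsub>H\<^esub> \<and> f Gen_b [^]\<^bsub>H\<^esub> (p ^ m) = \<one>\<^bsub>H\<^esub> \<and> f Gen_c [^]\<^bsub>H\<^esub> p = \<one>\<^bsub>H\<^esub> \<and>
    commutator H (f Gen_a) (f Gen_b) = f Gen_c \<and> commutator H (f Gen_c) (f Gen_a) = \<one>\<^bsub>H\<^esub> \<and>
    commutator H (f Gen_c) (f Gen_b) = \<one>\<^bsub>H\<^esub>"
proof -
  interpret H: group H by fact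
  have single: "word_val H f [(x, True)] = f x" for x by (simp add: assms(2))
  show ?thesis
    unfolding M_relations_def
    by (simp add: word_val_wpow[OF assms] word_val_wcomm[OF assms] single assms(2))
qed

text \<open>\<open>M_p(n,m,1)\<close> is the case \<open>P = p\<close> with all four exponents 0, so
  collection, normal forms and the model apply to it unchanged.\<close>

abbreviation M_pair :: "nat \<Rightarrow> nat \<Rightarrow> nat \<Rightarrow> ('a, 'b) monoid_scheme \<Rightarrow> 'a \<Rightarrow> 'a \<Rightarrow> bool" where
  "M_pair p n m G x y \<equiv> generating_pair G (int p ^ n) (int p ^ m) (int p) 0 0 0 0 x y"

lemma M_pair_iff:
  assumes "0 < p"
  shows "M_pair p n m G x y \<longleftrightarrow> group G \<and> x \<in> carrier G \<and> y \<in> carrier G \<and>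
    generate G {x, y} = carrier G \<and> commutator G x y [^]\<^bsub>G\<^esub> p = \<one>\<^bsub>G\<^esub> \<and>
    x [^]\<^bsub>G\<^esub> (p ^ n) = \<one>\<^bsub>G\<^esub> \<and> y [^]\<^bsub>G\<^esub> (p ^ m) = \<one>\<^bsub>G\<^esub> \<and>
    commutator G (commutator G x y) x = \<one>\<^bsub>G\<^esub> \<and> commutator G (commutator G x y) y = \<one>\<^bsub>G\<^esub>"
proof -
  have "pair_params (int p ^ n) (int p ^ m) (int p) 0 0 0 0"
    using assms by (simp add: pair_params_def)
  moreover have "g [^]\<^bsub>G\<^esub> (int p ^ k) = g [^]\<^bsub>G\<^esub> (p ^ k)" for g k
    by (simp add: int_pow_int flip: of_nat_power)
  ultimately show ?thesis
    unfolding generating_pair_def generating_pair_axioms_def commutator_pair_def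
      commutator_pair_axioms_def by (auto simp: int_pow_int)
qed

lemma M_group_pair:
  assumes "0 < p"
  obtains x y where "M_pair p n m (M_group p n m) x y"
proof -
  let ?G = "M_group p n m"
  have G: "group ?G" unfolding M_group_eq by (rule group_presented_group)
  define g where "g = gen_class (M_relations p n m)"
  have g: "g x \<in> carrier ?G" for x
    unfolding g_def M_group_eq by (rule gen_class_closed)
  have "\<forall>(u, v)\<in>M_relations p n m. word_val ?G g u = word_val ?G g v"
    unfolding g_def M_group_eq by (clarify, rule gen_class_relations)
  note rel = iffD1[OF M_relations_iff[OF G g] this]
  have "generate ?G {g Gen_a, g Gen_b, g Gen_c} = carrier ?G"
    unfolding range_gen[symmetric] unfolding g_def M_group_eq by (rule generate_gen_class)
  moreover have "g Gen_c = commutator ?G (g Gen_a) (g Gen_b)" using rel by simp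
  ultimately have "generate ?G {g Gen_a, g Gen_b} = carrier ?G"
    using group.generate_insert_commutator[OF G g g, of Gen_a Gen_b] by simp
  then have "M_pair p n m ?G (g Gen_a) (g Gen_b)"
    unfolding M_pair_iff[OF assms] using rel G g by auto
  then show thesis by (rule that)
qed

text \<open>With the order \<open>p\<close> of \<open>\<Phi>(G')\<close> this determines the order
  of \<open>G\<close>, on which uniqueness of normal forms rests.\<close>

lemma order_M_group:
  assumes "1 < p" "1 \<le> n" "1 \<le> m"
  shows "order (M_group p n m) = p ^ (n + m + 1)"
proof -
  let ?G = "M_group p n m"
  have p: "0 < p" using assms(1) by simp
  have dvd: "int p dvd int p ^ n" "int p dvd int p ^ m" using assms(2,3) by (simp_all add: dvd_power)
  interpret model_params "int p ^ n" "int p ^ m" "int p" 0 0 0 0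
    using p dvd by unfold_locales (simp_all add: trix_def)
  have nat: "nat (int p ^ n * int p ^ m * int p) = p ^ (n + m + 1)"
    by (simp add: power_add nat_mult_distrib nat_power_eq)
  obtain x y where xy: "M_pair p n m ?G x y" by (rule M_group_pair[OF p])
  note fin = generating_pair.finite_carrier[OF xy]
  have pair: "M_pair p n m model mod_a mod_b" by (rule generating_pair_model)
  note model = pair[unfolded M_pair_iff[OF p]]
  define f where "f = gen_map mod_a mod_b (commutator model mod_a mod_b)"
  have f: "f u \<in> carrier model" for u
    using model by (cases u) (auto simp: f_def group.commutator_closed)
  have rel: "\<forall>(u, v) \<in> M_relations p n m. word_val model f u = word_val model f v"
    using model by (intro iffD2[OF M_relations_iff[OF group_model f]]) (simp add: f_def)
  have gen: "generate model (range f) = carrier model"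
    unfolding range_gen using model group.generate_insert_commutator[OF group_model, of mod_a mod_b]
    by (simp add: f_def)
  have "\<exists>h \<in> hom ?G model. h ` carrier ?G = carrier model"
    unfolding M_group_eq by (rule presented_group_surj[OF group_model f _ gen]) (use rel in blast)
  then obtain h where "h ` carrier ?G = carrier model" by (rule bexE)
  then have "order model \<le> order ?G"
    unfolding order_def using card_image_le[OF fin, of h] by simp
  then show ?thesis
    using generating_pair.order_le[OF xy] unfolding order_model nat by simp
qed

section \<open>The Frattini subgroup: non-generators, and normality of
  \<open>\<Phi>(G')\<close>\<close>

lemma (in group) maximal_subgroup_exists:
  assumes "finite (carrier G)" "subgroup Z G" "Z \<noteq> carrier G"
  obtains M where "maximal_subgroup M G" "Z \<subseteq> M"
proof -
  define S where "S = {K. subgroup K G \<and> Z \<subseteq> K \<and> K \<noteq> carrier G}"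
  have "S \<subseteq> Pow (carrier G)" by (auto simp: S_def dest: subgroup.subset)
  then have "finite S" using assms(1) by (simp add: finite_subset)
  moreover have "Z \<in> S" using assms(2,3) by (simp add: S_def)
  ultimately obtain M where M: "M \<in> S" "Z \<subseteq> M" "\<forall>K\<in>S. M \<subseteq> K \<longrightarrow> M = K"
    using finite_has_maximal2[of S Z] by auto
  have "maximal_subgroup M G"
    unfolding maximal_subgroup_def
  proof (intro conjI allI impI)
    show "subgroup M G" "M \<noteq> carrier G" using M(1) by (auto simp: S_def)
    fix K assume K: "subgroup K G" "M \<subseteq> K"
    show "K = M \<or> K = carrier G"
    proof (rule disjCI)
      assume "K \<noteq> carrier G"
      then have "K \<in> S" using K M(2) by (auto simp: S_def)
      then show "K = M" using M(3) K(2) by blast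
    qed
  qed
  then show thesis using M(2) by (rule that)
qed

text \<open>A proper \<open>Z\<close> lies in a maximal subgroup, which contains the Frattini
  subgroup as well, so the products could not fill the group.\<close>

lemma (in group) frattini_nongenerators:
  assumes "finite (carrier G)" "subgroup Z G"
    and "\<And>d. d \<in> carrier G \<Longrightarrow> \<exists>f\<in>frattini G. \<exists>z\<in>Z. d = f \<otimes> z"
  shows "Z = carrier G"
proof (rule ccontr)
  assume "Z \<noteq> carrier G"
  then obtain M where M: "maximal_subgroup M G" "Z \<subseteq> M"
    by (rule maximal_subgroup_exists[OF assms(1,2)])
  have sub: "subgroup M G" and proper: "M \<noteq> carrier G" using M(1) by (auto simp: maximal_subgroup_def)
  have "frattini G \<subseteq> M" using M(1) by (auto simp: frattini_def)
  then have "carrier G \<subseteq> M"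
    using assms(3) M(2) subgroup.m_closed[OF sub] by blast
  then show False using proper subgroup.subset[OF sub] by blast
qed

lemma (in group) subgroup_frattini: "subgroup (frattini G) G"
proof -
  have "frattini G = \<Inter>(insert (carrier G) {M. maximal_subgroup M G})" by (simp add: frattini_def)
  moreover have "subgroup (\<Inter>(insert (carrier G) {M. maximal_subgroup M G})) G"
    by (rule subgroups_Inter) (auto simp: maximal_subgroup_def subgroup_self)
  ultimately show ?thesis by simp
qed

lemma (in group) subgroup_frattini_derived: "subgroup (frattini_derived G) G"
  and frattini_derived_subset: "frattini_derived G \<subseteq> derived_subgroup G"
proof -
  have D: "subgroup (derived_subgroup G) G" by (rule derived_is_subgroup) simp
  then interpret D: group "G\<lparr>carrier := derived_subgroup G\<rparr>" by (rule subgroup_imp_group)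
  show "subgroup (frattini_derived G) G"
    unfolding frattini_derived_def by (rule incl_subgroup[OF D D.subgroup_frattini])
  show "frattini_derived G \<subseteq> derived_subgroup G"
    by (auto simp: frattini_derived_def frattini_def)
qed

lemma (in group) commutator_in_G3:
  "x \<in> derived_subgroup G \<Longrightarrow> y \<in> carrier G \<Longrightarrow> commutator G x y \<in> G3 G"
  unfolding G3_def commutator_subgroup_def by (rule generate.incl) blast

text \<open>\<open>x h x^-1 = h [h, x^-1]\<close>, and the commutator lies in \<open>G_3\<close>
  because \<open>h\<close> lies in \<open>G'\<close>.\<close>

lemma (in group) normal_frattini_derived:
  assumes "G3 G \<subseteq> frattini_derived G"
  shows "frattini_derived G \<lhd> G"
  unfolding normal_inv_iff
proof (intro conjI ballI)
  show sub: "subgroup (frattini_derived G) G" by (rule subgroup_frattini_derived)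
  fix x h assume x: "x \<in> carrier G" and h: "h \<in> frattini_derived G"
  have h': "h \<in> carrier G" using subgroup.mem_carrier[OF sub h] .
  have "commutator G h (inv x) \<in> frattini_derived G"
    using commutator_in_G3[of h "inv x"] assms x h frattini_derived_subset by auto
  then have "h \<otimes> commutator G h (inv x) \<in> frattini_derived G" by (rule subgroup.m_closed[OF sub h])
  moreover have "h \<otimes> commutator G h (inv x) = x \<otimes> h \<otimes> inv x"
    using x h' by (simp add: commutator_def m_assoc inv_solve_left)
      (metis h' inv_closed m_assoc m_closed r_inv l_one)
  ultimately show "x \<otimes> h \<otimes> inv x \<in> frattini_derived G" by simp
qed

lemma (in group) commutator_in_derived:
  assumes "x \<in> carrier G" "y \<in> carrier G"
  shows "commutator G x y \<in> derived_subgroup G"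
proof -
  have "commutator G x y = inv x \<otimes> inv y \<otimes> inv (inv x) \<otimes> inv (inv y)"
    using assms by (simp add: commutator_def)
  then show ?thesis
    unfolding derived_def using assms by (intro generate.incl) (use inv_closed in blast)
qed

text \<open>The product \<open>b^(p^m) a\<close> is computed by collection and by replacing
  \<open>b^(p^m)\<close> with \<open>c^(pj)\<close>, which commutes with \<open>a\<close>. Its
  normal form is unique, so the power of \<open>c\<close> from the collection is trivial.\<close>

lemma (in full_pair) sq_dvd_trix_M: "int p ^ 2 dvd trix (int p * s) (int p ^ m)"
proof -
  define t where "t = trix (int p * s) (int p ^ m)"
  have "\<phi> (0, int p ^ m, 0) \<otimes> \<phi> (1, 0, 0) = \<phi> (0, 0, int p * j) \<otimes> \<phi> (1, 0, 0)"
    using phi_NM[of 0 1 0] by simp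
  then have "\<phi> (1, int p ^ m, - t) = \<phi> (1, 0, int p * j * (1 + int p * r))"
    unfolding phi_mult tmult.simps by (simp add: t_def)
  then have "sim (1, int p ^ m, - t) (1, 0, int p * j * (1 + int p * r))" by (rule sim_if_phi_eq)
  then obtain k l where kl: "(1::int) = 1 + int p ^ n * k" "0 = int p ^ m + int p ^ m * l"
    "int p ^ 2 dvd int p * j * (1 + int p * r) - - t + int p * i * k + int p * j * l"
    by auto
  have "int p ^ m * (1 + l) = 0" using kl(2) by (simp add: algebra_simps)
  then have "k = 0" "l = - 1" using kl(1) p_pos by auto
  then have "int p ^ 2 dvd t + int p ^ 2 * (j * r)"
    using kl(3) by (simp add: algebra_simps power2_eq_square)
  then show ?thesis unfolding t_def[symmetric] by (simp add: dvd_add_left_iff)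
qed

text \<open>Divided by \<open>p\<close>, the preceding condition is
  \<open>1 + s binom(p, 2) = 0\<close> modulo \<open>p\<close>; for odd \<open>p\<close> the
  binomial vanishes and leaves \<open>1 = 0\<close>.\<close>

lemma (in full_pair) m_eq_1:
  assumes "m = 1"
  shows "p = 2 \<and> odd s"
proof -
  obtain q where "trix (int p * s) (int p ^ m) = int p ^ 2 * q" using sq_dvd_trix_M by blast
  then have "int p * (1 + s * tri (int p)) = int p * (int p * q)"
    unfolding assms by (simp add: trix_def algebra_simps power2_eq_square)
  then have e: "1 + s * tri (int p) = int p * q" using p_pos by simp
  have "\<not> int p dvd tri (int p)"
  proof
    assume "int p dvd tri (int p)"
    then have "int p dvd int p * q - s * tri (int p)" by simp
    then show False unfolding e[symmetric] using not_prime_dvd_1[OF prime_p] by simp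
  qed
  moreover have "int p dvd 2 * tri (int p)" unfolding two_tri by simp
  ultimately have "int p dvd 2" using prime_p by (simp add: prime_dvd_mult_iff)
  then have p: "p = 2"
    using prime_p by (metis int_dvd_int_iff of_nat_numeral primes_dvd_imp_eq two_is_prime_nat)
  have "tri 2 = 1" by (simp add: tri_def)
  then have "1 + s = 2 * q" using e p by simp
  then show ?thesis using p by presburger
qed

text \<open>What holds in the quotient holds for the lifts up to a factor in \<open>F\<close>. Once
  \<open>G'\<close> is known to be the cyclic group of \<open>C\<close>, \<open>F\<close> consists
  of powers of \<open>C^p\<close>, and these factors supply \<open>i\<close>, \<open>j\<close>,
  \<open>r\<close>, \<open>s\<close>.\<close>

lemma (in group) full_pair_exists:
  assumes pr: "Factorial_Ring.prime p" and fin: "finite (carrier G)" and nm: "1 \<le> n" "1 \<le> m"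
    and G3: "G3 G \<subseteq> frattini_derived G"
    and iso1: "G\<lparr>carrier := frattini_derived G\<rparr> \<cong> integer_mod_group p"
    and iso2: "G Mod frattini_derived G \<cong> M_group p n m"
  shows "\<exists>a b i j r s. full_pair p n m i j r s G a b"
proof -
  define F where "F = frattini_derived G"
  define D where "D = derived_subgroup G"
  define Q where "Q = G Mod F"
  have p: "0 < p" "1 < p" using prime_gt_0_nat[OF pr] prime_gt_1_nat[OF pr] by auto
  have F: "F \<lhd> G" unfolding F_def by (rule normal_frattini_derived[OF G3])
  interpret F: normal F G by (rule F)
  have D: "subgroup D G" unfolding D_def by (rule derived_is_subgroup) simp
  have FD: "F \<subseteq> D" unfolding F_def D_def by (rule frattini_derived_subset)
  have Q: "group Q" unfolding Q_def by (rule F.factorgroup_is_group)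
  interpret Q: group Q by (rule Q)
  define \<pi> where "\<pi> = (\<lambda>g. F #> g)"
  have \<pi>_hom: "\<pi> \<in> hom G Q" unfolding \<pi>_def Q_def by (rule F.r_coset_hom_Mod)
  interpret \<pi>: group_hom G Q \<pi> by unfold_locales (rule \<pi>_hom)
  have \<pi>_surj: "\<exists>g\<in>carrier G. z = \<pi> g" if "z \<in> carrier Q" for z
    using that unfolding Q_def carrier_FactGroup \<pi>_def by blast
  have \<pi>_eq: "\<exists>f\<in>F. g = f \<otimes> h" if "g \<in> carrier G" "h \<in> carrier G" "\<pi> g = \<pi> h" for g h
    using repr_independenceD[OF F.subgroup_axioms that(1)] that(3) by (auto simp: \<pi>_def r_coset_def)
  have \<pi>_one: "g \<in> F" if "g \<in> carrier G" "\<pi> g = \<one>\<^bsub>Q\<^esub>" for g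
    using \<pi>_eq[of g \<one>] that by auto
  have card_F: "card F = p"
  proof -
    obtain h where "h \<in> iso (G\<lparr>carrier := F\<rparr>) (integer_mod_group p)"
      using iso1 by (auto simp: F_def is_iso_def)
    then have "bij_betw h F (carrier (integer_mod_group p))" by (simp add: iso_def)
    then show ?thesis using p by (auto dest: bij_betw_same_card simp: carrier_integer_mod_group)
  qed
  have M: "group (M_group p n m)" unfolding M_group_eq by (rule group_presented_group)
  have "M_group p n m \<cong> Q" using iso2 Q.iso_sym by (simp add: Q_def F_def)
  then obtain h where h: "h \<in> iso (M_group p n m) Q" by (auto simp: is_iso_def)
  obtain x y where "M_pair p n m (M_group p n m) x y" by (rule M_group_pair[OF p(1)])
  then have pair: "M_pair p n m Q (h x) (h y)" by (rule generating_pair_iso[OF _ h Q])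
  have order_Q: "order Q = p ^ (n + m + 1)"
    using bij_betw_same_card[of h "carrier (M_group p n m)" "carrier Q"] h order_M_group[OF p(2) nm]
    by (simp add: iso_def order_def)
  have order_G: "order G = p ^ (n + m + 2)"
    using lagrange[OF F.subgroup_axioms] order_Q card_F by (simp add: Q_def FactGroup_def order_def mult.commute)
  have hxy: "h x \<in> carrier Q" "h y \<in> carrier Q" using pair unfolding M_pair_iff[OF p(1)] by simp_all
  from \<pi>_surj[OF hxy(1)] obtain A where A: "A \<in> carrier G" "h x = \<pi> A" by (rule bexE)
  from \<pi>_surj[OF hxy(2)] obtain B where B: "B \<in> carrier G" "h y = \<pi> B" by (rule bexE)
  interpret QP: generating_pair Q "int p ^ n" "int p ^ m" "int p" 0 0 0 0 "\<pi> A" "\<pi> B"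
    using pair unfolding A(2) B(2) .
  define C where "C = commutator G A B"
  have C: "C \<in> carrier G" using A(1) B(1) by (simp add: C_def)
  have comm_hom: "commutator Q (\<pi> u) (\<pi> v) = \<pi> (commutator G u v)" if "u \<in> carrier G" "v \<in> carrier G" for u v
    using that by (simp add: commutator_def)
  have \<pi>C: "commutator Q (\<pi> A) (\<pi> B) = \<pi> C" unfolding C_def by (rule comm_hom[OF A(1) B(1)])
  have pow_hom: "\<pi> (g [^] k) = \<pi> g [^]\<^bsub>Q\<^esub> k" if "g \<in> carrier G" for g and k :: int
    using that by (rule \<pi>.hom_int_pow)
  have coords: "\<exists>f\<in>F. \<exists>(x::int) (y::int) (w::int). g = f \<otimes> (A [^] x \<otimes> B [^] y \<otimes> C [^] w)" if g: "g \<in> carrier G" for g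
  proof -
    have "\<pi> g \<in> range QP.\<phi>" using g QP.carrier_eq \<pi>.hom_closed by simp
    then obtain x y w where "\<pi> g = QP.\<phi> (x, y, w)" by auto
    then have eq: "\<pi> g = \<pi> (A [^] x \<otimes> B [^] y \<otimes> C [^] w)"
      using A(1) B(1) C by (simp add: \<pi>C pow_hom)
    have cl: "A [^] x \<otimes> B [^] y \<otimes> C [^] w \<in> carrier G" using A(1) B(1) C by simp
    from \<pi>_eq[OF g cl eq] show ?thesis by blast
  qed
  \<comment> \<open>The preimage of the cyclic group of \<open>\<pi> C\<close>. It contains
    \<open>G'\<close>, because every commutator in the quotient is a power of
    \<open>\<pi> C\<close>.\<close>
  define K where "K = {g \<in> carrier G. \<exists>w::int. \<pi> g = \<pi> C [^]\<^bsub>Q\<^esub> w}"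
  have K: "subgroup K G"
  proof (rule subgroupI)
    show "K \<subseteq> carrier G" by (auto simp: K_def)
    have "C \<in> K" using C \<pi>.hom_closed[OF C] by (auto simp: K_def intro!: exI[of _ 1])
    then show "K \<noteq> {}" by blast
    fix g assume "g \<in> K"
    then obtain w :: int where w: "g \<in> carrier G" "\<pi> g = \<pi> C [^]\<^bsub>Q\<^esub> w" by (auto simp: K_def)
    then have "\<pi> (inv g) = \<pi> C [^]\<^bsub>Q\<^esub> (- w)" using C by (simp add: Q.int_pow_neg)
    then show "inv g \<in> K" using w(1) by (auto simp: K_def)
    fix g' assume "g' \<in> K"
    then obtain w' :: int where w': "g' \<in> carrier G" "\<pi> g' = \<pi> C [^]\<^bsub>Q\<^esub> w'" by (auto simp: K_def)
    then have "\<pi> (g \<otimes> g') = \<pi> C [^]\<^bsub>Q\<^esub> (w + w')" using w C by (simp add: Q.int_pow_mult)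
    then show "g \<otimes> g' \<in> K" using w(1) w'(1) by (auto simp: K_def)
  qed
  have DK: "D \<subseteq> K"
    unfolding D_def derived_def
  proof (rule generate_subgroup_incl[OF _ K], safe)
    fix u v assume uv: "u \<in> carrier G" "v \<in> carrier G"
    \<comment> \<open>\<open>derived\<close> is built from \<open>u v u^-1 v^-1\<close>, the
      commutator of the inverses in the present convention.\<close>
    have e: "u \<otimes> v \<otimes> inv u \<otimes> inv v = commutator G (inv u) (inv v)"
      using uv by (simp add: commutator_def)
    obtain q1 where q1: "\<pi> (inv u) = QP.\<phi> q1" using uv QP.carrier_eq \<pi>.hom_closed[of "inv u"] by auto
    obtain q2 where q2: "\<pi> (inv v) = QP.\<phi> q2" using uv QP.carrier_eq \<pi>.hom_closed[of "inv v"] by auto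
    have "\<exists>w::int. \<pi> (commutator G (inv u) (inv v)) = \<pi> C [^]\<^bsub>Q\<^esub> w"
      using QP.commutator_phi[of q1 q2] unfolding q1[symmetric] q2[symmetric] \<pi>C
      using comm_hom[of "inv u" "inv v"] uv by auto
    then show "u \<otimes> v \<otimes> inv u \<otimes> inv v \<in> K" unfolding e K_def using uv by simp
  qed
  have CD: "C \<in> D" unfolding C_def D_def by (rule commutator_in_derived[OF A(1) B(1)])
  define Z where "Z = range (\<lambda>w::int. C [^] w)"
  have Z: "subgroup Z G"
    unfolding Z_def using generate_pow[OF C] generate_is_subgroup[of "{C}"] C by (simp add: full_SetCompr_eq)
  have ZD: "Z \<subseteq> D" unfolding Z_def using subgroup_int_pow_closed[OF D CD] by blast
  interpret GD: group "G\<lparr>carrier := D\<rparr>" by (rule subgroup_imp_group[OF D])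
  have D_eq: "Z = D"
  proof -
    have "Z = carrier (G\<lparr>carrier := D\<rparr>)"
    proof (rule GD.frattini_nongenerators)
      show "finite (carrier (G\<lparr>carrier := D\<rparr>))"
        using fin subgroup.subset[OF D] by (simp add: finite_subset)
      show "subgroup Z (G\<lparr>carrier := D\<rparr>)" by (rule subgroup_incl[OF Z D ZD])
      fix d assume "d \<in> carrier (G\<lparr>carrier := D\<rparr>)"
      then have d: "d \<in> K" using DK by auto
      then obtain w :: int where w: "d \<in> carrier G" "\<pi> d = \<pi> (C [^] w)" by (auto simp: K_def pow_hom[OF C])
      obtain f where "f \<in> F" "d = f \<otimes> C [^] w" using \<pi>_eq[OF w(1) _ w(2)] C by auto
      then show "\<exists>f\<in>frattini (G\<lparr>carrier := D\<rparr>). \<exists>z\<in>Z. d = f \<otimes>\<^bsub>G\<lparr>carrier := D\<rparr>\<^esub> z"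
        unfolding Z_def F_def frattini_derived_def D_def[symmetric] by auto
    qed
    then show ?thesis by simp
  qed
  have F_pow: "f [^] (int p) = \<one>" if "f \<in> F" for f
  proof -
    interpret GF: group "G\<lparr>carrier := F\<rparr>" by (rule subgroup_imp_group[OF F.subgroup_axioms])
    have "f [^]\<^bsub>G\<lparr>carrier := F\<rparr>\<^esub> order (G\<lparr>carrier := F\<rparr>) = \<one>"
      using GF.pow_order_eq_1[of f] that by simp
    then show ?thesis
      using int_pow_consistent[OF F.subgroup_axioms that, of "int p"] card_F by (simp add: order_def int_pow_int)
  qed
  have CpF: "C [^] (int p) \<in> F"
  proof (rule \<pi>_one)
    show "\<pi> (C [^] int p) = \<one>\<^bsub>Q\<^esub>" unfolding pow_hom[OF C] using QP.c_pow_P unfolding \<pi>C .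
  qed (simp add: C)
  have C_notin_F: "C \<notin> F"
  proof
    assume "C \<in> F"
    then have "\<pi> C = \<one>\<^bsub>Q\<^esub>" unfolding \<pi>_def Q_def one_FactGroup by (rule coset_join2[OF C F.subgroup_axioms])
    then have "QP.\<phi> (0, 0, 1) = QP.\<phi> (0, 0, 0)" by (simp add: \<pi>C)
    moreover have "nat (int p ^ n * int p ^ m * int p) = p ^ (n + m + 1)"
      by (simp add: power_add nat_mult_distrib nat_power_eq)
    ultimately have "QP.sim (0, 0, 1) (0, 0, 0)" using QP.phi_eq_iff order_Q by (simp del: QP.\<phi>.simps tequiv.simps)
    then have "int p dvd 1" by auto
    then show False using not_prime_dvd_1[OF pr] by simp
  qed
  \<comment> \<open>A power of \<open>C\<close> with exponent prime to \<open>p\<close>, together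
    with \<open>C^p\<close>, would put \<open>C\<close> itself into \<open>F\<close>.\<close>
  have pF: "int p dvd w" if w: "C [^] w \<in> F" for w :: int
  proof (rule ccontr)
    assume "\<not> int p dvd w"
    then obtain v k where v: "w * v = 1 + int p * k" by (rule obtain_inverse[OF pr])
    have "(C [^] w) [^] v \<otimes> (C [^] int p) [^] (- k) \<in> F"
      by (rule F.m_closed[OF subgroup_int_pow_closed[OF F.subgroup_axioms w] subgroup_int_pow_closed[OF F.subgroup_axioms CpF]])
    moreover have "(C [^] w) [^] v \<otimes> (C [^] int p) [^] (- k) = C [^] (w * v + int p * (- k))"
      using C by (simp only: int_pow_pow int_pow_mult)
    ultimately show False using C_notin_F C by (simp add: v)
  qed
  have F_form: "\<exists>k. f = C [^] (int p * k)" if "f \<in> F" for f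
  proof -
    have "f \<in> Z" using that FD unfolding D_eq by (rule subsetD[rotated])
    then obtain w :: int where w: "f = C [^] w" unfolding Z_def by (rule rangeE)
    have "int p dvd w" using that unfolding w by (rule pF)
    then show ?thesis unfolding w by (elim dvdE) (rule exI, rule arg_cong)
  qed
  have Cp: "C [^] (int p) \<noteq> \<one>"
  proof
    assume 1: "C [^] (int p) = \<one>"
    have "f = \<one>" if "f \<in> F" for f
      using F_form[OF that] C by (auto simp: 1 simp flip: int_pow_pow)
    then have "F \<subseteq> {\<one>}" by blast
    then have "card F \<le> 1" using card_mono[of "{\<one>}" F] by simp
    then show False using card_F p by simp
  qed
  obtain i where i: "A [^] (int p ^ n) = C [^] (int p * i)"
  proof -
    have "\<pi> (A [^] (int p ^ n)) = \<one>\<^bsub>Q\<^esub>" unfolding pow_hom[OF A(1)] using QP.a_pow_N by simp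
    then show thesis using that F_form \<pi>_one A(1) by (meson int_pow_closed)
  qed
  obtain j where j: "B [^] (int p ^ m) = C [^] (int p * j)"
  proof -
    have "\<pi> (B [^] (int p ^ m)) = \<one>\<^bsub>Q\<^esub>" unfolding pow_hom[OF B(1)] using QP.b_pow_M by simp
    then show thesis using that F_form \<pi>_one B(1) by (meson int_pow_closed)
  qed
  have G3_form: "\<exists>k. commutator G C g = C [^] (int p * k)" if "g \<in> carrier G" for g
    using commutator_in_G3[of C g] CD that G3 F_form unfolding D_def F_def by blast
  obtain r where r: "commutator G C A = C [^] (int p * r)" using G3_form[OF A(1)] by blast
  obtain s where s: "commutator G C B = C [^] (int p * s)" using G3_form[OF B(1)] by blast
  have C2: "C [^] (int p ^ 2) = \<one>"
    using F_pow[OF CpF] C by (simp add: int_pow_pow power2_eq_square)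
  have gen: "generate G {A, B} = carrier G"
  proof
    have sub: "{A, B} \<subseteq> carrier G" using A(1) B(1) by simp
    show "generate G {A, B} \<subseteq> carrier G" by (rule generate_incl[OF sub])
    have inA: "A \<in> generate G {A, B}" "B \<in> generate G {A, B}" by (auto intro: generate.incl)
    then have inC: "C \<in> generate G {A, B}" unfolding C_def by (rule commutator_in_generate[OF _ _ sub])
    show "carrier G \<subseteq> generate G {A, B}"
    proof
      fix g assume "g \<in> carrier G"
      then obtain f x y w where f: "f \<in> F" "g = f \<otimes> (A [^] (x::int) \<otimes> B [^] (y::int) \<otimes> C [^] (w::int))" using coords by blast
      obtain k where "f = C [^] (int p * k)" using F_form[OF f(1)] by blast
      then show "g \<in> generate G {A, B}"
        unfolding f(2) using inA inC sub by (simp add: generate.eng int_pow_in_generate)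
    qed
  qed
  have "has_pair p G A B n m i j r s"
    unfolding has_pair_iff[OF p(1)] C_def[symmetric]
    using is_group A(1) B(1) gen C2 i j r s by blast
  then have "full_pair p n m i j r s G A B" using pr order_G by (rule full_pair.intro)
  then show ?thesis by blast
qed

theorem theorem3p5:
  fixes p :: nat
  assumes "Factorial_Ring.prime p"
  shows "(\<forall>(G :: ('a, 'b) monoid_scheme) n m.
            finite_p_group p G \<and>
            m \<ge> 1 \<and> n \<ge> m \<and> (p = 2 \<longrightarrow> n > 1) \<and>
            G3 G \<subseteq> frattini_derived G \<and>
            G\<lparr>carrier := frattini_derived G\<rparr> \<cong> integer_mod_group p \<and>
            G Mod frattini_derived G \<cong> M_group p n m
            \<longrightarrow> (\<exists>L. admissible p L \<and> has_params n m L \<and> G \<cong> listed_group p L))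
       \<and> (\<forall>L L'. admissible p L \<and> admissible p L' \<and> L \<noteq> L'
            \<longrightarrow> \<not> listed_group p L \<cong> listed_group p L')"
proof (intro conjI allI impI; elim conjE)
  fix G :: "('a, 'b) monoid_scheme" and n m
  assume G: "finite_p_group p G" and nm: "m \<ge> 1" "n \<ge> m" "p = 2 \<longrightarrow> n > 1"
    and G3: "G3 G \<subseteq> frattini_derived G"
    and iso: "G\<lparr>carrier := frattini_derived G\<rparr> \<cong> integer_mod_group p" "G Mod frattini_derived G \<cong> M_group p n m"
  interpret group G using G by (simp add: finite_p_group_def)
  have fin: "finite (carrier G)" using G by (simp add: finite_p_group_def)
  have "1 \<le> n" using nm by simp
  then obtain a b i j r s where "full_pair p n m i j r s G a b"
    using full_pair_exists[OF assms fin _ nm(1) G3 iso] by blast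
  then interpret full_pair p n m i j r s G a b .
  \<comment> \<open>If \<open>m = 1\<close>, consistency forces \<open>p = 2\<close>, and there the
    hypothesis \<open>n > 1\<close> provides \<open>n \<ge> 2\<close>.\<close>
  have "m \<ge> 2 \<or> m = 1 \<and> p = 2 \<and> odd s"
    using nm(1) m_eq_1 by (cases "m = 1") auto
  moreover from this have "n \<ge> 2" using nm by auto
  ultimately show "\<exists>L. admissible p L \<and> has_params n m L \<and> G \<cong> listed_group p L"
    using nm(2) by (intro classification)
next
  fix L L' assume "admissible p L" "admissible p L'" "L \<noteq> L'"
  then show "\<not> listed_group p L \<cong> listed_group p L'"
    using listed_groups_not_iso[OF assms] by blast
qed

end
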